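(* There is a randomized algorithm which solves an instance $(G,\mathsf{in},\mathsf{out})$ of \textsc{Decision Unweighted Fixed Degree Connected Subgraph} in time $\mathcal{O}^*(2^n\mathrm{poly}(M))$ and polynomial space, where $n=|V(G)|$ and $M=\max_{v}\max\{\mathsf{in}(v),\mathsf{out}(v)\}$. The algorithm is Monte Carlo with one-sided error: a positive answer is always correct, and a negative answer is correct with probability at least $p$, for any constant $p<1$.
   Context: \textsc{Decision Unweighted Fixed Degree Connected Subgraph}: given a digraph $G=(V,E)$ (without multiple edges; single loops allowed) and $\mathsf{in},\mathsf{out}:V\to\mathbb{Z}_{\ge 0}$, decide whether there is $m:V^2\to\mathbb{Z}_{\ge 0}$ such that the support $G^\downarrow_m$ (the digraph on vertex set $V$ with edge $(u,v)$ iff $m(u,v)>0$) is a subgraph of $G$ that is connected (its underlying undirected graph is connected), and for every $v\in V$, $\sum_{u}m(u,v)=\mathsf{in}(v)$ and $\sum_{u}m(v,u)=\mathsf{out}(v)$. The notation $\mathcal{O}^*(\cdot)$ hides factors polynomial in $n$. *)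

theory Defs
  imports
    "HOL-Probability.SPMF"
    "HOL-Library.Log_Nat"
    "HOL-Computational_Algebra.Polynomial"
    "Graph_Theory.Graph_Theory"
begin

section \<open>The decision problem\<close>

text \<open>
  The type \<open>pair_pre_digraph\<close> has at most one arc between an ordered pair of vertices and
  permits loops.  The degree functions and the multiplicities matter only on the vertex set.
\<close>

definition support_graph :: "'a pair_pre_digraph \<Rightarrow> ('a \<Rightarrow> 'a \<Rightarrow> nat) \<Rightarrow> 'a pair_pre_digraph" where
  "support_graph G m =
     \<lparr> pverts = pverts G, parcs = {(u, v) \<in> pverts G \<times> pverts G. m u v > 0} \<rparr>"

definition fdcs_solution ::
    "'a pair_pre_digraph \<Rightarrow> ('a \<Rightarrow> nat) \<Rightarrow> ('a \<Rightarrow> nat) \<Rightarrow> ('a \<Rightarrow> 'a \<Rightarrow> nat) \<Rightarrow> bool" where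
  "fdcs_solution G d_in d_out m \<longleftrightarrow>
     subgraph (with_proj (support_graph G m)) (with_proj G) \<and>
     Digraph_Component.connected (with_proj (support_graph G m)) \<and>
     (\<forall>v \<in> pverts G. (\<Sum>u \<in> pverts G. m u v) = d_in v \<and> (\<Sum>u \<in> pverts G. m v u) = d_out v)"

definition fdcs_solvable :: "'a pair_pre_digraph \<Rightarrow> ('a \<Rightarrow> nat) \<Rightarrow> ('a \<Rightarrow> nat) \<Rightarrow> bool" where
  "fdcs_solvable G d_in d_out \<longleftrightarrow> (\<exists>m. fdcs_solution G d_in d_out m)"

definition max_degree :: "'a pair_pre_digraph \<Rightarrow> ('a \<Rightarrow> nat) \<Rightarrow> ('a \<Rightarrow> nat) \<Rightarrow> nat" where
  "max_degree G d_in d_out = Max ((\<lambda>v. max (d_in v) (d_out v)) ` pverts G)"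


section \<open>Randomized random-access machines with logarithmic cost\<close>

text \<open>
  Programs work on a fixed finite number of named arrays of unbounded natural numbers; a scalar
  variable is a cell of an array.  Since numbers are unbounded, every operation is charged for
  the number of binary digits of its operands.
\<close>

type_synonym store = "nat \<Rightarrow> nat \<Rightarrow> nat"

datatype aexp =
    Num nat
  | Cell nat aexp
  | Add aexp aexp
  | Sub aexp aexp
  | Mul aexp aexp
  | Div aexp aexp

datatype com =
    Skip
  | Assign nat aexp aexp  \<comment> \<open>\<open>Assign a i e\<close> is \<open>a[i] := e\<close>\<close>
  | Flip nat aexp         \<comment> \<open>\<open>Flip a i\<close> stores a fair random bit in \<open>a[i]\<close>\<close>
  | Seq com com
  | Cond aexp com com      \<comment> \<open>nonzero means true\<close>
  | While aexp com

abbreviation len :: "nat \<Rightarrow> nat" where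
  "len k \<equiv> floorlog 2 k"

primrec val :: "store \<Rightarrow> aexp \<Rightarrow> nat" where
  "val s (Num k) = k"
| "val s (Cell a e) = s a (val s e)"
| "val s (Add e f) = val s e + val s f"
| "val s (Sub e f) = val s e - val s f"
| "val s (Mul e f) = val s e * val s f"
| "val s (Div e f) = val s e div val s f"

primrec cost :: "store \<Rightarrow> aexp \<Rightarrow> nat" where
  "cost s (Num k) = 1 + len k"
| "cost s (Cell a e) = cost s e + 1 + len (val s e) + len (s a (val s e))"
| "cost s (Add e f) = cost s e + cost s f + 1 + len (val s e) + len (val s f)"
| "cost s (Sub e f) = cost s e + cost s f + 1 + len (val s e) + len (val s f)"
| "cost s (Mul e f) = cost s e + cost s f + (1 + len (val s e)) * (1 + len (val s f))"
| "cost s (Div e f) = cost s e + cost s f + (1 + len (val s e)) * (1 + len (val s f))"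

text \<open>
  A store is measured as the list of its nonzero cells, each with its index.  Stores reachable
  from an input have only finitely many of them.
\<close>

definition store_size :: "store \<Rightarrow> nat" where
  "store_size s = (\<Sum>(a, i) | s a i \<noteq> 0. 1 + len i + len (s a i))"

record config =
  store :: store
  steps :: nat
  peak :: nat

text \<open>
  An operation of cost \<open>k\<close> takes time \<open>k\<close> and needs at most \<open>k\<close> bits besides the current store:
  this covers intermediate results as well as the cell written by an assignment.
\<close>

definition charge :: "nat \<Rightarrow> config \<Rightarrow> config" where
  "charge k c = c\<lparr> steps := steps c + k, peak := max (peak c) (store_size (store c) + k) \<rparr>"

definition put :: "nat \<Rightarrow> nat \<Rightarrow> nat \<Rightarrow> config \<Rightarrow> config" where
  "put a i x c = c\<lparr> store := (store c)(a := (store c a)(i := x)) \<rparr>"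

partial_function (spmf) while_spmf :: "('s \<Rightarrow> bool) \<Rightarrow> ('s \<Rightarrow> 's spmf) \<Rightarrow> 's \<Rightarrow> 's spmf" where
  "while_spmf b f s = (if b s then bind_spmf (f s) (while_spmf b f) else return_spmf s)"

text \<open>
  The result is a subdistribution on final configurations; missing mass is the probability of
  nontermination.  Every loop test is charged, including the last one.  Every loop iteration has
  positive cost, so if no mass is missing and \<open>steps\<close> is bounded on the support, then every
  sequence of coin flips halts within that bound.
\<close>

primrec sem :: "com \<Rightarrow> config \<Rightarrow> config spmf" where
  "sem Skip c = return_spmf (charge 1 c)"
| "sem (Assign a i e) c =
     (let s = store c; j = val s i; x = val s e
      in return_spmf (put a j x (charge (cost s i + cost s e + 1 + len j + len x) c)))"
| "sem (Flip a i) c =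
     (let s = store c; j = val s i
      in map_spmf (\<lambda>b. put a j (of_bool b) (charge (cost s i + 2 + len j) c)) coin_spmf)"
| "sem (Seq p q) c = bind_spmf (sem p c) (sem q)"
| "sem (Cond e p q) c =
     (let s = store c; c' = charge (cost s e + 1) c
      in if val s e \<noteq> 0 then sem p c' else sem q c')"
| "sem (While e p) c =
     map_spmf (\<lambda>c. charge (cost (store c) e + 1) c)
       (while_spmf (\<lambda>c. val (store c) e \<noteq> 0)
          (\<lambda>c. sem p (charge (cost (store c) e + 1) c)) c)"


section \<open>Input and output\<close>

text \<open>
  A program sees a graph with vertex set \<open>{..<n}\<close>.  Array 0 holds \<open>n\<close>, array 1 the adjacency
  matrix in row-major order, arrays 2 and 3 the prescribed in- and out-degrees.  The answer is
  read off the first cell of array 4.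
\<close>

definition encodable :: "nat pair_pre_digraph \<Rightarrow> bool" where
  "encodable G \<longleftrightarrow> pair_fin_digraph G \<and> (\<exists>n \<ge> 1. pverts G = {..<n})"

definition input_store :: "nat pair_pre_digraph \<Rightarrow> (nat \<Rightarrow> nat) \<Rightarrow> (nat \<Rightarrow> nat) \<Rightarrow> store" where
  "input_store G d_in d_out =
     (let n = card (pverts G) in
      (\<lambda>_ _. 0)
        (0 := (\<lambda>i. if i = 0 then n else 0),
         1 := (\<lambda>i. if i < n * n \<and> (i div n, i mod n) \<in> parcs G then 1 else 0),
         2 := (\<lambda>v. if v < n then d_in v else 0),
         3 := (\<lambda>v. if v < n then d_out v else 0)))"

definition run ::
    "com \<Rightarrow> nat pair_pre_digraph \<Rightarrow> (nat \<Rightarrow> nat) \<Rightarrow> (nat \<Rightarrow> nat) \<Rightarrow> config spmf" where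
  "run P G d_in d_out =
     (let s = input_store G d_in d_out
      in sem P \<lparr> store = s, steps = 0, peak = store_size s \<rparr>)"

definition accepts :: "config \<Rightarrow> bool" where
  "accepts c \<longleftrightarrow> store c 4 0 \<noteq> 0"

text \<open>The number of bits of an instance, with the degrees written in binary.\<close>

definition input_size :: "nat pair_pre_digraph \<Rightarrow> (nat \<Rightarrow> nat) \<Rightarrow> (nat \<Rightarrow> nat) \<Rightarrow> nat" where
  "input_size G d_in d_out =
     card (pverts G) ^ 2 + (\<Sum>v \<in> pverts G. len (d_in v) + len (d_out v))"

end

theory Submission
  imports Defs "Jordan_Normal_Form.Determinant" "HOL-Library.Z2"
begin

text \<open>
  By Hall's theorem, all degrees may be lowered along an arc as long as no cut becomes too tight to
  accommodate a connected spanning subgraph on top of a flow; when this is no longer possible, the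
  total degree \<open>N\<close> of a solvable instance is at most \<open>n\<^sup>3\<close>.  After blowing up every vertex into slots
  according to its degrees, solutions become permutations of \<open>N\<close> slots whose arcs connect the graph.
  Give every pair of slots a random polynomial over \<open>GF(2)\<close>.  In characteristic \<open>2\<close> the permanent is
  a determinant, and summing it over all \<open>2 ^ (n - 1)\<close> cuts (only arcs that do not cross the cut are
  kept) cancels the disconnected permutations, because a graph with several components has an even
  number of uncut sets avoiding a fixed vertex.  By the Schwartz--Zippel bound, the remaining sum of
  monomials vanishes with small probability only.  Each determinant is computed as the top part of
  \<open>det (I + w\<^sup>D A)\<close>, which can be found modulo a power of \<open>w\<close> by elimination without pivots.
\<close>

section \<open>Connected flows and reduction of degrees\<close>

text \<open>The reduction of degrees is forced by the space bound: degrees are written in binary, so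
  one slot per unit of degree could take exponential space. Once the total is at most
  \<open>n ^ 3\<close>, only enumerations of vertex sets stay exponential. They are run through one
  at a time, costing a factor \<open>2 ^ n\<close> in time but no space; this includes the test
  whether an arc may be lowered. Lowering happens in unit steps, which is one source of the
  dependence on \<open>M\<close>.

  Schwartz--Zippel wants a large domain, the cancellation wants characteristic 2. The usual choice,
  a field with \<open>2 ^ k\<close> elements, requires an irreducible polynomial. Polynomials of
  degree below \<open>k\<close> in the domain GF(2)[w] serve as well, since the bound holds for any
  finite set of sample points in a domain. The price is that entries are not invertible and degrees
  grow; hence a truncated computation without division. The shift \<open>D\<close> is so large that
  the terms caused by adding the identity stay below degree \<open>N * D\<close>. With
  \<open>k = N + c\<close> random bits per entry the error \<open>N / 2 ^ k\<close> is at most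
  \<open>1 / 2 ^ c\<close>.\<close>

definition flow :: "'a set \<Rightarrow> 'a rel \<Rightarrow> ('a \<Rightarrow> nat) \<Rightarrow> ('a \<Rightarrow> nat) \<Rightarrow> ('a \<Rightarrow> 'a \<Rightarrow> nat) \<Rightarrow> bool" where
  "flow V E a b m \<longleftrightarrow> (\<forall>u v. 0 < m u v \<longrightarrow> (u, v) \<in> E) \<and>
     (\<forall>u\<in>V. (\<Sum>v\<in>V. m u v) = a u) \<and> (\<forall>v\<in>V. (\<Sum>u\<in>V. m u v) = b v)"

definition conn :: "'a set \<Rightarrow> 'a rel \<Rightarrow> bool" where
  "conn V S \<longleftrightarrow> (\<forall>u\<in>V. \<forall>v\<in>V. (u, v) \<in> (S \<union> S\<inverse>)\<^sup>*)"

definition conn_flow :: "'a set \<Rightarrow> 'a rel \<Rightarrow> ('a \<Rightarrow> nat) \<Rightarrow> ('a \<Rightarrow> nat) \<Rightarrow> bool" where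
  "conn_flow V E a b \<longleftrightarrow> (\<exists>m. flow V E a b m \<and> conn V {(u, v). 0 < m u v})"

abbreviation (input) dec :: "('a \<Rightarrow> nat) \<Rightarrow> 'a \<Rightarrow> 'a \<Rightarrow> nat" where
  "dec a u \<equiv> a(u := a u - 1)"

lemma sum_dec:
  assumes "finite X" "0 < a u"
  shows "sum a X = sum (dec a u) X + of_bool (u \<in> X)"
proof (cases "u \<in> X")
  case True
  have "sum a X = a u + sum a (X - {u})" using sum.remove[OF assms(1) True] .
  moreover have "sum (dec a u) X = (a u - 1) + sum (dec a u) (X - {u})"
    using sum.remove[OF assms(1) True, of "dec a u"] by simp
  moreover have "sum (dec a u) (X - {u}) = sum a (X - {u})" by (rule sum.cong) auto
  ultimately show ?thesis using assms(2) True by simp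
next
  case False
  then have "sum (dec a u) X = sum a X" by (intro sum.cong) auto
  with False show ?thesis by simp
qed

section \<open>Hall's condition for integral transport\<close>

lemma flow_add:
  assumes "flow V E a b m" "flow V E a' b' m'"
  shows "flow V E (\<lambda>u. a u + a' u) (\<lambda>v. b v + b' v) (\<lambda>u v. m u v + m' u v)"
  using assms unfolding flow_def by (auto simp: sum.distrib)

lemma flow_cong:
  assumes "flow V E a b m" "\<And>u. u \<in> V \<Longrightarrow> a u = a' u" "\<And>v. v \<in> V \<Longrightarrow> b v = b' v"
  shows "flow V E a' b' m"
  using assms unfolding flow_def by auto

lemma flow_single:
  assumes "finite V" "u \<in> V" "v \<in> V" "(u, v) \<in> E"
  shows "flow V E (\<lambda>x. of_bool (x = u)) (\<lambda>x. of_bool (x = v)) (\<lambda>x y. of_bool (x = u \<and> y = v))"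
  using assms unfolding flow_def
  by (auto simp: of_bool_def if_distrib sum.If_cases)

lemma flow_inc:
  assumes "finite V" "u \<in> V" "v \<in> V" "(u, v) \<in> E" "0 < a u" "0 < b v"
    and "flow V E (dec a u) (dec b v) m"
  shows "flow V E a b (\<lambda>x y. m x y + of_bool (x = u \<and> y = v))"
  using assms by (intro flow_cong[OF flow_add[OF assms(7) flow_single[OF assms(1-4)]]]) auto

text \<open>Hall's theorem by induction on the total supply. Tight sets avoiding a vertex
  \<open>u\<close> with positive supply are closed under union, so there is a largest one,
  \<open>T\<close>. Hall's condition for \<open>insert u T\<close> yields an arc from
  \<open>u\<close> to some \<open>v\<close> with positive demand outside the image of
  \<open>T\<close>. Sending one unit along it can only hurt a tight set that avoids \<open>u\<close>
  and has \<open>v\<close> in its image; no such set exists, because they all lie in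
  \<open>T\<close>.\<close>

lemma transport_exists:
  assumes "finite V" "E \<subseteq> V \<times> V" "sum a V = sum b V"
    and "\<And>X. X \<subseteq> V \<Longrightarrow> sum a X \<le> sum b (E `` X)"
  shows "\<exists>m. flow V E a b m"
  using assms(3,4)
proof (induction "sum a V" arbitrary: a b)
  case 0
  then have "\<forall>u\<in>V. a u = 0" "\<forall>v\<in>V. b v = 0" using assms(1) by auto
  then have "flow V E a b (\<lambda>_ _. 0)" by (auto simp: flow_def)
  then show ?case by blast
next
  case (Suc k)
  have fin: "finite X" if "X \<subseteq> V" for X using that assms(1) finite_subset by blast
  have im: "E `` X \<subseteq> V" for X using assms(2) by auto
  from Suc.hyps(2) obtain u where u: "u \<in> V" "0 < a u"
    by (metis gr0I sum.neutral nat.distinct(1))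
  define tight where "tight X \<longleftrightarrow> X \<subseteq> V \<and> u \<notin> X \<and> sum a X = sum b (E `` X)" for X
  \<comment> \<open>Supply is modular, and the demand of images is submodular because the image of
    an intersection lies in the intersection of the images. Two tight sets therefore leave no slack
    for their union.\<close>
  have tight_Un: "tight (X \<union> Y)" if "tight X" "tight Y" for X Y
  proof -
    have sub: "X \<subseteq> V" "Y \<subseteq> V" "u \<notin> X \<union> Y" using that by (auto simp: tight_def)
    have "sum a (X \<union> Y) + sum a (X \<inter> Y) = sum a X + sum a Y"
      using sub fin by (simp add: sum.union_inter)
    moreover have "sum b (E `` X \<union> E `` Y) + sum b (E `` X \<inter> E `` Y) = sum b (E `` X) + sum b (E `` Y)"
      by (rule sum.union_inter) (use im fin in auto)
    moreover have "sum a (X \<inter> Y) \<le> sum b (E `` (X \<inter> Y))" using sub by (intro Suc.prems) auto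
    moreover have "sum b (E `` (X \<inter> Y)) \<le> sum b (E `` X \<inter> E `` Y)"
      by (rule sum_mono2) (use im fin in auto)
    moreover have "sum a (X \<union> Y) \<le> sum b (E `` (X \<union> Y))" using sub by (intro Suc.prems) auto
    ultimately show ?thesis using that sub by (auto simp: tight_def Image_Un)
  qed
  have "tight {}" by (simp add: tight_def)
  moreover have "\<forall>X. tight X \<longrightarrow> card X \<le> card V" using assms(1) by (auto simp: tight_def card_mono)
  ultimately obtain T where T: "tight T" "\<And>X. tight X \<Longrightarrow> card X \<le> card T"
    using ex_has_greatest_nat[of tight "{}" card "Suc (card V)"] by (metis less_Suc_eq_le)
  have maxT: "X \<subseteq> T" if "tight X" for X
  proof -
    have "card (T \<union> X) \<le> card T" using T tight_Un that by blast
    moreover have "finite (T \<union> X)" using T(1) that fin by (auto simp: tight_def)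
    ultimately have "T \<union> X = T" by (metis card_seteq inf_sup_ord(3))
    then show ?thesis by auto
  qed
  have Tu: "u \<notin> T" "T \<subseteq> V" "sum a T = sum b (E `` T)" using T(1) by (auto simp: tight_def)
  \<comment> \<open>Otherwise adding \<open>u\<close> to \<open>T\<close> would raise the supply
    without raising the demand of the image.\<close>
  have "\<exists>v\<in>E `` {u} - E `` T. 0 < b v"
  proof (rule ccontr)
    assume "\<not> ?thesis"
    then have "sum b (E `` {u} - E `` T) = 0" by auto
    moreover have "sum b (E `` insert u T) = sum b (E `` T) + sum b (E `` {u} - E `` T)"
      by (subst sum.union_disjoint[symmetric]) (use im fin in \<open>auto intro!: arg_cong[where f="sum b"]\<close>)
    moreover have "sum a (insert u T) \<le> sum b (E `` insert u T)" using Tu u by (intro Suc.prems) auto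
    ultimately show False using Tu u fin by simp
  qed
  then obtain v where v: "(u, v) \<in> E" "v \<notin> E `` T" "0 < b v" by auto
  have vV: "v \<in> V" using v assms(2) by auto
  have sa: "sum a X = sum (dec a u) X + of_bool (u \<in> X)" if "X \<subseteq> V" for X
    using sum_dec[of X a u] fin[OF that] u by simp
  have sb: "sum b X = sum (dec b v) X + of_bool (v \<in> X)" if "X \<subseteq> V" for X
    using sum_dec[of X b v] fin[OF that] v by simp
  have "\<exists>m. flow V E (dec a u) (dec b v) m"
  proof (rule Suc.hyps(1))
    show "k = sum (dec a u) V" using sa[of V] Suc.hyps(2) u by simp
    show "sum (dec a u) V = sum (dec b v) V" using sa[of V] sb[of V] Suc.prems u vV by simp
    fix X assume X: "X \<subseteq> V"
    have le: "sum a X \<le> sum b (E `` X)" using X Suc.prems by auto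
    have "sum a X < sum b (E `` X)" if "u \<notin> X" "v \<in> E `` X"
    proof (rule ccontr)
      assume "\<not> ?thesis"
      then have "tight X" using le that X by (simp add: tight_def)
      then show False using maxT that v by blast
    qed
    moreover have "v \<in> E `` X" if "u \<in> X" using v that by auto
    ultimately show "sum (dec a u) X \<le> sum (dec b v) (E `` X)"
      using sa[OF X] sb[OF im, of X] le by (cases "u \<in> X"; cases "v \<in> E `` X") auto
  qed
  then obtain m where "flow V E (dec a u) (dec b v) m" by blast
  then have "flow V E a b (\<lambda>x y. m x y + of_bool (x = u \<and> y = v))"
    using assms(1) u vV v by (intro flow_inc)
  then show ?case by blast
qed

lemma flow_sum_le:
  assumes "finite V" "E \<subseteq> V \<times> V" "flow V E a b m" "X \<subseteq> V"
  shows "sum a X \<le> sum b (E `` X)"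
proof -
  have "sum a X = (\<Sum>u\<in>X. \<Sum>v\<in>V. m u v)" using assms by (auto simp: flow_def subset_iff intro!: sum.cong)
  also have "\<dots> = (\<Sum>u\<in>X. \<Sum>v\<in>E `` X. m u v)"
    by (intro sum.cong refl sum.mono_neutral_right) (use assms in \<open>auto simp: flow_def, blast\<close>)
  also have "\<dots> = (\<Sum>v\<in>E `` X. \<Sum>u\<in>X. m u v)" by (rule sum.swap)
  also have "\<dots> \<le> (\<Sum>v\<in>E `` X. \<Sum>u\<in>V. m u v)"
    using assms by (intro sum_mono sum_mono2) auto
  also have "\<dots> = sum b (E `` X)" using assms by (auto simp: flow_def intro!: sum.cong)
  finally show ?thesis .
qed

lemma flow_sum_eq:
  assumes "finite V" "flow V E a b m"
  shows "sum a V = sum b V"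
proof -
  have "sum a V = (\<Sum>u\<in>V. \<Sum>v\<in>V. m u v)" using assms by (auto simp: flow_def)
  also have "\<dots> = (\<Sum>v\<in>V. \<Sum>u\<in>V. m u v)" by (rule sum.swap)
  also have "\<dots> = sum b V" using assms by (auto simp: flow_def)
  finally show ?thesis .
qed

section \<open>Sparse connected subgraphs\<close>

lemma rtrancl_crossing:
  assumes "(x, y) \<in> R\<^sup>*" "x \<in> U" "y \<notin> U"
  shows "\<exists>p q. (p, q) \<in> R \<and> p \<in> U \<and> q \<notin> U"
  using assms by (induction rule: rtrancl_induct) auto

lemma sym_rtrancl: "(u, v) \<in> (S \<union> S\<inverse>)\<^sup>* \<Longrightarrow> (v, u) \<in> (S \<union> S\<inverse>)\<^sup>*"
  by (metis converse_Un converse_converse rtrancl_converseI sup_commute)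

lemma conn_mono: "conn V S \<Longrightarrow> S \<subseteq> S' \<Longrightarrow> conn V S'"
  unfolding conn_def by (meson Un_mono converse_mono in_mono rtrancl_mono)

text \<open>Take a largest vertex set that is reached from a root by no more arcs than it has
  vertices. If it were not all of \<open>V\<close>, an arc leaving it would add one vertex at the
  price of one arc. Counting the root as well makes the bound \<open>card V\<close>, one more than
  for a spanning tree.\<close>

lemma conn_sparse:
  assumes "finite V" "S \<subseteq> V \<times> V" "conn V S"
  shows "\<exists>F\<subseteq>S. conn V F \<and> finite F \<and> card F \<le> card V"
proof (cases "V = {}")
  case True
  then show ?thesis by (auto simp: conn_def)
next
  case False
  then obtain r where r: "r \<in> V" by blast
  define P where "P U \<longleftrightarrow> r \<in> U \<and> U \<subseteq> V \<and>
    (\<exists>F\<subseteq>S. finite F \<and> card F \<le> card U \<and> (\<forall>u\<in>U. (r, u) \<in> (F \<union> F\<inverse>)\<^sup>*))" for U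
  have "P {r}" using r by (auto simp: P_def intro!: exI[of _ "{}"])
  moreover have "\<forall>U. P U \<longrightarrow> card U \<le> card V" using assms by (auto simp: P_def card_mono)
  ultimately obtain U where U: "P U" "\<And>U'. P U' \<Longrightarrow> card U' \<le> card U"
    using ex_has_greatest_nat[of P "{r}" card "Suc (card V)"] by (metis less_Suc_eq_le)
  obtain F where F: "F \<subseteq> S" "finite F" "card F \<le> card U" "\<forall>u\<in>U. (r, u) \<in> (F \<union> F\<inverse>)\<^sup>*"
    and rU: "r \<in> U" "U \<subseteq> V" using U(1) by (auto simp: P_def)
  have finU: "finite U" using rU assms finite_subset by blast
  have "U = V"
  proof (rule ccontr)
    assume "U \<noteq> V"
    then obtain w where "w \<in> V" "w \<notin> U" using rU by blast
    then have "(r, w) \<in> (S \<union> S\<inverse>)\<^sup>*" using assms r by (auto simp: conn_def)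
    from rtrancl_crossing[OF this rU(1) \<open>w \<notin> U\<close>] obtain p q
      where pq: "(p, q) \<in> S \<union> S\<inverse>" "p \<in> U" "q \<notin> U" by blast
    \<comment> \<open>The crossing pair comes from the symmetric closure; \<open>e\<close> is the
      orientation that occurs in \<open>S\<close>.\<close>
    define e where "e = (if (p, q) \<in> S then (p, q) else (q, p))"
    let ?F = "insert e F"
    have sub: "F \<union> F\<inverse> \<subseteq> ?F \<union> ?F\<inverse>" by auto
    have 1: "(r, u) \<in> (?F \<union> ?F\<inverse>)\<^sup>*" if "u \<in> U" for u
      using F(4) that rtrancl_mono[OF sub] by blast
    have "(p, q) \<in> ?F \<union> ?F\<inverse>" by (auto simp: e_def)
    then have 2: "(r, q) \<in> (?F \<union> ?F\<inverse>)\<^sup>*" using 1[OF pq(2)] by (rule rtrancl_into_rtrancl[rotated])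
    have "P (insert q U)"
      unfolding P_def
    proof (intro conjI exI[of _ ?F])
      show "insert q U \<subseteq> V" using pq assms rU by auto
      show "?F \<subseteq> S" using F pq by (auto simp: e_def)
      show "card ?F \<le> card (insert q U)"
        using F finU pq by (simp add: card_insert_if)
    qed (use F rU 1 2 in auto)
    then have "card (insert q U) \<le> card U" by (rule U(2))
    then show False using finU pq by simp
  qed
  moreover have "conn U F" unfolding conn_def using F(4) sym_rtrancl rtrancl_trans by metis
  ultimately show ?thesis using F by blast
qed

section \<open>Lowering the degrees along an arc\<close>

text \<open>
  Some connected subgraph of a connected flow has at most \<open>card V\<close> arcs.  The slack \<open>card V\<close> in Hall's
  condition allows one to fix such a subgraph and to reroute the rest after lowering \<open>a u\<close> and \<open>b v\<close>.
\<close>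

definition reducible :: "'a set \<Rightarrow> 'a rel \<Rightarrow> ('a \<Rightarrow> nat) \<Rightarrow> ('a \<Rightarrow> nat) \<Rightarrow> 'a \<Rightarrow> 'a \<Rightarrow> bool" where
  "reducible V E a b u v \<longleftrightarrow> card V < a u \<and> card V < b v \<and>
     (\<forall>X\<subseteq>V. u \<notin> X \<and> v \<in> E `` X \<longrightarrow> sum a X + card V < sum b (E `` X))"

text \<open>The easy converse of \<open>conn_flow_dec\<close>: one more unit never disconnects the
  support.\<close>

lemma conn_flow_inc:
  assumes "finite V" "u \<in> V" "v \<in> V" "(u, v) \<in> E" "0 < a u" "0 < b v"
    and "conn_flow V E (dec a u) (dec b v)"
  shows "conn_flow V E a b"
proof -
  obtain m where m: "flow V E (dec a u) (dec b v) m" "conn V {(u, v). 0 < m u v}"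
    using assms(7) by (auto simp: conn_flow_def)
  have "conn V {(x, y). 0 < m x y + of_bool (x = u \<and> y = v)}"
    by (rule conn_mono[OF m(2)]) auto
  then show ?thesis unfolding conn_flow_def using flow_inc[OF assms(1-6) m(1)] by blast
qed

lemma conn_flow_dec:
  assumes V: "finite V" "E \<subseteq> V \<times> V" and uv: "(u, v) \<in> E"
    and red: "reducible V E a b u v" and cf: "conn_flow V E a b"
  shows "conn_flow V E (dec a u) (dec b v)"
proof -
  have fin: "finite X" if "X \<subseteq> V" for X using that V finite_subset by blast
  have im: "E `` X \<subseteq> V" for X using V by auto
  have uV: "u \<in> V" "v \<in> V" using V uv by auto
  obtain m where m: "flow V E a b m" "conn V {(u, v). 0 < m u v}" using cf by (auto simp: conn_flow_def)
  have "{(u, v). 0 < m u v} \<subseteq> V \<times> V" using m(1) V by (auto simp: flow_def)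
  from conn_sparse[OF V(1) this m(2)] obtain F where F: "F \<subseteq> {(u, v). 0 < m u v}" "conn V F"
    "finite F" "card F \<le> card V" by blast
  \<comment> \<open>\<open>f\<close> sends one unit along every arc of the fixed connected subgraph
    \<open>F\<close>; \<open>m' = m - f\<close> is the part that will be rerouted.\<close>
  define f where "f x y = (of_bool ((x, y) \<in> F) :: nat)" for x y
  define fa where "fa x = (\<Sum>y\<in>V. f x y)" for x
  define fb where "fb y = (\<Sum>x\<in>V. f x y)" for y
  have FE: "F \<subseteq> E" using F m(1) by (auto simp: flow_def)
  have f_le: "f x y \<le> m x y" for x y using F by (auto simp: f_def)
  have Ff: "flow V E fa fb f" using FE by (auto simp: flow_def fa_def fb_def f_def)
  define m' where "m' x y = m x y - f x y" for x y
  define a' where "a' x = a x - fa x" for x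
  define b' where "b' y = b y - fb y" for y
  have le_a: "fa x \<le> a x" if "x \<in> V" for x
    using m(1) that sum_mono[of V "f x" "m x"] f_le by (auto simp: flow_def fa_def)
  have le_b: "fb y \<le> b y" if "y \<in> V" for y
    using m(1) that sum_mono[of V "\<lambda>x. f x y" "\<lambda>x. m x y"] f_le by (auto simp: flow_def fb_def)
  have "(\<Sum>y\<in>V. m x y - f x y) = (\<Sum>y\<in>V. m x y) - (\<Sum>y\<in>V. f x y)" for x
    using f_le by (intro sum_subtractf_nat) auto
  moreover have "(\<Sum>x\<in>V. m x y - f x y) = (\<Sum>x\<in>V. m x y) - (\<Sum>x\<in>V. f x y)" for y
    using f_le by (intro sum_subtractf_nat) auto
  ultimately have m': "flow V E a' b' m'"
    using m(1) by (auto simp: flow_def m'_def a'_def b'_def fa_def fb_def)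
  have "sum fb V \<le> card F"
  proof -
    have "sum fb V = (\<Sum>(x, y)\<in>V \<times> V. f x y)"
      unfolding fb_def by (subst sum.swap) (simp add: sum.cartesian_product)
    also have "\<dots> = (\<Sum>e\<in>V \<times> V. of_bool (e \<in> F))" by (intro sum.cong) (auto simp: f_def)
    also have "\<dots> = card (V \<times> V \<inter> F)" using V(1) by (simp add: sum_of_bool_eq)
    also have "\<dots> \<le> card F" using F(3) by (intro card_mono) auto
    finally show ?thesis .
  qed
  then have fbV: "sum fb V \<le> card V" using F(4) by simp
  have faV: "sum fa V \<le> card V" using fbV flow_sum_eq[OF V(1) Ff] by simp
  have fau: "fa u \<le> card V" using member_le_sum[of u V fa] uV V(1) faV by simp
  have fbv: "fb v \<le> card V" using member_le_sum[of v V fb] uV V(1) fbV by simp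
  have pos: "0 < a' u" "0 < b' v" using fau fbv red by (auto simp: a'_def b'_def reducible_def)
  have sa: "sum a' X = sum (dec a' u) X + of_bool (u \<in> X)" if "X \<subseteq> V" for X
    using sum_dec[of X a' u] fin[OF that] pos by simp
  have sb: "sum b' X = sum (dec b' v) X + of_bool (v \<in> X)" if "X \<subseteq> V" for X
    using sum_dec[of X b' v] fin[OF that] pos by simp
  have "\<exists>m2. flow V E (dec a' u) (dec b' v) m2"
  proof (rule transport_exists[OF V])
    show "sum (dec a' u) V = sum (dec b' v) V"
      using sa[of V] sb[of V] flow_sum_eq[OF V(1) m'] uV by simp
    fix X assume X: "X \<subseteq> V"
    have le: "sum a' X \<le> sum b' (E `` X)" by (rule flow_sum_le[OF V m' X])
    \<comment> \<open>\<open>F\<close> takes away at most \<open>card V\<close> units of demand,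
      which is exactly what the slack in \<open>reducible\<close> pays for.\<close>
    have "sum a' X < sum b' (E `` X)" if "u \<notin> X" "v \<in> E `` X"
    proof -
      have "sum a X + card V < sum b (E `` X)" using red X that by (auto simp: reducible_def)
      moreover have "sum a' X \<le> sum a X" by (intro sum_mono) (simp add: a'_def)
      moreover have "sum b (E `` X) = sum b' (E `` X) + sum fb (E `` X)"
        unfolding sum.distrib[symmetric] b'_def
        by (intro sum.cong refl) (use le_b[OF subsetD[OF im]] in simp)
      moreover have "sum fb (E `` X) \<le> sum fb V" using im V(1) by (intro sum_mono2) auto
      ultimately show ?thesis using fbV by linarith
    qed
    moreover have "v \<in> E `` X" if "u \<in> X" using uv that by auto
    ultimately show "sum (dec a' u) X \<le> sum (dec b' v) (E `` X)"
      using sa[OF X] sb[OF im, of X] le by (cases "u \<in> X"; cases "v \<in> E `` X") auto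
  qed
  then obtain m2 where m2: "flow V E (dec a' u) (dec b' v) m2" by blast
  have "flow V E (dec a u) (dec b v) (\<lambda>x y. m2 x y + f x y)"
    by (rule flow_cong[OF flow_add[OF m2 Ff]])
      (use le_a le_b pos uV in \<open>auto simp: a'_def b'_def\<close>)
  moreover have "conn V {(x, y). 0 < m2 x y + f x y}"
    by (rule conn_mono[OF F(2)]) (auto simp: f_def)
  ultimately show ?thesis unfolding conn_flow_def by blast
qed

text \<open>If \<open>u\<close> lies in \<open>X\<close>, then \<open>v\<close> lies in its image,
  so undoing a unit step along the arc never shrinks the slack of a set. Read contrapositively, an
  arc that cannot be lowered stays so while other arcs are lowered; hence one pass over the arcs
  suffices.\<close>

lemma reducible_dec:
  assumes V: "finite V" "E \<subseteq> V \<times> V" and uv: "(u, v) \<in> E" "0 < a u" "0 < b v"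
    and red: "reducible V E (dec a u) (dec b v) x y"
  shows "reducible V E a b x y"
proof -
  have fin: "finite X" if "X \<subseteq> V" for X using that V finite_subset by blast
  have im: "E `` X \<subseteq> V" for X using V by auto
  have "sum a X + card V < sum b (E `` X)" if X: "X \<subseteq> V" "x \<notin> X" "y \<in> E `` X" for X
  proof -
    have "sum (dec a u) X + card V < sum (dec b v) (E `` X)" using red X by (auto simp: reducible_def)
    moreover have "v \<in> E `` X" if "u \<in> X" using uv that by auto
    ultimately show ?thesis
      using sum_dec[of X a u] sum_dec[of "E `` X" b v] fin X im uv by (auto split: if_splits)
  qed
  moreover have "card V < a x" "card V < b y" using red by (auto simp: reducible_def split: if_splits)
  ultimately show ?thesis by (auto simp: reducible_def)
qed

text \<open>A flow with more than \<open>card V\<close> units on a single arc makes this arc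
  reducible, so every one of the \<open>card V ^ 2\<close> multiplicities is at most
  \<open>card V\<close>.\<close>

lemma irreducible_bound:
  assumes V: "finite V" "E \<subseteq> V \<times> V" and cf: "conn_flow V E a b"
    and irr: "\<And>u v. (u, v) \<in> E \<Longrightarrow> \<not> reducible V E a b u v"
  shows "sum a V \<le> card V ^ 3"
proof -
  have im: "E `` X \<subseteq> V" for X using V by auto
  obtain m where m: "flow V E a b m" using cf by (auto simp: conn_flow_def)
  have le: "m u v \<le> card V" if uv: "u \<in> V" "v \<in> V" for u v
  proof (rule ccontr)
    assume big: "\<not> m u v \<le> card V"
    then have E: "(u, v) \<in> E" using m by (auto simp: flow_def)
    have au: "card V < a u" using m uv big member_le_sum[of v V "m u"] V(1) by (auto simp: flow_def)
    have bv: "card V < b v"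
      using m uv big member_le_sum[of u V "\<lambda>x. m x v"] V(1) by (auto simp: flow_def)
    have "sum a X + card V < sum b (E `` X)" if X: "X \<subseteq> V" "u \<notin> X" "v \<in> E `` X" for X
    proof -
      \<comment> \<open>Empty the heavy arc altogether. As \<open>X\<close> avoids \<open>u\<close>,
        its supply is untouched, while the demand of its image drops by \<open>m u v\<close>; the
        easy half of Hall's theorem for \<open>m'\<close> then shows the slack in the original
        demands.\<close>
      define m' where "m' = (\<lambda>x y. if x = u \<and> y = v then 0 else m x y)"
      define a' where "a' x = (\<Sum>y\<in>V. m' x y)" for x
      define b' where "b' y = (\<Sum>x\<in>V. m' x y)" for y
      have f': "flow V E a' b' m'" using m by (auto simp: flow_def m'_def a'_def b'_def)
      have aa: "a' x = a x" if "x \<in> X" for x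
      proof -
        have "x \<noteq> u" "x \<in> V" using that X by auto
        then show ?thesis using m by (simp add: a'_def m'_def flow_def)
      qed
      have bb: "b y = b' y + of_bool (y = v) * m u v" if "y \<in> V" for y
      proof -
        have "b y = (\<Sum>x\<in>V. m x y)" using m that by (auto simp: flow_def)
        also have "\<dots> = (\<Sum>x\<in>V. m' x y + (if x = u then of_bool (y = v) * m u v else 0))"
          by (intro sum.cong) (auto simp: m'_def)
        finally show ?thesis using uv V(1) by (simp add: sum.distrib b'_def)
      qed
      have "sum b (E `` X) = (\<Sum>y\<in>E `` X. b' y + (if y = v then m u v else 0))"
        by (intro sum.cong refl) (use bb[OF subsetD[OF im]] in simp)
      also have "\<dots> = sum b' (E `` X) + m u v"
        using X im V(1) finite_subset[OF im] by (simp add: sum.distrib)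
      finally have "sum b (E `` X) = sum b' (E `` X) + m u v" .
      moreover have "sum a X = sum a' X" using aa by simp
      moreover have "sum a' X \<le> sum b' (E `` X)" by (rule flow_sum_le[OF V f' X(1)])
      ultimately show ?thesis using big by simp
    qed
    then have "reducible V E a b u v" using au bv by (auto simp: reducible_def)
    then show False using irr[OF E] by simp
  qed
  have "sum a V = (\<Sum>u\<in>V. \<Sum>v\<in>V. m u v)" using m by (auto simp: flow_def)
  also have "\<dots> \<le> (\<Sum>u\<in>V. \<Sum>v\<in>V. card V)" using le by (intro sum_mono) auto
  finally show ?thesis by (simp add: power3_eq_cube)
qed

section \<open>The decision problem in terms of connected flows\<close>

text \<open>The library's connectivity demands a vertex, whereas \<open>conn\<close> holds for the
  empty set; this is why \<open>pverts G\<close> is assumed nonempty.\<close>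

lemma connected_support_graph_iff:
  assumes "pverts G \<noteq> {}"
  shows "Digraph_Component.connected (with_proj (support_graph G m)) \<longleftrightarrow>
    conn (pverts G) (parcs (support_graph G m))"
proof -
  let ?H = "mk_symmetric (with_proj (support_graph G m))"
  have arcs: "parcs ?H = parcs (support_graph G m) \<union> (parcs (support_graph G m))\<inverse>"
    by (auto simp: mk_symmetric_def)
  have vs: "pverts ?H = pverts G" by (simp add: mk_symmetric_def support_graph_def)
  interpret H: pair_wf_digraph ?H
    by unfold_locales (auto simp: mk_symmetric_def support_graph_def)
  have "u \<rightarrow>\<^sup>*\<^bsub>with_proj ?H\<^esub> v \<longleftrightarrow> (u, v) \<in> Restr ((parcs ?H)\<^sup>*) (pverts G)" for u v
    using H.reachable_conv[of u v] vs by simp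
  moreover have "pverts (support_graph G m) = pverts G" by (simp add: support_graph_def)
  ultimately show ?thesis using assms
    by (auto simp: Digraph_Component.connected_def strongly_connected_def conn_def arcs vs)
qed

text \<open>Out-degrees act as supplies and in-degrees as demands, so \<open>d_out\<close> comes
  first.\<close>

lemma fdcs_solvable_iff:
  assumes "pair_fin_digraph G" "pverts G \<noteq> {}"
  shows "fdcs_solvable G d_in d_out \<longleftrightarrow> conn_flow (pverts G) (parcs G) d_out d_in"
proof
  interpret pair_fin_digraph G by fact
  have E: "parcs G \<subseteq> pverts G \<times> pverts G" using wellformed' by auto
  have fin: "finite (pverts G)" by (rule pair_finite_verts)
  {
    assume "fdcs_solvable G d_in d_out"
    then obtain m where m: "fdcs_solution G d_in d_out m" by (auto simp: fdcs_solvable_def)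
    \<comment> \<open>The problem ignores multiplicities outside the vertex set, but
      \<open>flow\<close> wants every positive one to sit on an arc.\<close>
    define m' where "m' u v = (if u \<in> pverts G \<and> v \<in> pverts G then m u v else 0)" for u v
    have "parcs (support_graph G m) \<subseteq> parcs G" using m by (auto simp: fdcs_solution_def subgraph_def)
    then have "flow (pverts G) (parcs G) d_out d_in m'"
      using m by (auto simp: flow_def fdcs_solution_def m'_def support_graph_def)
    moreover have "{(u, v). 0 < m' u v} = parcs (support_graph G m)"
      by (auto simp: m'_def support_graph_def split: if_splits)
    ultimately show "conn_flow (pverts G) (parcs G) d_out d_in"
      unfolding conn_flow_def using m connected_support_graph_iff[OF assms(2)]
      by (auto simp: fdcs_solution_def intro!: exI[of _ m'])
  }
  {
    assume "conn_flow (pverts G) (parcs G) d_out d_in"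
    then obtain m where m: "flow (pverts G) (parcs G) d_out d_in m" "conn (pverts G) {(u, v). 0 < m u v}"
      by (auto simp: conn_flow_def)
    have eq: "{(u, v). 0 < m u v} = parcs (support_graph G m)"
      using m(1) E by (auto simp: support_graph_def flow_def)
    interpret S: pair_wf_digraph "support_graph G m"
      by unfold_locales (auto simp: support_graph_def)
    have "subgraph (with_proj (support_graph G m)) (with_proj G)"
      unfolding subgraph_def compatible_def using eq m(1) wf_digraph_axioms S.wf_digraph_axioms
      by (auto simp: flow_def) (auto simp: support_graph_def)
    then have "fdcs_solution G d_in d_out m"
      using m connected_support_graph_iff[OF assms(2)] eq by (auto simp: fdcs_solution_def flow_def)
    then show "fdcs_solvable G d_in d_out" by (auto simp: fdcs_solvable_def)
  }
qed

text \<open>Glue bijections between corresponding fibres. This matches slots with units of flow at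
  the same vertex.\<close>

lemma fibrewise_bij:
  assumes "finite A" "finite B" "\<And>c. card {x\<in>A. f x = c} = card {y\<in>B. g y = c}"
  shows "\<exists>h. bij_betw h A B \<and> (\<forall>x\<in>A. g (h x) = f x)"
proof -
  have "\<exists>h. bij_betw h {x\<in>A. f x = c} {y\<in>B. g y = c}" for c
    using assms by (intro finite_same_card_bij) auto
  then obtain h where h: "\<And>c. bij_betw (h c) {x\<in>A. f x = c} {y\<in>B. g y = c}" by metis
  have mem: "h (f x) x \<in> B \<and> g (h (f x) x) = f x" if "x \<in> A" for x
    using bij_betwE[OF h[of "f x"]] that by auto
  have "bij_betw (\<lambda>x. h (f x) x) A B"
    unfolding bij_betw_def
  proof
    show "inj_on (\<lambda>x. h (f x) x) A"
    proof (rule inj_onI)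
      fix x y assume xy: "x \<in> A" "y \<in> A" "h (f x) x = h (f y) y"
      then have "f x = f y" using mem by metis
      then show "x = y" using xy bij_betw_imp_inj_on[OF h[of "f x"]] by (auto dest: inj_onD)
    qed
    have "y \<in> (\<lambda>x. h (f x) x) ` A" if "y \<in> B" for y
    proof -
      have "y \<in> h (g y) ` {x\<in>A. f x = g y}" using bij_betw_imp_surj_on[OF h[of "g y"]] that by auto
      then obtain x where "x \<in> A" "f x = g y" "y = h (g y) x" by auto
      then show ?thesis by (intro image_eqI[of _ _ x]) auto
    qed
    then show "(\<lambda>x. h (f x) x) ` A = B" using mem by auto
  qed
  then show ?thesis using mem by blast
qed

lemma bij_permutes: "bij_betw h {..<N::nat} {..<N} \<Longrightarrow> (\<lambda>r. if r < N then h r else r) permutes {..<N}"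
  by (rule bij_imp_permutes) (auto simp: bij_betw_def inj_on_def image_def)

lemma card_fibres:
  assumes "finite V" "finite A" "\<And>x. x \<in> A \<Longrightarrow> f x \<in> V"
  shows "(\<Sum>v\<in>V. card {x\<in>A. f x = v}) = card A"
  using assms sum.group[of A V f "\<lambda>_. 1::nat"] by (simp add: image_subset_iff)

section \<open>Connected permutations of slots\<close>

text \<open>
  Out-slot \<open>r\<close> belongs to the vertex \<open>ra r\<close> and in-slot \<open>r\<close> to \<open>ca r\<close>; a vertex has as many slots as
  its degree.
\<close>

definition arcs_of :: "nat \<Rightarrow> (nat \<Rightarrow> 'a) \<Rightarrow> (nat \<Rightarrow> 'a) \<Rightarrow> (nat \<Rightarrow> nat) \<Rightarrow> 'a rel" where
  "arcs_of N ra ca \<rho> = (\<lambda>r. (ra r, ca (\<rho> r))) ` {..<N}"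

definition conn_perms :: "nat \<Rightarrow> (nat \<Rightarrow> 'a) \<Rightarrow> (nat \<Rightarrow> 'a) \<Rightarrow> 'a set \<Rightarrow> 'a rel \<Rightarrow> (nat \<Rightarrow> nat) set" where
  "conn_perms N ra ca V E =
     {\<rho>. \<rho> permutes {..<N} \<and> arcs_of N ra ca \<rho> \<subseteq> E \<and> conn V (arcs_of N ra ca \<rho>)}"

text \<open>A flow is a multiset of \<open>N\<close> arcs. Assign its units bijectively to the
  out-slots of their tails and to the in-slots of their heads; the composition is a permutation
  whose arcs form the support. Conversely, the number of slots that a permutation sends from
  \<open>u\<close> to \<open>v\<close> is a flow, since each vertex owns as many slots as its
  degree.\<close>

lemma conn_flow_iff_perm:
  assumes V: "finite V" "E \<subseteq> V \<times> V"
    and ra: "\<And>r. r < N \<Longrightarrow> ra r \<in> V" "\<And>u. u \<in> V \<Longrightarrow> card {r. r < N \<and> ra r = u} = a u"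
    and ca: "\<And>r. r < N \<Longrightarrow> ca r \<in> V" "\<And>v. v \<in> V \<Longrightarrow> card {r. r < N \<and> ca r = v} = b v"
  shows "conn_flow V E a b \<longleftrightarrow> conn_perms N ra ca V E \<noteq> {}"
proof
  assume "conn_perms N ra ca V E \<noteq> {}"
  then obtain \<rho> where \<rho>: "\<rho> permutes {..<N}" "arcs_of N ra ca \<rho> \<subseteq> E" "conn V (arcs_of N ra ca \<rho>)"
    by (auto simp: conn_perms_def)
  have \<rho>N: "\<rho> r < N" if "r < N" for r using permutes_in_image[OF \<rho>(1), of r] that by auto
  define m where "m u v = card {r. r < N \<and> ra r = u \<and> ca (\<rho> r) = v}" for u v
  have pos: "0 < m u v \<longleftrightarrow> (u, v) \<in> arcs_of N ra ca \<rho>" for u v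
    by (auto simp: m_def card_gt_0_iff arcs_of_def)
  have "(\<Sum>v\<in>V. m u v) = a u" if "u \<in> V" for u
  proof -
    have "(\<Sum>v\<in>V. card {r\<in>{r. r < N \<and> ra r = u}. ca (\<rho> r) = v}) = card {r. r < N \<and> ra r = u}"
      by (rule card_fibres) (use V ca \<rho>N in auto)
    then show ?thesis using ra that by (simp add: m_def conj_assoc)
  qed
  moreover have "(\<Sum>u\<in>V. m u v) = b v" if "v \<in> V" for v
  proof -
    have "(\<Sum>u\<in>V. card {r\<in>{r. r < N \<and> ca (\<rho> r) = v}. ra r = u}) = card {r. r < N \<and> ca (\<rho> r) = v}"
      by (rule card_fibres) (use V ra in auto)
    moreover have "bij_betw \<rho> {r. r < N \<and> ca (\<rho> r) = v} {s. s < N \<and> ca s = v}"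
      unfolding bij_betw_def
    proof
      show "inj_on \<rho> {r. r < N \<and> ca (\<rho> r) = v}" using permutes_inj[OF \<rho>(1)] by (rule inj_on_subset) auto
      have "s \<in> \<rho> ` {r. r < N \<and> ca (\<rho> r) = v}" if "s < N" "ca s = v" for s
      proof -
        have "s \<in> \<rho> ` {..<N}" using permutes_image[OF \<rho>(1)] that by simp
        then show ?thesis using that by auto
      qed
      then show "\<rho> ` {r. r < N \<and> ca (\<rho> r) = v} = {s. s < N \<and> ca s = v}" using \<rho>N by auto
    qed
    then have "card {r. r < N \<and> ca (\<rho> r) = v} = b v"
      using ca(2)[OF that] by (simp add: bij_betw_same_card)
    moreover have "m u v = card {r\<in>{r. r < N \<and> ca (\<rho> r) = v}. ra r = u}" for u
      unfolding m_def by (rule arg_cong[where f = card]) auto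
    ultimately show ?thesis by simp
  qed
  ultimately have "flow V E a b m" unfolding flow_def using \<rho>(2) by (auto simp: pos)
  moreover have "{(u, v). 0 < m u v} = arcs_of N ra ca \<rho>" by (auto simp: pos)
  ultimately show "conn_flow V E a b" unfolding conn_flow_def using \<rho>(3) by (intro exI[of _ m]) simp
next
  assume "conn_flow V E a b"
  then obtain m where m: "flow V E a b m" "conn V {(u, v). 0 < m u v}" by (auto simp: conn_flow_def)
  \<comment> \<open>One element for every unit of flow, numbered within its arc.\<close>
  define T where "T = Sigma (V \<times> V) (\<lambda>(u, v). {..<m u v})"
  have finT: "finite T" using V by (auto simp: T_def)
  have "card {r\<in>{..<N}. ra r = u} = card {t\<in>T. fst (fst t) = u}" for u
  proof (cases "u \<in> V")
    case True
    have "{t\<in>T. fst (fst t) = u} = Sigma ({u} \<times> V) (\<lambda>(u, v). {..<m u v})" using True by (auto simp: T_def)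
    then have "card {t\<in>T. fst (fst t) = u} = (\<Sum>(u, v)\<in>{u} \<times> V. m u v)"
      using V by (simp add: card_SigmaI split_def)
    also have "\<dots> = (\<Sum>v\<in>V. m u v)" by (simp add: sum.cartesian_product[symmetric])
    finally show ?thesis using m(1) ra(2) True by (simp add: flow_def)
  next
    case False
    then have 1: "{t\<in>T. fst (fst t) = u} = {}" "{r\<in>{..<N}. ra r = u} = {}" using ra(1) by (auto simp: T_def)
    show ?thesis unfolding 1 by simp
  qed
  from fibrewise_bij[OF _ finT this] obtain h
    where h: "bij_betw h {..<N} T" "\<forall>r\<in>{..<N}. fst (fst (h r)) = ra r" by auto
  have "card {t\<in>T. snd (fst t) = v} = card {r\<in>{..<N}. ca r = v}" for v
  proof (cases "v \<in> V")
    case True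
    have "{t\<in>T. snd (fst t) = v} = Sigma (V \<times> {v}) (\<lambda>(u, v). {..<m u v})" using True by (auto simp: T_def)
    then have "card {t\<in>T. snd (fst t) = v} = (\<Sum>(u, v)\<in>V \<times> {v}. m u v)"
      using V by (simp add: card_SigmaI split_def)
    also have "\<dots> = (\<Sum>u\<in>V. m u v)" by (simp add: sum.cartesian_product[symmetric])
    finally show ?thesis using m(1) ca(2) True by (simp add: flow_def)
  next
    case False
    then have 1: "{t\<in>T. snd (fst t) = v} = {}" "{r\<in>{..<N}. ca r = v} = {}" using ca(1) by (auto simp: T_def)
    show ?thesis unfolding 1 by simp
  qed
  from fibrewise_bij[OF finT _ this] obtain g
    where g: "bij_betw g T {..<N}" "\<forall>t\<in>T. ca (g t) = snd (fst t)" by auto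
  \<comment> \<open>From an out-slot to the unit leaving through it, and from there to the in-slot
    where this unit arrives.\<close>
  define \<rho> where "\<rho> r = (if r < N then (g \<circ> h) r else r)" for r
  have perm: "\<rho> permutes {..<N}"
    unfolding \<rho>_def using bij_betw_trans[OF h(1) g(1)] by (rule bij_permutes)
  have "(ra r, ca (\<rho> r)) = fst (h r)" if "r < N" for r
    using h(2) g(2) bij_betwE[OF h(1)] that by (auto simp: \<rho>_def prod_eq_iff)
  then have "arcs_of N ra ca \<rho> = (fst \<circ> h) ` {..<N}"
    unfolding arcs_of_def by (auto simp del: prod.inject)
  also have "\<dots> = fst ` T" using bij_betw_imp_surj_on[OF h(1)] by (metis image_comp)
  also have "\<dots> = {(u, v). 0 < m u v}"
  proof -
    have "(u, v) \<in> fst ` T" if "0 < m u v" for u v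
    proof -
      have "(u, v) \<in> V \<times> V" using m(1) V(2) that by (auto simp: flow_def)
      then have "((u, v), 0) \<in> T" using that by (auto simp: T_def)
      then show ?thesis by (metis fst_conv image_eqI)
    qed
    then show ?thesis by (auto simp: T_def)
  qed
  finally have "arcs_of N ra ca \<rho> = {(u, v). 0 < m u v}" .
  then have "\<rho> \<in> conn_perms N ra ca V E" using perm m by (auto simp: conn_perms_def flow_def)
  then show "conn_perms N ra ca V E \<noteq> {}" by auto
qed

section \<open>Parity of the number of uncut sets\<close>

definition uncut :: "'a rel \<Rightarrow> 'a set \<Rightarrow> bool" where
  "uncut S X \<longleftrightarrow> (\<forall>(u, v)\<in>S. u \<in> X \<longleftrightarrow> v \<in> X)"

text \<open>A graph with \<open>c\<close> components has \<open>2 ^ (c - 1)\<close> uncut sets avoiding a given vertex.\<close>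

lemma odd_card_uncut:
  assumes V: "finite V" "z \<in> V" "S \<subseteq> V \<times> V"
  shows "odd (card {X\<in>Pow (V - {z}). uncut S X}) \<longleftrightarrow> conn V S"
proof (cases "conn V S")
  case True
  have "X = {}" if X: "X \<subseteq> V - {z}" "uncut S X" for X
  proof (rule ccontr)
    assume "X \<noteq> {}"
    then obtain w where w: "w \<in> X" by blast
    then have "(w, z) \<in> (S \<union> S\<inverse>)\<^sup>*" using True X V by (auto simp: conn_def)
    from rtrancl_crossing[OF this w] show False using X by (auto simp: uncut_def)
  qed
  then have "{X\<in>Pow (V - {z}). uncut S X} = {{}}" by (auto simp: uncut_def)
  then show ?thesis using True by simp
next
  case False
  define C where "C w = {x. (w, x) \<in> (S \<union> S\<inverse>)\<^sup>*}" for w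
  from False obtain w where w: "w \<in> V" "(w, z) \<notin> (S \<union> S\<inverse>)\<^sup>*"
    unfolding conn_def by (meson rtrancl_trans sym_rtrancl)
  have CV: "C w \<subseteq> V"
  proof
    fix x assume "x \<in> C w"
    then have "(w, x) \<in> (S \<union> S\<inverse>)\<^sup>*" by (simp add: C_def)
    then show "x \<in> V" by (induction rule: rtrancl_induct) (use w V in auto)
  qed
  have Cz: "z \<notin> C w" and wC: "w \<in> C w" using w by (auto simp: C_def)
  have Cst: "x \<in> C w \<longleftrightarrow> y \<in> C w" if "(x, y) \<in> S" for x y
    using that by (auto simp: C_def intro: rtrancl_into_rtrancl)
  have Csub: "C w \<subseteq> X" if "uncut S X" "w \<in> X" for X
  proof
    fix x assume "x \<in> C w"
    then have "(w, x) \<in> (S \<union> S\<inverse>)\<^sup>*" by (simp add: C_def)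
    then show "x \<in> X" by (induction rule: rtrancl_induct) (use that in \<open>auto simp: uncut_def\<close>)
  qed
  have Cdis: "C w \<inter> X = {}" if "uncut S X" "w \<notin> X" for X
    using Csub[of "- X"] that by (auto simp: uncut_def)
  define U where "U = {X\<in>Pow (V - {z}). uncut S X}"
  have finU: "finite U" using V by (auto simp: U_def)
  \<comment> \<open>\<open>C w\<close> is the component of a vertex \<open>w\<close> that is not
    connected to \<open>z\<close>. Every uncut set contains it entirely or avoids it, so toggling it
    pairs the uncut sets and their number is even.\<close>
  have "bij_betw (\<lambda>X. X \<union> C w) {X\<in>U. w \<notin> X} {X\<in>U. w \<in> X}"
  proof (rule bij_betw_byWitness[where f' = "\<lambda>X. X - C w"])
    show "\<forall>X\<in>{X\<in>U. w \<notin> X}. X \<union> C w - C w = X" using Cdis by (auto simp: U_def)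
    show "\<forall>X\<in>{X\<in>U. w \<in> X}. X - C w \<union> C w = X" using Csub by (auto simp: U_def)
    show "(\<lambda>X. X \<union> C w) ` {X\<in>U. w \<notin> X} \<subseteq> {X\<in>U. w \<in> X}"
      using CV Cz wC Cst by (auto simp: U_def uncut_def)
    show "(\<lambda>X. X - C w) ` {X\<in>U. w \<in> X} \<subseteq> {X\<in>U. w \<notin> X}"
      using CV Cz wC Cst by (auto simp: U_def uncut_def)
  qed
  then have "card {X\<in>U. w \<notin> X} = card {X\<in>U. w \<in> X}" by (rule bij_betw_same_card)
  moreover have "U = {X\<in>U. w \<notin> X} \<union> {X\<in>U. w \<in> X}" by auto
  moreover have "card ({X\<in>U. w \<notin> X} \<union> {X\<in>U. w \<in> X}) = card {X\<in>U. w \<notin> X} + card {X\<in>U. w \<in> X}"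
    by (rule card_Un_disjoint) (use finU in auto)
  ultimately have "even (card U)" by simp
  then show ?thesis using False by (simp add: U_def)
qed


section \<open>Determinants over \<open>GF(2)[w]\<close>\<close>

lemma two_bit_poly [simp]: "2 = (0 :: bit poly)"
  by (simp add: one_pCons flip: one_add_one)

lemma bit_poly_add_self [simp]: "p + p = (0 :: bit poly)"
  by (simp flip: mult_2)

lemma of_nat_bit_poly: "(of_nat n :: bit poly) = of_bool (odd n)"
  by (induction n) auto

text \<open>The permanent. Over \<open>bit poly\<close> the signs that distinguish it from the
  determinant are all equal to 1.\<close>

definition perm :: "nat \<Rightarrow> (nat \<Rightarrow> nat \<Rightarrow> 'a::comm_semiring_1) \<Rightarrow> 'a" where
  "perm N A = (\<Sum>\<rho> | \<rho> permutes {..<N}. \<Prod>i<N. A i (\<rho> i))"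

lemma perm_eq_det: "perm N (A :: nat \<Rightarrow> nat \<Rightarrow> bit poly) = det (mat N N (\<lambda>(i, j). A i j))"
proof -
  have "of_int (sign p) = (1 :: bit poly)" for p :: "nat \<Rightarrow> nat"
    by (cases "evenperm p") (simp_all add: sign_def)
  moreover have "(\<Prod>i = 0..<N. mat N N (\<lambda>(i, j). A i j) $$ (i, p i)) = (\<Prod>i<N. A i (p i))"
    if "p permutes {0..<N}" for p
    unfolding atLeast0LessThan using permutes_in_image[OF that] by (intro prod.cong) auto
  ultimately show ?thesis
    unfolding perm_def by (subst det_def'[of _ N]) (auto simp: atLeast0LessThan intro!: sum.cong)
qed

lemma perm_add_row:
  fixes A :: "nat \<Rightarrow> nat \<Rightarrow> bit poly"
  assumes "k < N" "i \<noteq> k"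
  shows "perm N (A(i := \<lambda>j. A i j + c * A k j)) = perm N A"
proof -
  have eq: "mat N N (\<lambda>(i', j). (A(i := \<lambda>j. A i j + c * A k j)) i' j) = addrow c i k (mat N N (\<lambda>(i, j). A i j))"
    by (rule eq_matI) (use assms in \<open>auto simp: add.commute\<close>)
  show ?thesis unfolding perm_eq_det eq by (rule det_addrow) (use assms in auto)
qed

lemma perm_upper_triangular:
  fixes A :: "nat \<Rightarrow> nat \<Rightarrow> bit poly"
  assumes "\<And>i j. i < N \<Longrightarrow> j < i \<Longrightarrow> A i j = 0"
  shows "perm N A = (\<Prod>i<N. A i i)"
proof -
  have "upper_triangular (mat N N (\<lambda>(i, j). A i j))" using assms by (auto simp: upper_triangular_def)
  then have "perm N A = prod_list (diag_mat (mat N N (\<lambda>(i, j). A i j)))"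
    unfolding perm_eq_det by (rule det_upper_triangular[where n = N]) simp
  also have "diag_mat (mat N N (\<lambda>(i, j). A i j)) = map (\<lambda>i. A i i) [0..<N]"
    unfolding diag_mat_def by auto
  also have "prod_list \<dots> = (\<Prod>i<N. A i i)"
    by (simp add: prod.distinct_set_conv_list[symmetric] atLeast0LessThan)
  finally show ?thesis .
qed

section \<open>Congruence modulo powers of w\<close>

text \<open>Congruence modulo \<open>w ^ L\<close>, phrased by coefficients because the machine
  stores exactly the first \<open>L\<close> of them.\<close>

definition eqp :: "nat \<Rightarrow> 'a::comm_semiring_1 poly \<Rightarrow> 'a poly \<Rightarrow> bool" where
  "eqp L p q \<longleftrightarrow> (\<forall>d<L. coeff p d = coeff q d)"

lemma eqp_refl [simp, intro]: "eqp L p p" by (simp add: eqp_def)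
lemma eqp_sym: "eqp L p q \<Longrightarrow> eqp L q p" by (simp add: eqp_def)
lemma eqp_trans [trans]: "eqp L p q \<Longrightarrow> eqp L q r \<Longrightarrow> eqp L p r" by (simp add: eqp_def)
lemma eqp_mono: "eqp L p q \<Longrightarrow> L' \<le> L \<Longrightarrow> eqp L' p q" by (simp add: eqp_def)
lemma eqp_add: "eqp L p q \<Longrightarrow> eqp L p' q' \<Longrightarrow> eqp L (p + p') (q + q')" by (simp add: eqp_def)
lemma eqp_mult: "eqp L p q \<Longrightarrow> eqp L p' q' \<Longrightarrow> eqp L (p * p') (q * q')"
  by (auto simp: eqp_def coeff_mult intro!: sum.cong)
lemma eqp_sum: "(\<And>x. x \<in> S \<Longrightarrow> eqp L (f x) (g x)) \<Longrightarrow> eqp L (sum f S) (sum g S)"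
  by (induction S rule: infinite_finite_induct) (auto intro: eqp_add)
lemma eqp_prod: "(\<And>x. x \<in> S \<Longrightarrow> eqp L (f x) (g x)) \<Longrightarrow> eqp L (prod f S) (prod g S)"
  by (induction S rule: infinite_finite_induct) (auto intro: eqp_mult)

lemma eqp_perm:
  assumes "\<And>i j. i < N \<Longrightarrow> j < N \<Longrightarrow> eqp L (A i j) (B i j)"
  shows "eqp L (perm N A) (perm N B)"
  unfolding perm_def
proof (intro eqp_sum eqp_prod)
  fix \<rho> i assume "\<rho> \<in> {\<rho>. \<rho> permutes {..<N}}" "i \<in> {..<N}"
  then show "eqp L (A i (\<rho> i)) (B i (\<rho> i))" using permutes_in_image[of \<rho> "{..<N}" i] assms by auto
qed

text \<open>Orders of vanishing at \<open>w = 0\<close> add up; each row operation of the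
  elimination gains its factor \<open>w ^ D\<close> here.\<close>

lemma eqp_mult_0:
  assumes "eqp m p 0" "eqp D q 0"
  shows "eqp (m + D) (p * q) 0"
  unfolding eqp_def
proof (intro allI impI)
  fix d assume d: "d < m + D"
  have "coeff p i * coeff q (d - i) = 0" if "i \<le> d" for i
    using assms d that by (cases "i < m") (auto simp: eqp_def)
  then show "coeff (p * q) d = coeff 0 d" by (simp add: coeff_mult)
qed

text \<open>
  The matrix \<open>I + w\<^sup>D A\<close> needs no pivoting: its diagonal stays congruent to \<open>1\<close> modulo \<open>w\<^sup>D\<close>.  Adding
  \<open>A i k\<close> times row \<open>k\<close> to row \<open>i\<close> turns \<open>A i k\<close> into \<open>A i k * (1 + A k k)\<close>, which is divisible
  by another factor \<open>w\<^sup>D\<close>, so that no division is needed to clear the entry modulo \<open>w\<^sup>L\<close>.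
\<close>

definition elim_inv :: "nat \<Rightarrow> nat \<Rightarrow> nat \<Rightarrow> (nat \<Rightarrow> nat \<Rightarrow> bit poly) \<Rightarrow> nat \<Rightarrow> nat \<Rightarrow> (nat \<Rightarrow> nat \<Rightarrow> bit poly) \<Rightarrow> bool" where
  "elim_inv N D L A0 k i A \<longleftrightarrow> eqp L (perm N A) (perm N A0) \<and>
     (\<forall>i<N. \<forall>j<N. eqp D (A i j) (of_bool (i = j))) \<and>
     (\<forall>j<k. \<forall>i<N. j < i \<longrightarrow> eqp L (A i j) 0) \<and>
     (\<forall>i'<i. k < i' \<longrightarrow> eqp L (A i' k) 0)"

text \<open>Adding a multiple of another row keeps the permanent. The multiplier
  \<open>A i k\<close> is divisible by \<open>w ^ D\<close>, so the matrix stays congruent to the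
  identity modulo \<open>w ^ D\<close>. Columns before \<open>k\<close> remain cleared because row
  \<open>k\<close> already vanishes there modulo \<open>w ^ L\<close>.\<close>

lemma elim_step:
  assumes inv: "elim_inv N D L A0 k i A" and ki: "k < i" "i < N" and DL: "D \<le> L"
    and A': "\<And>i' j. i' < N \<Longrightarrow> j < N \<Longrightarrow> i' \<noteq> i \<Longrightarrow> A' i' j = A i' j"
      "\<And>j. j < N \<Longrightarrow> eqp L (A' i j) (A i j + A i k * A k j)"
    and m: "eqp m (A i k) 0"
  shows "elim_inv N D L A0 k i A'" "eqp (min L (m + D)) (A' i k) 0"
proof -
  note inv' = inv[unfolded elim_inv_def]
  have eq: "eqp L (A' i' j) ((A(i := \<lambda>j. A i j + A i k * A k j)) i' j)" if "i' < N" "j < N" for i' j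
    using A' that by (cases "i' = i") auto
  have "eqp L (perm N A') (perm N (A(i := \<lambda>j. A i j + A i k * A k j)))"
    by (rule eqp_perm) (rule eq)
  then have 0: "eqp L (perm N A') (perm N A)"
    using perm_add_row[of k N i A "A i k"] ki by simp
  then have 1: "eqp L (perm N A') (perm N A0)" using inv' eqp_trans by blast
  have iD: "eqp D (A i' j) (of_bool (i' = j))" if "i' < N" "j < N" for i' j
    using inv' that by blast
  have ik: "eqp D (A i k) 0" using iD[of i k] ki by simp
  have 2: "eqp D (A' i' j) (of_bool (i' = j))" if "i' < N" "j < N" for i' j
  proof (cases "i' = i")
    case True
    have "eqp D (A i k * A k j) (0 * A k j)" by (rule eqp_mult) (use ik in auto)
    then have "eqp D (A i j + A i k * A k j) (of_bool (i = j) + 0)"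
      using inv' that True by (intro eqp_add) auto
    moreover have "eqp D (A' i j) (A i j + A i k * A k j)" using A'(2)[OF that(2)] DL by (rule eqp_mono)
    ultimately show ?thesis using True eqp_trans by fastforce
  qed (use A' inv' that in auto)
  have 3: "eqp L (A' i' j) 0" if "j < k" "i' < N" "j < i'" for i' j
  proof (cases "i' = i")
    case True
    have "eqp L (A i k * A k j) (A i k * 0)" by (rule eqp_mult) (use inv' that ki in auto)
    then have "eqp L (A i j + A i k * A k j) (0 + 0)"
      using inv' that ki True by (intro eqp_add) auto
    then show ?thesis using True A'(2)[of j] that ki eqp_trans[of L "A' i j"] by auto
  qed (use A' inv' that ki in auto)
  have 4: "eqp L (A' i' k) 0" if "i' < i" "k < i'" for i'
    using A'(1)[of i' k] inv' that ki by auto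
  show "elim_inv N D L A0 k i A'" unfolding elim_inv_def using 1 2 3 4 by blast
  \<comment> \<open>\<open>A k k\<close> is congruent to 1, and \<open>1 + 1 = 0\<close>.\<close>
  have kk: "eqp D (1 + A k k) 0"
    using iD[of k k] ki eqp_add[of D 1 1 "A k k" 1] by simp
  have "eqp (m + D) (A i k * (1 + A k k)) 0" by (rule eqp_mult_0[OF m kk])
  then have "eqp (min L (m + D)) (A i k * (1 + A k k)) 0" by (rule eqp_mono) simp
  moreover have "eqp (min L (m + D)) (A' i k) (A i k * (1 + A k k))"
    using eqp_mono[OF A'(2)[of k]] ki by (simp add: algebra_simps)
  ultimately show "eqp (min L (m + D)) (A' i k) 0" using eqp_trans by blast
qed

lemma elim_inv_next_row:
  assumes "elim_inv N D L A0 k i A" "eqp L (A i k) 0"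
  shows "elim_inv N D L A0 k (Suc i) A"
  using assms by (auto simp: elim_inv_def less_Suc_eq)

lemma elim_inv_next_col:
  assumes "elim_inv N D L A0 k N A"
  shows "elim_inv N D L A0 (Suc k) 0 A"
  using assms by (auto simp: elim_inv_def less_Suc_eq)

lemma elim_inv_start:
  assumes "\<And>i j. i < N \<Longrightarrow> j < N \<Longrightarrow> eqp D (A i j) (of_bool (i = j))"
  shows "elim_inv N D L A 0 0 A"
  using assms by (auto simp: elim_inv_def)

text \<open>Entries below the diagonal vanish modulo \<open>w ^ L\<close>; replacing them by 0 gives
  a triangular matrix with a congruent permanent.\<close>

lemma elim_inv_end:
  assumes "elim_inv N D L A0 N 0 A"
  shows "eqp L (\<Prod>i<N. A i i) (perm N A0)"
proof -
  define B where "B i j = (if j < i then 0 else A i j)" for i j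
  have "perm N B = (\<Prod>i<N. A i i)" by (subst perm_upper_triangular) (auto simp: B_def)
  moreover have "eqp L (perm N A) (perm N B)"
    by (rule eqp_perm) (use assms in \<open>auto simp: elim_inv_def B_def\<close>)
  ultimately show ?thesis using assms eqp_trans eqp_sym unfolding elim_inv_def by metis
qed

section \<open>The permanent as the top part of a shifted permanent\<close>

text \<open>When the first product is expanded, each term other than the product of all
  \<open>p i\<close> takes at least one constant and thus misses a factor of degree up to
  \<open>h\<close>. The second bound is carried along for the induction.\<close>

lemma degree_prod_shift:
  fixes p :: "nat \<Rightarrow> bit poly"
  assumes "\<And>i. i < N \<Longrightarrow> degree (p i) \<le> h" "0 < N"
  shows "degree ((\<Prod>i<N. of_bool (\<delta> i) + p i) - (\<Prod>i<N. p i)) \<le> (N - 1) * h \<and>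
    degree (\<Prod>i<N. p i) \<le> N * h"
  using assms(2,1)
proof (induction N rule: nat_induct_non_zero)
  case 1
  have "degree (of_bool b :: bit poly) = 0" for b by (cases b) auto
  then show ?case using 1 by simp
next
  case (Suc N)
  let ?P = "\<Prod>i<N. of_bool (\<delta> i) + p i" and ?Q = "\<Prod>i<N. p i"
  have d: "degree (of_bool b :: bit poly) = 0" for b by (cases b) auto
  have ih: "degree (?P - ?Q) \<le> (N - 1) * h" "degree ?Q \<le> N * h" using Suc by auto
  have dN: "degree (of_bool (\<delta> N) + p N) \<le> h" "degree (p N) \<le> h"
    using Suc.prems by (auto intro: degree_add_le simp: d)
  have eq: "(\<Prod>i<Suc N. of_bool (\<delta> i) + p i) - (\<Prod>i<Suc N. p i)
      = (?P - ?Q) * (of_bool (\<delta> N) + p N) + ?Q * of_bool (\<delta> N)"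
    by (simp add: algebra_simps)
  have "degree ((?P - ?Q) * (of_bool (\<delta> N) + p N)) \<le> (N - 1) * h + h"
    using degree_mult_le[of "?P - ?Q" "of_bool (\<delta> N) + p N"] ih dN by linarith
  also have "(N - 1) * h + h = N * h" using Suc.hyps by (cases N) auto
  finally have 1: "degree ((?P - ?Q) * (of_bool (\<delta> N) + p N)) \<le> N * h" .
  have 2: "degree (?Q * of_bool (\<delta> N)) \<le> N * h"
    using degree_mult_le[of ?Q "of_bool (\<delta> N)"] ih d[of "\<delta> N"] by simp
  have 3: "degree (?Q * p N) \<le> Suc N * h" using degree_mult_le[of ?Q "p N"] ih dN by simp
  show ?case unfolding eq using degree_add_le[OF 1 2] 3 by simp
qed

text \<open>A term that uses a 1 from the diagonal has degree at most
  \<open>(N - 1) * (D + (k - 1))\<close>, which is below \<open>N * D\<close>. From there on only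
  the terms without such a 1 are visible, and together they form \<open>w ^ (N * D)\<close> times
  the permanent of \<open>A\<close>.\<close>

lemma coeff_perm_shift:
  fixes A :: "nat \<Rightarrow> nat \<Rightarrow> bit poly"
  assumes deg: "\<And>i j. i < N \<Longrightarrow> j < N \<Longrightarrow> degree (A i j) < k" and D: "D = N * k + 1" and d: "N * D \<le> d"
  shows "coeff (perm N (\<lambda>i j. of_bool (i = j) + monom 1 D * A i j)) d = coeff (perm N A) (d - N * D)"
proof (cases "N = 0")
  case True
  then show ?thesis by (simp add: perm_def)
next
  case False
  have "coeff (\<Prod>i<N. of_bool (i = \<rho> i) + monom 1 D * A i (\<rho> i)) d = coeff (\<Prod>i<N. A i (\<rho> i)) (d - N * D)"
    if \<rho>: "\<rho> permutes {..<N}" for \<rho>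
  proof -
    let ?p = "\<lambda>i. monom 1 D * A i (\<rho> i)"
    have dp: "degree (?p i) \<le> D + (k - 1)" if "i < N" for i
    proof -
      have "degree (A i (\<rho> i)) < k" using deg permutes_in_image[OF \<rho>, of i] that by auto
      then show ?thesis using degree_mult_le[of "monom (1 :: bit) D" "A i (\<rho> i)"] by (simp add: degree_monom_eq)
    qed
    have k: "0 < k" using deg[of 0 0] False by simp
    \<comment> \<open>This amounts to \<open>(N - 1) * (k - 1) < D\<close>, the reason for the
      choice of \<open>D\<close>.\<close>
    have "(N - 1) * (D + (k - 1)) < N * D"
    proof -
      obtain N' k' where "N = Suc N'" "k = Suc k'" using False k by (metis gr0_conv_Suc neq0_conv)
      then show ?thesis using D by (simp add: algebra_simps)
    qed
    then have "degree ((\<Prod>i<N. of_bool (i = \<rho> i) + ?p i) - (\<Prod>i<N. ?p i)) < d"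
      using degree_prod_shift[of N ?p "D + (k - 1)" "\<lambda>i. i = \<rho> i"] dp False d by fastforce
    from coeff_eq_0[OF this] have "coeff (\<Prod>i<N. of_bool (i = \<rho> i) + ?p i) d = coeff (\<Prod>i<N. ?p i) d"
      by (simp only: coeff_diff right_minus_eq)
    also have "(\<Prod>i<N. ?p i) = monom 1 (N * D) * (\<Prod>i<N. A i (\<rho> i))"
      by (simp add: prod.distrib monom_power mult.commute)
    finally show ?thesis using d by (simp add: coeff_monom_mult)
  qed
  then show ?thesis by (simp add: perm_def coeff_sum)
qed

lemma degree_perm_le:
  fixes A :: "nat \<Rightarrow> nat \<Rightarrow> bit poly"
  assumes deg: "\<And>i j. i < N \<Longrightarrow> j < N \<Longrightarrow> degree (A i j) < k"
  shows "degree (perm N A) \<le> N * k"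
  unfolding perm_def
proof (rule degree_sum_le)
  show "finite {\<rho>. \<rho> permutes {..<N}}" by (simp add: finite_permutations)
  fix \<rho> assume "\<rho> \<in> {\<rho>. \<rho> permutes {..<N}}"
  then have "degree (A i (\<rho> i)) \<le> k" if "i < N" for i
    using deg[of i "\<rho> i"] permutes_in_image[of \<rho> "{..<N}" i] that by auto
  then have "(\<Sum>i<N. degree (A i (\<rho> i))) \<le> (\<Sum>i<N. k)" by (intro sum_mono) auto
  then show "degree (\<Prod>i<N. A i (\<rho> i)) \<le> N * k"
    using degree_prod_sum_le[of "{..<N}" "\<lambda>i. A i (\<rho> i)"] by simp
qed

section \<open>Cancellation of the disconnected permutations\<close>

text \<open>Exchange the two sums: the monomial of a permutation with all arcs in \<open>E\<close>
  is counted once for each uncut set avoiding \<open>z\<close>. By \<open>odd_card_uncut\<close>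
  this number is odd exactly for connected permutations, and only its parity matters in
  characteristic 2.\<close>

lemma sum_perm_uncut:
  fixes x :: "nat \<Rightarrow> nat \<Rightarrow> bit poly"
  assumes V: "finite V" "z \<in> V" and ra: "\<And>r. r < N \<Longrightarrow> ra r \<in> V" and ca: "\<And>r. r < N \<Longrightarrow> ca r \<in> V"
  shows "(\<Sum>X\<in>Pow (V - {z}). perm N (\<lambda>r s. of_bool ((ra r, ca s) \<in> E \<and> (ra r \<in> X \<longleftrightarrow> ca s \<in> X)) * x r s))
    = (\<Sum>\<rho>\<in>conn_perms N ra ca V E. \<Prod>r<N. x r (\<rho> r))"
proof -
  have "(\<Prod>r<N. of_bool ((ra r, ca (\<rho> r)) \<in> E \<and> (ra r \<in> X \<longleftrightarrow> ca (\<rho> r) \<in> X)) * x r (\<rho> r))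
      = of_bool (arcs_of N ra ca \<rho> \<subseteq> E) * (of_bool (uncut (arcs_of N ra ca \<rho>) X) * (\<Prod>r<N. x r (\<rho> r)))" for \<rho> X
  proof (cases "arcs_of N ra ca \<rho> \<subseteq> E \<and> uncut (arcs_of N ra ca \<rho>) X")
    case True
    then show ?thesis by (auto simp: arcs_of_def uncut_def intro!: prod.cong)
  next
    case False
    then obtain r where "r < N" "\<not> ((ra r, ca (\<rho> r)) \<in> E \<and> (ra r \<in> X \<longleftrightarrow> ca (\<rho> r) \<in> X))"
      by (auto simp: arcs_of_def uncut_def)
    then have "(\<Prod>r<N. of_bool ((ra r, ca (\<rho> r)) \<in> E \<and> (ra r \<in> X \<longleftrightarrow> ca (\<rho> r) \<in> X)) * x r (\<rho> r)) = 0"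
      by (intro prod_zero) auto
    then show ?thesis using False by auto
  qed
  then have "(\<Sum>X\<in>Pow (V - {z}). perm N (\<lambda>r s. of_bool ((ra r, ca s) \<in> E \<and> (ra r \<in> X \<longleftrightarrow> ca s \<in> X)) * x r s))
    = (\<Sum>\<rho> | \<rho> permutes {..<N}. of_bool (arcs_of N ra ca \<rho> \<subseteq> E) *
        ((\<Sum>X\<in>Pow (V - {z}). of_bool (uncut (arcs_of N ra ca \<rho>) X)) * (\<Prod>r<N. x r (\<rho> r))))"
    unfolding perm_def by (subst sum.swap) (simp add: sum_distrib_left sum_distrib_right)
  also have "\<dots> = (\<Sum>\<rho> | \<rho> permutes {..<N}. of_bool (\<rho> \<in> conn_perms N ra ca V E) * (\<Prod>r<N. x r (\<rho> r)))"
  proof (rule sum.cong[OF refl])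
    fix \<rho> assume \<rho>: "\<rho> \<in> {\<rho>. \<rho> permutes {..<N}}"
    have sub: "arcs_of N ra ca \<rho> \<subseteq> V \<times> V"
      using ra ca permutes_in_image[of \<rho> "{..<N}"] \<rho> by (auto simp: arcs_of_def)
    have uncI: "Pow (V - {z}) \<inter> {X. uncut S X} = {X\<in>Pow (V - {z}). uncut S X}" for S by auto
    have "(\<Sum>X\<in>Pow (V - {z}). of_bool (uncut (arcs_of N ra ca \<rho>) X) :: bit poly)
      = of_nat (card {X\<in>Pow (V - {z}). uncut (arcs_of N ra ca \<rho>) X})"
      using V by (simp add: sum_of_bool_eq uncI)
    also have "\<dots> = of_bool (conn V (arcs_of N ra ca \<rho>))"
      unfolding of_nat_bit_poly using odd_card_uncut[OF V sub] by simp
    finally show "of_bool (arcs_of N ra ca \<rho> \<subseteq> E) *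
        ((\<Sum>X\<in>Pow (V - {z}). of_bool (uncut (arcs_of N ra ca \<rho>) X)) * (\<Prod>r<N. x r (\<rho> r)))
      = of_bool (\<rho> \<in> conn_perms N ra ca V E) * (\<Prod>r<N. x r (\<rho> r))"
      using \<rho> by (auto simp: conn_perms_def)
  qed
  also have "\<dots> = (\<Sum>\<rho>\<in>conn_perms N ra ca V E. \<Prod>r<N. x r (\<rho> r))"
    by (rule sum.mono_neutral_cong_right) (auto simp: conn_perms_def finite_permutations)
  finally show ?thesis .
qed


section \<open>The Schwartz--Zippel bound\<close>

text \<open>\<open>M\<close> is a set of squarefree monomials with coefficient 1, so it represents a
  nonzero polynomial as soon as it is nonempty. Split off one variable \<open>e\<close>: the
  polynomial becomes \<open>F M0 + t * F M1\<close> in the value \<open>t\<close> of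
  \<open>e\<close>. For fixed other values it has at most one root \<open>t\<close> unless
  \<open>F M1\<close> vanishes, and that event is bounded by induction in degree one lower.\<close>

lemma schwartz_zippel_multilinear:
  fixes T :: "'b::idom set" and E :: "'a set"
  assumes "finite E" "finite T" "M \<noteq> {}" "M \<subseteq> Pow E" "\<And>\<mu>. \<mu> \<in> M \<Longrightarrow> card \<mu> \<le> d"
  shows "card {x \<in> PiE E (\<lambda>_. T). (\<Sum>\<mu>\<in>M. \<Prod>e\<in>\<mu>. x e) = 0} * card T \<le> d * card T ^ card E"
  using assms(1,3-5)
proof (induction E arbitrary: M d rule: finite_induct)
  case empty
  then have "M = {{}}" by auto
  then show ?case by simp
next
  case (insert e E)
  define M0 where "M0 = {\<mu>\<in>M. e \<notin> \<mu>}"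
  define M1 where "M1 = (\<lambda>\<mu>. \<mu> - {e}) ` {\<mu>\<in>M. e \<in> \<mu>}"
  define F where "F M' x = (\<Sum>\<mu>\<in>M'. \<Prod>e\<in>\<mu>. x e)" for M' and x :: "'a \<Rightarrow> 'b"
  have finM: "finite M" using insert.prems insert.hyps by (meson finite.insertI finite_Pow_iff finite_subset)
  have M01: "M0 \<subseteq> Pow E" "M1 \<subseteq> Pow E" using insert.prems by (auto simp: M0_def M1_def)
  have finE: "finite \<mu>" if "\<mu> \<in> M" for \<mu>
    using insert.prems insert.hyps that by (meson PowD finite.insertI finite_subset subsetD)
  have upd: "F M' (x(e := t)) = F M' x" if "M' \<subseteq> Pow E" for M' x t
    unfolding F_def using that insert.hyps by (intro sum.cong prod.cong) auto
  have split: "F M (x(e := t)) = F M0 x + t * F M1 x" for x t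
  proof -
    have "F M (x(e := t)) = F M0 (x(e := t)) + F {\<mu>\<in>M. e \<in> \<mu>} (x(e := t))"
      unfolding F_def M0_def using finM
      by (subst sum.union_disjoint[symmetric]) (auto intro!: sum.cong)
    moreover have "F {\<mu>\<in>M. e \<in> \<mu>} (x(e := t)) = t * F M1 (x(e := t))"
    proof -
      have "F M1 (x(e := t)) = (\<Sum>\<mu>\<in>{\<mu>\<in>M. e \<in> \<mu>}. \<Prod>e'\<in>\<mu> - {e}. (x(e := t)) e')"
        unfolding F_def M1_def by (subst sum.reindex) (auto simp: inj_on_def)
      moreover have "(\<Prod>e'\<in>\<mu>. (x(e := t)) e') = t * (\<Prod>e'\<in>\<mu> - {e}. (x(e := t)) e')"
        if "\<mu> \<in> M" "e \<in> \<mu>" for \<mu>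
        using prod.remove[OF finE[OF that(1)] that(2), of "x(e := t)"] by simp
      ultimately show ?thesis unfolding F_def by (simp add: sum_distrib_left)
    qed
    ultimately show ?thesis using upd M01 by metis
  qed
  define Z where "Z M' = {x \<in> PiE E (\<lambda>_. T). F M' x = 0}" for M'
  define c where "c = card T ^ card E"
  have ZI: "PiE E (\<lambda>_. T) \<inter> {x. F M' x = 0} = Z M'" for M' by (auto simp: Z_def)
  have cc: "card T ^ card (insert e E) = c * card T" using insert.hyps by (simp add: c_def)
  have finP: "finite (PiE E (\<lambda>_. T))" using insert.hyps assms(2) by (simp add: finite_PiE)
  have cP: "card (PiE E (\<lambda>_. T)) = c" using insert.hyps by (simp add: card_PiE c_def)
  \<comment> \<open>Zeros with the coordinate \<open>e\<close> separated, to be counted fibre by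
    fibre.\<close>
  define Y where "Y = (SIGMA x:PiE E (\<lambda>_. T). {t\<in>T. F M0 x + t * F M1 x = 0})"
  have finY: "finite Y" unfolding Y_def using finP assms(2) by (intro finite_SigmaI) auto
  have "y \<in> (\<lambda>(x, t). x(e := t)) ` Y" if y: "y \<in> PiE (insert e E) (\<lambda>_. T)" "F M y = 0" for y
  proof -
    obtain t x where tx: "y = x(e := t)" "t \<in> T" "x \<in> PiE E (\<lambda>_. T)"
      using y(1) unfolding PiE_insert_eq by auto
    then have "(x, t) \<in> Y" using y(2) split[of x t] by (simp add: Y_def)
    then show ?thesis using tx(1) by (intro image_eqI[of _ _ "(x, t)"]) simp_all
  qed
  then have "{x \<in> PiE (insert e E) (\<lambda>_. T). F M x = 0} \<subseteq> (\<lambda>(x, t). x(e := t)) ` Y" by blast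
  then have "card {x \<in> PiE (insert e E) (\<lambda>_. T). F M x = 0} \<le> card ((\<lambda>(x, t). x(e := t)) ` Y)"
    using finY by (intro card_mono finite_imageI)
  also have "\<dots> \<le> card Y" using finY by (rule card_image_le)
  also have "\<dots> = (\<Sum>x\<in>PiE E (\<lambda>_. T). card {t\<in>T. F M0 x + t * F M1 x = 0})"
    unfolding Y_def using finP assms(2) by (subst card_SigmaI) auto
  finally have le: "card {x \<in> PiE (insert e E) (\<lambda>_. T). F M x = 0} \<le> \<dots>" .
  show ?case
  proof (cases "M1 = {}")
    case True
    \<comment> \<open>The variable \<open>e\<close> occurs in no monomial: every zero extends in
      \<open>card T\<close> ways, and the induction hypothesis applies with the same
      \<open>d\<close>.\<close>
    then have MM: "M0 = M" by (auto simp: M0_def M1_def)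
    have "(\<Sum>x\<in>PiE E (\<lambda>_. T). card {t\<in>T. F M0 x + t * F M1 x = 0})
      = (\<Sum>x\<in>PiE E (\<lambda>_. T). if F M0 x = 0 then card T else 0)"
      using True by (intro sum.cong) (auto simp: F_def)
    also have "\<dots> = card (Z M0) * card T"
      using finP by (simp add: sum.If_cases ZI)
    also have "\<dots> \<le> d * c"
      unfolding Z_def F_def c_def
      by (rule insert.IH) (use MM M01 insert.prems in auto)
    finally have "card {x \<in> PiE (insert e E) (\<lambda>_. T). F M x = 0} * card T \<le> d * c * card T"
      using le by (meson le_trans mult_le_mono1)
    then show ?thesis unfolding cc F_def by (simp only: mult.assoc)
  next
    case False
    then obtain \<mu> where \<mu>: "\<mu> \<in> M" "e \<in> \<mu>" by (auto simp: M1_def)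
    then have "0 < card \<mu>" using finE by (auto simp: card_gt_0_iff)
    \<comment> \<open>Some monomial contains \<open>e\<close>, so \<open>d\<close> is positive;
      taking \<open>e\<close> out lowers all degrees in \<open>M1\<close> to
      \<open>d'\<close>.\<close>
    then obtain d' where d': "d = Suc d'" using insert.prems(3)[OF \<mu>(1)] by (metis gr0_conv_Suc less_le_trans)
    have ih: "card (Z M1) * card T \<le> d' * c"
      unfolding Z_def F_def c_def
    proof (rule insert.IH[OF False M01(2)])
      fix \<mu> assume "\<mu> \<in> M1"
      then obtain \<mu>' where "\<mu>' \<in> M" "e \<in> \<mu>'" "\<mu> = \<mu>' - {e}" by (auto simp: M1_def)
      then show "card \<mu> \<le> d'" using insert.prems(3)[of \<mu>'] finE[of \<mu>'] d' by (simp add: card_Diff_singleton_if)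
    qed
    have one: "card {t\<in>T. F M0 x + t * F M1 x = 0} \<le> 1 + (if F M1 x = 0 then card T else 0)" for x
    proof (cases "F M1 x = 0")
      case True
      have "card {t\<in>T. F M0 x + t * F M1 x = 0} \<le> card T" using assms(2) by (intro card_mono) auto
      then show ?thesis using True by simp
    next
      case False
      have "t = t'" if "F M0 x + t * F M1 x = 0" "F M0 x + t' * F M1 x = 0" for t t'
      proof -
        have "t * F M1 x = t' * F M1 x" using that add_left_cancel by metis
        then show ?thesis using False by simp
      qed
      then have "card {t\<in>T. F M0 x + t * F M1 x = 0} \<le> 1"
        using assms(2) by (subst card_le_Suc0_iff_eq[unfolded One_nat_def[symmetric]]) auto
      then show ?thesis by simp
    qed
    have "(\<Sum>x\<in>PiE E (\<lambda>_. T). card {t\<in>T. F M0 x + t * F M1 x = 0})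
      \<le> (\<Sum>x\<in>PiE E (\<lambda>_. T). 1 + (if F M1 x = 0 then card T else 0))"
      by (intro sum_mono one)
    also have "\<dots> = c + card (Z M1) * card T"
      using finP cP by (subst sum.distrib) (simp add: sum.If_cases ZI)
    also have "\<dots> \<le> d * c" using ih d' by simp
    finally have "card {x \<in> PiE (insert e E) (\<lambda>_. T). F M x = 0} * card T \<le> d * c * card T"
      using le by (meson le_trans mult_le_mono1)
    then show ?thesis unfolding cc F_def by (simp only: mult.assoc)
  qed
qed


section \<open>Random polynomials from random bits\<close>

definition bits_poly :: "nat \<Rightarrow> (nat \<Rightarrow> bool) \<Rightarrow> bit poly" where
  "bits_poly k f = (\<Sum>d<k. monom (of_bool (f d)) d)"

lemma coeff_bits_poly: "coeff (bits_poly k f) d = of_bool (d < k \<and> f d)"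
  by (simp add: bits_poly_def coeff_sum if_distrib cong: if_cong)

lemma degree_bits_poly: "0 < k \<Longrightarrow> degree (bits_poly k f) < k"
  by (rule le_less_trans[OF degree_le[of "k - 1"]]) (auto simp: coeff_bits_poly)

text \<open>A set of bits is the same as a choice of one of \<open>2 ^ k\<close> polynomials for
  each of the \<open>N * N\<close> pairs of slots. The monomials have degree \<open>N\<close>, so
  Schwartz--Zippel bounds the fraction of bad choices by \<open>N / 2 ^ k\<close>.\<close>

lemma card_bad_bits:
  assumes ne: "P \<noteq> {}" and P: "P \<subseteq> {\<rho>. \<rho> permutes {..<N}}"
  shows "card {b \<in> Pow {..<N * N * k}.
      (\<Sum>\<rho>\<in>P. \<Prod>r<N. bits_poly k (\<lambda>d. (r * N + \<rho> r) * k + d \<in> b)) = 0} * 2 ^ k \<le> N * 2 ^ (N * N * k)"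
proof -
  define E where "E = {..<N} \<times> {..<N}"
  define T where "T = (\<lambda>S. bits_poly k (\<lambda>d. d \<in> S)) ` Pow {..<k}"
  define x where "x b = (\<lambda>e\<in>E. bits_poly k (\<lambda>d. (fst e * N + snd e) * k + d \<in> b))" for b
  \<comment> \<open>The graph of a permutation is the set of variables in its monomial. Different
    permutations have different graphs, so no two monomials cancel.\<close>
  define gr where "gr \<rho> = (\<lambda>r. (r, \<rho> r :: nat)) ` {..<N}" for \<rho>
  have "inj_on (\<lambda>S. bits_poly k (\<lambda>d. d \<in> S)) (Pow {..<k})"
  proof (rule inj_onI)
    fix S S' assume S: "S \<in> Pow {..<k}" "S' \<in> Pow {..<k}" "bits_poly k (\<lambda>d. d \<in> S) = bits_poly k (\<lambda>d. d \<in> S')"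
    have "d \<in> S \<longleftrightarrow> d \<in> S'" for d
      using arg_cong[OF S(3), of "\<lambda>p. coeff p d"] S(1,2) by (auto simp: coeff_bits_poly of_bool_def split: if_splits)
    then show "S = S'" by blast
  qed
  then have cT: "card T = 2 ^ k" unfolding T_def by (subst card_image) (auto simp: card_Pow)
  have finT: "finite T" by (simp add: T_def)
  have xT: "x b \<in> PiE E (\<lambda>_. T)" for b
  proof -
    have "bits_poly k f \<in> T" for f
      unfolding T_def by (rule image_eqI[of _ _ "{d. d < k \<and> f d}"]) (auto simp: bits_poly_def intro!: sum.cong)
    then show ?thesis by (auto simp: x_def)
  qed
  have inj: "inj_on x (Pow {..<N * N * k})"
  proof (rule inj_onI)
    fix b b' assume b: "b \<in> Pow {..<N * N * k}" "b' \<in> Pow {..<N * N * k}" "x b = x b'"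
    have "i \<in> b \<longleftrightarrow> i \<in> b'" if i: "i < N * N * k" for i
    proof -
      \<comment> \<open>The digits of a bit index: row, column and degree.\<close>
      define r s d where "r = i div k div N" and "s = i div k mod N" and "d = i mod k"
      have k0: "0 < k" "0 < N" using i by (auto intro: gr0I)
      have "i div k < N * N" using i by (simp add: less_mult_imp_div_less)
      then have rs: "r < N" "s < N" "d < k" "(r * N + s) * k + d = i"
        using k0 by (simp_all add: r_def s_def d_def less_mult_imp_div_less)
      have "x b (r, s) = x b' (r, s)" using b by simp
      then have "coeff (x b (r, s)) d = coeff (x b' (r, s)) d" by simp
      then show ?thesis using rs by (auto simp: x_def E_def coeff_bits_poly of_bool_def split: if_splits)
    qed
    then show "b = b'" using b by blast
  qed
  have sum: "(\<Sum>\<mu>\<in>gr ` P. \<Prod>e\<in>\<mu>. x b e)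
      = (\<Sum>\<rho>\<in>P. \<Prod>r<N. bits_poly k (\<lambda>d. (r * N + \<rho> r) * k + d \<in> b))" for b
  proof -
    have "inj_on gr P"
    proof (rule inj_onI)
      fix \<rho> \<sigma> assume "\<rho> \<in> P" "\<sigma> \<in> P" and eq: "gr \<rho> = gr \<sigma>"
      then have perm: "\<rho> permutes {..<N}" "\<sigma> permutes {..<N}" using P by auto
      have "\<rho> r = \<sigma> r" for r
      proof (cases "r < N")
        case True
        then have "(r, \<rho> r) \<in> gr \<sigma>" unfolding eq[symmetric] by (auto simp: gr_def)
        then show ?thesis by (auto simp: gr_def)
      qed (use perm in \<open>auto simp: permutes_def\<close>)
      then show "\<rho> = \<sigma>" by blast
    qed
    moreover have "(\<Prod>e\<in>gr \<rho>. x b e) = (\<Prod>r<N. bits_poly k (\<lambda>d. (r * N + \<rho> r) * k + d \<in> b))"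
      if "\<rho> \<in> P" for \<rho>
    proof -
      have "\<rho> r < N" if "r < N" for r using P \<open>\<rho> \<in> P\<close> permutes_in_image[of \<rho> "{..<N}" r] that by auto
      then show ?thesis unfolding gr_def
        by (subst prod.reindex) (auto simp: inj_on_def x_def E_def intro!: prod.cong)
    qed
    ultimately show ?thesis by (simp add: sum.reindex)
  qed
  have "card {b \<in> Pow {..<N * N * k}. (\<Sum>\<mu>\<in>gr ` P. \<Prod>e\<in>\<mu>. x b e) = 0}
      \<le> card {y \<in> PiE E (\<lambda>_. T). (\<Sum>\<mu>\<in>gr ` P. \<Prod>e\<in>\<mu>. y e) = 0}"
  proof (rule card_inj_on_le[of x])
    have "finite (PiE E (\<lambda>_. T))" using finT by (intro finite_PiE) (auto simp: E_def)
    then show "finite {y \<in> PiE E (\<lambda>_. T). (\<Sum>\<mu>\<in>gr ` P. \<Prod>e\<in>\<mu>. y e) = 0}" by simp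
  qed (use xT inj in \<open>auto intro: inj_on_subset\<close>)
  moreover have "card {y \<in> PiE E (\<lambda>_. T). (\<Sum>\<mu>\<in>gr ` P. \<Prod>e\<in>\<mu>. y e) = 0} * card T \<le> N * card T ^ card E"
  proof (rule schwartz_zippel_multilinear)
    show "gr ` P \<subseteq> Pow E" using P permutes_in_image by (fastforce simp: gr_def E_def)
    show "card \<mu> \<le> N" if "\<mu> \<in> gr ` P" for \<mu>
      using that card_image_le[of "{..<N}"] by (auto simp: gr_def)
  qed (use ne finT in \<open>auto simp: E_def\<close>)
  ultimately have "card {b \<in> Pow {..<N * N * k}. (\<Sum>\<mu>\<in>gr ` P. \<Prod>e\<in>\<mu>. x b e) = 0} * card T
      \<le> N * card T ^ card E"
    by (meson le_trans mult_le_mono1)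
  then show ?thesis unfolding sum cT by (simp add: E_def power_mult[symmetric] mult_ac)
qed

section \<open>Probabilities of sequential composition\<close>

lemma measure_bind_spmf_integral:
  "measure (measure_spmf (bind_spmf p f)) A = (\<integral>y. measure (measure_spmf (f y)) A \<partial>measure_spmf p)"
proof -
  have conv: "measure (measure_spmf q) A = spmf (map_spmf (\<lambda>x. x \<in> A) q) True" for q
    by (simp add: spmf_map vimage_def)
  have "measure (measure_spmf (bind_spmf p f)) A = spmf (bind_spmf p (\<lambda>y. map_spmf (\<lambda>x. x \<in> A) (f y))) True"
    by (simp only: conv map_spmf_bind_spmf o_def)
  also have "\<dots> = (\<integral>y. spmf (map_spmf (\<lambda>x. x \<in> A) (f y)) True \<partial>measure_spmf p)"
    by (rule spmf_bind)
  finally show ?thesis by (simp only: conv)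
qed

lemma measure_bind_coin:
  "measure (measure_spmf (bind_spmf coin_spmf f)) A
    = (measure (measure_spmf (f True)) A + measure (measure_spmf (f False)) A) / 2"
  unfolding measure_bind_spmf_integral by (simp add: integral_spmf_of_set UNIV_bool)

lemma measure_bind_ge:
  assumes p: "lossless_spmf p" and f: "\<And>y. y \<in> set_spmf p \<Longrightarrow> r \<le> measure (measure_spmf (f y)) A"
  shows "r \<le> measure (measure_spmf (bind_spmf p f)) A"
proof -
  have "r = (\<integral>y. r \<partial>measure_spmf p)" using p by (simp add: lossless_weight_spmfD)
  also have "\<dots> \<le> (\<integral>y. measure (measure_spmf (f y)) A \<partial>measure_spmf p)"
  proof (rule integral_mono_AE)
    show "integrable (measure_spmf p) (\<lambda>y. measure (measure_spmf (f y)) A)"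
      by (intro measure_spmf.integrable_const_bound[where B=1])
        (auto simp: subprob_space.subprob_measure_le_1[OF subprob_space_measure_spmf])
  qed (use f in auto)
  finally show ?thesis unfolding measure_bind_spmf_integral .
qed

text \<open>Applied with \<open>G\<close> the favourable random bits: from there on the computation
  accepts with certainty.\<close>

lemma measure_bind_good:
  assumes f: "\<And>y. y \<in> set_spmf p \<Longrightarrow> y \<in> G \<Longrightarrow> lossless_spmf (f y) \<and> set_spmf (f y) \<subseteq> A"
  shows "measure (measure_spmf p) G \<le> measure (measure_spmf (bind_spmf p f)) A"
proof -
  have "measure (measure_spmf p) G = (\<integral>y. indicator G y \<partial>measure_spmf p)" by simp
  also have "\<dots> \<le> (\<integral>y. measure (measure_spmf (f y)) A \<partial>measure_spmf p)"
  proof (intro integral_mono_AE measure_spmf.integrable_const_bound[where B=1])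
    have "indicator G y \<le> measure (measure_spmf (f y)) A" if y: "y \<in> set_spmf p" for y
    proof (cases "y \<in> G")
      case True
      then have "lossless_spmf (f y)" "set_spmf (f y) \<subseteq> A" using f[OF y] by auto
      moreover have "measure (measure_spmf (f y)) A = measure (measure_spmf (f y)) UNIV"
        by (rule measure_spmf.finite_measure_eq_AE) (use calculation in auto)
      ultimately show ?thesis
        using True by (simp add: lossless_spmf_def weight_spmf_def)
    qed simp
    then show "AE y in measure_spmf p. indicator G y \<le> measure (measure_spmf (f y)) A" by simp
  qed (auto simp: subprob_space.subprob_measure_le_1[OF subprob_space_measure_spmf])
  finally show ?thesis unfolding measure_bind_spmf_integral .
qed


section \<open>A program logic for total correctness with cost bounds\<close>

lemma len_le: "x < 2 ^ b \<Longrightarrow> len x \<le> b"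
  by (simp add: floorlog_leI)

lemma len_mono: "x \<le> y \<Longrightarrow> len x \<le> len y"
  using floorlog_mono by blast

lemma less_2_pow_len: "k < 2 ^ len k"
  by (cases "k = 0") (auto simp: floorlog_bounds)

text \<open>A weight such that values have at most \<open>B * esize e\<close> bits and costs are
  quadratic in \<open>B * esize e\<close>. Lengths of sums and products are at most additive; a
  constant counts with its length since it need not fit into \<open>B\<close> bits.\<close>

primrec esize :: "aexp \<Rightarrow> nat" where
  "esize (Num k) = 1 + len k"
| "esize (Cell a e) = esize e + 1"
| "esize (Add e f) = esize e + esize f"
| "esize (Sub e f) = esize e + esize f"
| "esize (Mul e f) = esize e + esize f"
| "esize (Div e f) = esize e + esize f"

lemma esize_pos: "1 \<le> esize e"
  by (induction e) auto

text \<open>The name of the written array is included, so that a program of size at most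
  \<open>K\<close> writes only to arrays below \<open>K\<close>.\<close>

primrec csize :: "com \<Rightarrow> nat" where
  "csize Skip = 1"
| "csize (Assign a i e) = a + 1 + esize i + esize e"
| "csize (Flip a i) = a + 1 + esize i"
| "csize (Seq p q) = csize p + csize q"
| "csize (Cond e p q) = esize e + 1 + csize p + csize q"
| "csize (While e p) = esize e + 1 + csize p"

abbreviation Var :: "nat \<Rightarrow> aexp" where
  "Var a \<equiv> Cell a (Num 0)"

abbreviation Set :: "nat \<Rightarrow> aexp \<Rightarrow> com" where
  "Set a e \<equiv> Assign a (Num 0) e"

text \<open>With truncated subtraction, \<open>b - v\<close> is nonzero exactly when
  \<open>v < b\<close>. The bound is evaluated anew before every round.\<close>

definition For :: "nat \<Rightarrow> aexp \<Rightarrow> com \<Rightarrow> com" where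
  "For v b p = Seq (Set v (Num 0)) (While (Sub b (Var v)) (Seq p (Set v (Add (Var v) (Num 1)))))"

abbreviation (input) upd :: "store \<Rightarrow> nat \<Rightarrow> nat \<Rightarrow> nat \<Rightarrow> store" where
  "upd s a i x \<equiv> s(a := (s a)(i := x))"

lemma store_charge [simp]: "store (charge k c) = store c"
  and steps_charge [simp]: "steps (charge k c) = steps c + k"
  and peak_charge [simp]: "peak (charge k c) = max (peak c) (store_size (store c) + k)"
  and store_put [simp]: "store (put a i x c) = upd (store c) a i x"
  and steps_put [simp]: "steps (put a i x c) = steps c"
  and peak_put [simp]: "peak (put a i x c) = peak c"
  by (simp_all add: charge_def put_def)

lemma sem_While:
  "sem (While e p) c = (let c' = charge (cost (store c) e + 1) c in
     if val (store c) e \<noteq> 0 then bind_spmf (sem p c') (sem (While e p)) else return_spmf c')"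
  by (auto simp: while_spmf.simps[of _ _ c] map_spmf_bind_spmf o_def Let_def intro!: bind_spmf_cong)

text \<open>
  \<open>B\<close> bounds the bit length of all cells, \<open>I\<close> the indices in use and \<open>K\<close> the size of the program.
  Since expressions have constant size, every single operation costs \<open>O(B\<^sup>2)\<close>, and it suffices to
  count operations.
\<close>

locale machine =
  fixes B I K :: nat
  assumes B: "1 \<le> B" and I: "1 \<le> I"
begin

definition wf_store :: "store \<Rightarrow> bool" where
  "wf_store s \<longleftrightarrow> (\<forall>a i. s a i < 2 ^ B \<and> (s a i \<noteq> 0 \<longrightarrow> a < K \<and> i < I))"

definition op_cost :: nat where
  "op_cost = 3 * (B * K)\<^sup>2"

text \<open>At most \<open>K * I\<close> cells are nonzero, each with an index below
  \<open>I\<close> and a value of at most \<open>B\<close> bits; \<open>op_cost\<close> leaves room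
  for the operation in progress.\<close>

definition space :: nat where
  "space = K * I * (1 + len I + B) + op_cost"

lemma B_esize: "1 \<le> B * esize e"
  using mult_le_mono[OF B esize_pos[of e]] by simp

lemma val_bound:
  assumes "wf_store s"
  shows "val s e < 2 ^ (B * esize e)"
proof (induction e)
  case (Num k)
  have "k < 2 ^ len k" by (rule less_2_pow_len)
  also have "(2::nat) ^ len k \<le> 2 ^ (B * (1 + len k))"
    by (rule power_increasing) (use mult_le_mono1[OF B, of "1 + len k"] in simp_all)
  finally show ?case by simp
next
  case (Cell a e)
  have "val s (Cell a e) < 2 ^ B" using assms by (simp add: wf_store_def)
  also have "(2::nat) ^ B \<le> 2 ^ (B * esize (Cell a e))" by (rule power_increasing) auto
  finally show ?case .
next
  case (Add e f)
  have two: "(2::nat) \<le> 2 ^ (B * esize g)" for g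
    using power_increasing[OF B_esize[of g], of "2 :: nat"] by (simp only: power_one_right)
  \<comment> \<open>The bounds are powers of 2 with positive exponent, so even a sum is covered by
    the product of the bounds; this keeps \<open>esize\<close> additive.\<close>
  have "x + y \<le> x * y" if xy: "2 \<le> x" "2 \<le> y" for x y :: nat
  proof -
    obtain x' where "x = 2 + x'" using le_Suc_ex[OF xy(1)] by blast
    moreover obtain y' where "y = 2 + y'" using le_Suc_ex[OF xy(2)] by blast
    ultimately show ?thesis by (simp add: algebra_simps)
  qed
  then have "(2::nat) ^ (B * esize e) + 2 ^ (B * esize f) \<le> 2 ^ (B * esize e) * 2 ^ (B * esize f)"
    using two by blast
  moreover have "val s (Add e f) < 2 ^ (B * esize e) + 2 ^ (B * esize f)" using Add by simp
  ultimately show ?case by (simp only: esize.simps distrib_left power_add)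
next
  case (Sub e f)
  have "val s (Sub e f) \<le> val s e" by simp
  also have "\<dots> < 2 ^ (B * esize e)" by (rule Sub)
  finally have "val s (Sub e f) < 2 ^ (B * esize e)" .
  also have "(2::nat) ^ (B * esize e) \<le> 2 ^ (B * esize (Sub e f))" by (rule power_increasing) auto
  finally show ?case .
next
  case (Mul e f)
  then have "val s e * val s f < 2 ^ (B * esize e) * 2 ^ (B * esize f)"
    by (intro mult_strict_mono) auto
  then show ?case by (simp only: val.simps esize.simps distrib_left power_add)
next
  case (Div e f)
  have "val s (Div e f) \<le> val s e" by simp
  also have "\<dots> < 2 ^ (B * esize e)" by (rule Div)
  finally have "val s (Div e f) < 2 ^ (B * esize e)" .
  also have "(2::nat) ^ (B * esize e) \<le> 2 ^ (B * esize (Div e f))" by (rule power_increasing) auto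
  finally show ?case .
qed

lemma len_val: "wf_store s \<Longrightarrow> len (val s e) \<le> B * esize e"
  by (rule len_le[OF val_bound])

text \<open>The mixed term of \<open>3 * (x + y)^2\<close> is \<open>6 * x * y\<close>, which covers
  \<open>(1 + x) * (1 + y)\<close> because \<open>x\<close> and \<open>y\<close> are at least 1.
  Hence a quadratic cost bound passes through an induction over expressions.\<close>

lemma cross_terms:
  fixes x y a b p q :: nat
  assumes "1 \<le> x" "1 \<le> y" "a \<le> 3 * x\<^sup>2" "b \<le> 3 * y\<^sup>2" "p \<le> x" "q \<le> y"
  shows "a + b + (1 + p) * (1 + q) \<le> 3 * (x + y)\<^sup>2" (is ?A)
    "a + b + 1 + p + q \<le> 3 * (x + y)\<^sup>2" (is ?B)
proof -
  obtain x' y' where xy: "x = 1 + x'" "y = 1 + y'" using assms by (metis le_iff_add)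
  have "3 * x\<^sup>2 + 3 * y\<^sup>2 + (1 + x) * (1 + y) \<le> 3 * (x + y)\<^sup>2"
    unfolding xy by (simp add: power2_eq_square algebra_simps)
  moreover have "(1 + p) * (1 + q) \<le> (1 + x) * (1 + y)" using assms by (intro mult_le_mono) auto
  ultimately show A: ?A using assms(3,4) by linarith
  have "1 + p + q \<le> (1 + p) * (1 + q)" by simp
  then show ?B using A by linarith
qed

lemma cost_bound:
  assumes "wf_store s"
  shows "cost s e \<le> 3 * (B * esize e)\<^sup>2"
proof (induction e)
  case (Num k)
  have "1 + len k \<le> B * (1 + len k)" using mult_le_mono1[OF B, of "1 + len k"] by simp
  also have "\<dots> \<le> (B * (1 + len k))\<^sup>2" by (simp add: power2_eq_square)
  finally show ?case by simp
next
  case (Cell a e)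
  have "len (s a (val s e)) \<le> B" using assms by (intro len_le) (simp add: wf_store_def)
  from cross_terms(2)[OF B_esize B Cell _ len_val[OF assms] this, of 0]
  show ?case by (simp add: distrib_left add.commute[of B])
next
  case (Mul e f)
  have eq: "B * esize (Mul e f) = B * esize e + B * esize f" by (simp add: distrib_left)
  show ?case unfolding eq cost.simps
    by (rule cross_terms(1)[OF B_esize B_esize Mul len_val[OF assms] len_val[OF assms]])
next
  case (Div e f)
  have eq: "B * esize (Div e f) = B * esize e + B * esize f" by (simp add: distrib_left)
  show ?case unfolding eq cost.simps
    by (rule cross_terms(1)[OF B_esize B_esize Div len_val[OF assms] len_val[OF assms]])
next
  case (Add e f)
  have eq: "B * esize (Add e f) = B * esize e + B * esize f" by (simp add: distrib_left)
  show ?case unfolding eq cost.simps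
    by (rule cross_terms(2)[OF B_esize B_esize Add len_val[OF assms] len_val[OF assms]])
next
  case (Sub e f)
  have eq: "B * esize (Sub e f) = B * esize e + B * esize f" by (simp add: distrib_left)
  show ?case unfolding eq cost.simps
    by (rule cross_terms(2)[OF B_esize B_esize Sub len_val[OF assms] len_val[OF assms]])
qed

lemma op_cost_mono: "k \<le> 3 * (B * m)\<^sup>2 \<Longrightarrow> m \<le> K \<Longrightarrow> k \<le> op_cost"
  unfolding op_cost_def by (erule le_trans) (simp add: power_mono)

lemma store_size_bound:
  assumes "wf_store s"
  shows "store_size s + op_cost \<le> space"
proof -
  let ?N = "{(a, i). s a i \<noteq> 0}"
  have sub: "?N \<subseteq> {..<K} \<times> {..<I}" using assms by (auto simp: wf_store_def)
  have "store_size s = (\<Sum>(a, i)\<in>?N. 1 + len i + len (s a i))"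
    unfolding store_size_def by (simp add: case_prod_unfold)
  also have "\<dots> \<le> (\<Sum>(a, i)\<in>?N. 1 + len I + B)"
  proof (rule sum_mono, clarify)
    fix a i assume "0 < s a i"
    then have "i < I" "s a i < 2 ^ B" using assms by (auto simp: wf_store_def)
    then show "1 + len i + len (s a i) \<le> 1 + len I + B" by (intro add_mono len_mono len_le) auto
  qed
  also have "\<dots> = card ?N * (1 + len I + B)" by (simp add: case_prod_unfold)
  also have "card ?N * (1 + len I + B) \<le> card ({..<K} \<times> {..<I}) * (1 + len I + B)"
    by (intro mult_le_mono1 card_mono[OF _ sub]) simp
  finally show ?thesis by (simp add: space_def)
qed

text \<open>A statement about all outcomes of the coin flips; probabilities enter only later. The
  conditions \<open>csize p \<le> K\<close> and \<open>wf_store s\<close> are premises inside the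
  triple, so the rules below carry no side conditions about them, and \<open>wf_store\<close> of the
  outcome is part of the promise, so triples compose. Time is counted in operations of cost at most
  \<open>op_cost\<close>.\<close>

definition tr :: "com \<Rightarrow> store \<Rightarrow> nat \<Rightarrow> (store \<Rightarrow> bool) \<Rightarrow> bool" where
  "tr p s k Q \<longleftrightarrow> (csize p \<le> K \<and> wf_store s \<longrightarrow> (\<forall>c. store c = s \<longrightarrow> lossless_spmf (sem p c) \<and>
     (\<forall>c'\<in>set_spmf (sem p c). wf_store (store c') \<and> Q (store c') \<and>
        steps c' \<le> steps c + k * op_cost \<and> (peak c \<le> space \<longrightarrow> peak c' \<le> space))))"

lemma tr_conseq:
  assumes "tr p s k Q" "k \<le> l" "\<And>s'. Q s' \<Longrightarrow> Q' s'"
  shows "tr p s l Q'"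
proof -
  have le: "k * op_cost \<le> l * op_cost" using assms(2) by simp
  have *: "n \<le> m + k * op_cost \<Longrightarrow> n \<le> m + l * op_cost" for n m using le by linarith
  show ?thesis using assms(1,3) * unfolding tr_def by blast
qed

lemma size_op: "wf_store s \<Longrightarrow> k \<le> op_cost \<Longrightarrow> store_size s + k \<le> space"
  using store_size_bound[of s] by simp

lemma tr_skip: "Q s \<Longrightarrow> tr Skip s 1 Q"
proof -
  assume Q: "Q s"
  have "1 \<le> op_cost" if "1 \<le> K"
    using op_cost_mono[of 1 1] B that by (simp add: power2_eq_square)
  then show ?thesis using Q size_op[of s 1] by (auto simp: tr_def)
qed

lemma wf_upd:
  assumes "wf_store s" "a < K" "j < I" "x < 2 ^ B"
  shows "wf_store (upd s a j x)"
  using assms by (auto simp: wf_store_def)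

lemma tr_assign:
  assumes "val s i < I" "val s e < 2 ^ B" "Q (upd s a (val s i) (val s e))"
  shows "tr (Assign a i e) s 1 Q"
proof -
  have cost: "cost s i + cost s e + 1 + len (val s i) + len (val s e) \<le> op_cost"
    if "csize (Assign a i e) \<le> K" "wf_store s"
  proof (rule op_cost_mono)
    show "cost s i + cost s e + 1 + len (val s i) + len (val s e) \<le> 3 * (B * (esize i + esize e))\<^sup>2"
      using cross_terms(2)[OF B_esize B_esize cost_bound cost_bound len_val len_val, OF that(2) that(2) that(2) that(2)]
      by (simp only: distrib_left)
  qed (use that in simp)
  show ?thesis
    unfolding tr_def
  proof (intro impI allI conjI ballI)
    fix c c' assume *: "csize (Assign a i e) \<le> K \<and> wf_store s" "store c = s" "c' \<in> set_spmf (sem (Assign a i e) c)"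
    then have c': "c' = put a (val s i) (val s e)
        (charge (cost s i + cost s e + 1 + len (val s i) + len (val s e)) c)" by (simp add: Let_def)
    show "wf_store (store c')" "Q (store c')" "steps c' \<le> steps c + 1 * op_cost"
      unfolding c' using * assms cost by (auto intro: wf_upd)
    show "peak c' \<le> space" if "peak c \<le> space"
      unfolding c' using size_op[OF _ cost] that * by simp
  qed (simp add: Let_def)
qed

lemma tr_flip:
  assumes "val s i < I" "\<And>b. Q (upd s a (val s i) (of_bool b))"
  shows "tr (Flip a i) s 1 Q"
proof -
  have cost: "cost s i + 2 + len (val s i) \<le> op_cost" if "csize (Flip a i) \<le> K" "wf_store s"
  proof (rule op_cost_mono)
    show "cost s i + 2 + len (val s i) \<le> 3 * (B * (esize i + 1))\<^sup>2"
    proof -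
      have "cost s i + 0 + 1 + len (val s i) + 1 \<le> 3 * (B * esize i + B)\<^sup>2"
        by (rule cross_terms(2)[OF B_esize B cost_bound[OF that(2)] _ len_val[OF that(2)] B]) simp
      then show ?thesis by (simp add: distrib_left add.commute[of B])
    qed
  qed (use that in simp)
  have 1: "(1::nat) < 2 ^ B" using B by (intro one_less_power) auto
  show ?thesis
    unfolding tr_def
  proof (intro impI allI conjI ballI)
    fix c c' assume *: "csize (Flip a i) \<le> K \<and> wf_store s" "store c = s" "c' \<in> set_spmf (sem (Flip a i) c)"
    then obtain b where c': "c' = put a (val s i) (of_bool b) (charge (cost s i + 2 + len (val s i)) c)"
      by (auto simp: Let_def)
    show "wf_store (store c')" "Q (store c')" "steps c' \<le> steps c + 1 * op_cost"
      unfolding c' using * assms cost 1 by (auto intro!: wf_upd)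
    show "peak c' \<le> space" if "peak c \<le> space"
      unfolding c' using size_op[OF _ cost] that * by simp
  qed (simp add: Let_def)
qed

text \<open>The postcondition of \<open>p\<close> is itself a triple for \<open>q\<close>, as in a
  weakest-precondition calculus.\<close>

lemma tr_seq:
  assumes "tr p s k (\<lambda>s'. tr q s' l Q)"
  shows "tr (Seq p q) s (k + l) Q"
  unfolding tr_def
proof (intro impI allI conjI ballI)
  fix c :: config assume *: "csize (Seq p q) \<le> K \<and> wf_store s" "store c = s"
  then have p: "lossless_spmf (sem p c)" "\<And>c'. c' \<in> set_spmf (sem p c) \<Longrightarrow>
      wf_store (store c') \<and> tr q (store c') l Q \<and> steps c' \<le> steps c + k * op_cost \<and>
      (peak c \<le> space \<longrightarrow> peak c' \<le> space)"
    using assms by (auto simp: tr_def)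
  have q: "lossless_spmf (sem q c') \<and> (\<forall>d\<in>set_spmf (sem q c'). wf_store (store d) \<and> Q (store d) \<and>
      steps d \<le> steps c' + l * op_cost \<and> (peak c' \<le> space \<longrightarrow> peak d \<le> space))"
    if "c' \<in> set_spmf (sem p c)" for c'
    using p(2)[OF that] * by (auto simp: tr_def)
  show "lossless_spmf (sem (Seq p q) c)" using p(1) q by simp
  fix d assume "d \<in> set_spmf (sem (Seq p q) c)"
  then obtain c' where c': "c' \<in> set_spmf (sem p c)" "d \<in> set_spmf (sem q c')"
    by (auto simp: set_bind_spmf)
  show "wf_store (store d)" "Q (store d)" using q[OF c'(1)] c'(2) by auto
  have "steps d \<le> steps c' + l * op_cost" "steps c' \<le> steps c + k * op_cost"
    using q[OF c'(1)] c'(2) p(2)[OF c'(1)] by auto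
  then show "steps d \<le> steps c + (k + l) * op_cost" by (simp add: distrib_right)
  show "peak d \<le> space" if "peak c \<le> space" using q[OF c'(1)] c'(2) p(2)[OF c'(1)] that by auto
qed

lemma cost_test:
  assumes "wf_store s" "esize e + 1 \<le> K"
  shows "cost s e + 1 \<le> op_cost"
proof (rule op_cost_mono[OF _ assms(2)])
  show "cost s e + 1 \<le> 3 * (B * (esize e + 1))\<^sup>2"
  proof -
    have "cost s e + 0 + 1 + 0 + 0 \<le> 3 * (B * esize e + B)\<^sup>2"
      by (rule cross_terms(2)[OF B_esize B cost_bound[OF assms(1)]]) simp_all
    then show ?thesis by (simp add: distrib_left add.commute[of B])
  qed
qed

lemma tr_cond:
  assumes "val s e \<noteq> 0 \<Longrightarrow> tr p s k Q" "val s e = 0 \<Longrightarrow> tr q s k Q"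
  shows "tr (Cond e p q) s (k + 1) Q"
proof -
  have "tr (if val s e \<noteq> 0 then p else q) s k Q" using assms by auto
  note * = this[unfolded tr_def]
  show ?thesis
    unfolding tr_def
  proof (intro impI allI)
    fix c :: config assume c: "csize (Cond e p q) \<le> K \<and> wf_store s" "store c = s"
    define c0 where "c0 = charge (cost s e + 1) c"
    have c0: "store c0 = s" "steps c0 \<le> steps c + op_cost" "peak c \<le> space \<Longrightarrow> peak c0 \<le> space"
      using c cost_test[of s e] size_op[of s "cost s e + 1"] by (auto simp: c0_def)
    have sem: "sem (Cond e p q) c = sem (if val s e \<noteq> 0 then p else q) c0"
      using c by (simp add: c0_def Let_def)
    have "csize (if val s e \<noteq> 0 then p else q) \<le> K \<and> wf_store s" using c by auto
    moreover have "n \<le> steps c + (k + 1) * op_cost" if "n \<le> steps c0 + k * op_cost" for n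
      using that c0(2) by (simp add: distrib_right)
    ultimately show "lossless_spmf (sem (Cond e p q) c) \<and>
      (\<forall>c'\<in>set_spmf (sem (Cond e p q) c). wf_store (store c') \<and> Q (store c') \<and>
        steps c' \<le> steps c + (k + 1) * op_cost \<and> (peak c \<le> space \<longrightarrow> peak c' \<le> space))"
      unfolding sem using * c0(1,3) by blast
  qed
qed

text \<open>The index \<open>t\<close> of the invariant is the variant: at most \<open>t\<close>
  rounds of cost \<open>k + 1\<close> including the test, and one last test.\<close>

lemma tr_while:
  assumes "J t s"
    and step: "\<And>t s. J t s \<Longrightarrow> val s e \<noteq> 0 \<Longrightarrow> tr p s k (\<lambda>s'. \<exists>t'<t. J t' s')"
    and exit: "\<And>t s. J t s \<Longrightarrow> val s e = 0 \<Longrightarrow> Q s"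
  shows "tr (While e p) s (t * (k + 1) + 1) Q"
  using assms(1)
proof (induction t arbitrary: s rule: less_induct)
  case (less t)
  show ?case
    unfolding tr_def
  proof (intro impI allI)
    fix c :: config assume c: "csize (While e p) \<le> K \<and> wf_store s" "store c = s"
    define c0 where "c0 = charge (cost s e + 1) c"
    have c0: "store c0 = s" "steps c0 \<le> steps c + op_cost" "peak c \<le> space \<Longrightarrow> peak c0 \<le> space"
      using c cost_test[of s e] size_op[of s "cost s e + 1"] by (auto simp: c0_def)
    show "lossless_spmf (sem (While e p) c) \<and>
      (\<forall>c'\<in>set_spmf (sem (While e p) c). wf_store (store c') \<and> Q (store c') \<and>
        steps c' \<le> steps c + (t * (k + 1) + 1) * op_cost \<and> (peak c \<le> space \<longrightarrow> peak c' \<le> space))"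
    proof (cases "val s e = 0")
      case True
      then have "sem (While e p) c = return_spmf c0" using c by (subst sem_While) (simp add: c0_def Let_def)
      then show ?thesis using c c0 exit[OF less.prems True] by auto
    next
      case False
      then have sem: "sem (While e p) c = bind_spmf (sem p c0) (sem (While e p))"
        using c by (subst sem_While) (simp add: c0_def Let_def)
      have p: "lossless_spmf (sem p c0)" "\<And>c'. c' \<in> set_spmf (sem p c0) \<Longrightarrow>
          wf_store (store c') \<and> (\<exists>t'<t. J t' (store c')) \<and> steps c' \<le> steps c0 + k * op_cost \<and>
          (peak c0 \<le> space \<longrightarrow> peak c' \<le> space)"
        using step[OF less.prems False, unfolded tr_def] c c0(1) by auto
      have w: "lossless_spmf (sem (While e p) c') \<and> (\<forall>d\<in>set_spmf (sem (While e p) c'). wf_store (store d) \<and>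
          Q (store d) \<and> steps d \<le> steps c + (t * (k + 1) + 1) * op_cost \<and> (peak c \<le> space \<longrightarrow> peak d \<le> space))"
        if c': "c' \<in> set_spmf (sem p c0)" for c'
      proof -
        obtain t' where t': "t' < t" "J t' (store c')" using p(2)[OF c'] by blast
        have 1: "wf_store (store c')" "steps c' \<le> steps c0 + k * op_cost" "peak c \<le> space \<Longrightarrow> peak c' \<le> space"
          using p(2)[OF c'] c0 by auto
        have 2: "lossless_spmf (sem (While e p) c') \<and> (\<forall>d\<in>set_spmf (sem (While e p) c'). wf_store (store d) \<and>
          Q (store d) \<and> steps d \<le> steps c' + (t' * (k + 1) + 1) * op_cost \<and> (peak c' \<le> space \<longrightarrow> peak d \<le> space))"
          using less.IH[OF t', unfolded tr_def] c 1(1) by blast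
        have "(t' * (k + 1) + 1) + (k + 1) \<le> t * (k + 1) + 1"
          using mult_le_mono1[of "Suc t'" t "k + 1"] t' by simp
        then have "((t' * (k + 1) + 1) + (k + 1)) * op_cost \<le> (t * (k + 1) + 1) * op_cost"
          by (rule mult_le_mono1)
        then have "steps c' + (t' * (k + 1) + 1) * op_cost \<le> steps c + (t * (k + 1) + 1) * op_cost"
          using 1(2) c0(2) by (simp add: distrib_right)
        then show ?thesis using 2 1(3) by (meson le_trans)
      qed
      show ?thesis unfolding sem using p(1) w by (auto simp: set_bind_spmf)
    qed
  qed
qed

text \<open>A round costs \<open>k\<close> for the body, 1 for the increment and 1 for the test; the
  remaining 2 are the initialisation and the last test. The bound must still evaluate to
  \<open>N\<close> at \<open>i = N\<close>, when that last test is made. The body has to leave the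
  counter alone, and the invariant is stated for the store after the increment.\<close>

lemma tr_for:
  assumes start: "J 0 (upd s v 0 0)" and N: "N < 2 ^ B"
    and bound: "\<And>i s. J i s \<Longrightarrow> i \<le> N \<Longrightarrow> val s b = N"
    and step: "\<And>i s. i < N \<Longrightarrow> J i s \<Longrightarrow> s v 0 = i \<Longrightarrow>
      tr p s k (\<lambda>s'. s' v 0 = i \<and> J (Suc i) (upd s' v 0 (Suc i)))"
    and exit: "\<And>s. J N s \<Longrightarrow> s v 0 = N \<Longrightarrow> Q s"
  shows "tr (For v b p) s (N * (k + 2) + 2) Q"
proof -
  define J' where "J' t s \<longleftrightarrow> s v 0 \<le> N \<and> t = N - s v 0 \<and> J (s v 0) s" for t and s :: store
  have "tr (While (Sub b (Var v)) (Seq p (Set v (Add (Var v) (Num 1))))) (upd s v 0 0)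
      (N * ((k + 1) + 1) + 1) Q"
  proof (rule tr_while[where J = J' and t = N and k = "k + 1" and Q = Q])
    show "J' N (upd s v 0 0)" using start by (simp add: J'_def)
  next
    fix t s assume J: "J' t s" "val s (Sub b (Var v)) \<noteq> 0"
    then have lt: "s v 0 < N" and "J (s v 0) s" using bound[of "s v 0" s] by (auto simp: J'_def)
    show "tr (Seq p (Set v (Add (Var v) (Num 1)))) s (k + 1) (\<lambda>s'. \<exists>t'<t. J' t' s')"
    proof (rule tr_seq, rule tr_conseq[OF step[OF lt \<open>J (s v 0) s\<close> refl] order.refl], rule tr_assign)
      fix s' assume s': "s' v 0 = s v 0 \<and> J (Suc (s v 0)) (upd s' v 0 (Suc (s v 0)))"
      show "val s' (Num 0) < I" using I by simp
      show "val s' (Add (Var v) (Num 1)) < 2 ^ B" using s' lt N by simp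
      show "\<exists>t'<t. J' t' (upd s' v (val s' (Num 0)) (val s' (Add (Var v) (Num 1))))"
        using s' lt J by (auto simp: J'_def)
    qed
  next
    fix t s assume J: "J' t s" "val s (Sub b (Var v)) = 0"
    then have "val s b = N" using bound[of "s v 0" s] by (auto simp: J'_def)
    then have "s v 0 = N" using J by (auto simp: J'_def)
    then show "Q s" using exit J by (auto simp: J'_def)
  qed
  then have "tr (For v b p) s (1 + (N * ((k + 1) + 1) + 1)) Q"
    unfolding For_def using I by (intro tr_seq tr_assign) auto
  then show ?thesis by (rule tr_conseq) auto
qed

lemma tr_lossless: "tr p s k Q \<Longrightarrow> csize p \<le> K \<Longrightarrow> wf_store s \<Longrightarrow> store c = s \<Longrightarrow> lossless_spmf (sem p c)"
  by (auto simp: tr_def)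

lemma tr_post: "tr p s k Q \<Longrightarrow> csize p \<le> K \<Longrightarrow> wf_store s \<Longrightarrow> store c = s \<Longrightarrow> c' \<in> set_spmf (sem p c) \<Longrightarrow>
    wf_store (store c') \<and> Q (store c')"
  by (auto simp: tr_def)

end


section \<open>The distribution of the random bits\<close>

text \<open>Induction on the number of cells still to be filled: one coin flip averages over the
  sets with and without the current index. The loop bound may depend neither on the random array nor
  on the counter.\<close>

lemma prob_flips:
  assumes av: "a \<noteq> v" and b: "\<And>s'. (\<And>x. x \<noteq> a \<Longrightarrow> x \<noteq> v \<Longrightarrow> s' x = s x) \<Longrightarrow> val s' b = N"
    and c: "store c = s"
  shows "measure (measure_spmf (sem (For v b (Flip a (Var v))) c)) {c. G (store c)}
    = card {S \<in> Pow {..<N}. G (s(a := \<lambda>i. if i < N then of_bool (i \<in> S) else s a i, v := (s v)(0 := N)))} / 2 ^ N"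
proof -
  \<comment> \<open>The final store if the cells from \<open>t\<close> on receive the bits of
    \<open>S\<close>.\<close>
  define fin where "fin t s' S = s'(a := \<lambda>i. if t \<le> i \<and> i < N then of_bool (i \<in> S) else s' a i, v := (s' v)(0 := N))"
    for t and s' :: store and S
  let ?w = "While (Sub b (Var v)) (Seq (Flip a (Var v)) (Set v (Add (Var v) (Num 1))))"
  have main: "measure (measure_spmf (sem ?w c)) {c. G (store c)}
      = card {S \<in> Pow {t..<N}. G (fin t (store c) S)} / 2 ^ (N - t)"
    if "store c v 0 = t" "t \<le> N" "\<And>x. x \<noteq> a \<Longrightarrow> x \<noteq> v \<Longrightarrow> store c x = s x" for t c
    using that
  proof (induction "N - t" arbitrary: t c)
    case 0
    then have tN: "t = N" by simp
    have "val (store c) b = N" using 0 by (intro b) auto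
    then have "sem ?w c = return_spmf (charge (cost (store c) (Sub b (Var v)) + 1) c)"
      using 0 tN by (subst sem_While) (simp only: Let_def val.simps if_False, simp)
    then have m: "measure (measure_spmf (sem ?w c)) {c. G (store c)} = of_bool (G (store c))"
      by (simp only: measure_spmf_return_spmf) (simp add: measure_return)
    have "fin t (store c) {} = store c" using 0 tN by (auto simp: fin_def fun_eq_iff)
    moreover have "{S \<in> Pow {t..<N}. G (fin t (store c) S)} = (if G (fin t (store c) {}) then {{}} else {})"
      using tN by auto
    ultimately show ?case unfolding m using tN by simp
  next
    case (Suc k)
    have t: "t < N" "k = N - Suc t" using Suc.hyps(2) by auto
    have vb: "val (store c) b = N" using Suc.prems by (intro b) auto
    define c0 where "c0 = charge (cost (store c) (Sub b (Var v)) + 1) c"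
    define c1 where "c1 x = put a t (of_bool x) (charge (cost (store c0) (Var v) + 2 + len t) c0)" for x
    define c2 where "c2 x = put v 0 (Suc t) (charge (cost (store (c1 x)) (Num 0) +
      cost (store (c1 x)) (Add (Var v) (Num 1)) + 1 + len 0 + len (Suc t)) (c1 x))" for x
    have s2: "store (c2 x) = upd (upd (store c) a t (of_bool x)) v 0 (Suc t)" for x
      by (simp add: c2_def c1_def c0_def)
    have "sem ?w c = bind_spmf coin_spmf (\<lambda>x. sem ?w (c2 x))"
    proof -
      have "sem ?w c = bind_spmf (sem (Seq (Flip a (Var v)) (Set v (Add (Var v) (Num 1)))) c0) (sem ?w)"
        using vb Suc.prems t by (subst sem_While) (simp add: Let_def c0_def)
      also have "sem (Seq (Flip a (Var v)) (Set v (Add (Var v) (Num 1)))) c0 = map_spmf c2 coin_spmf"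
        using Suc.prems av by (simp add: Let_def c0_def c1_def c2_def bind_map_spmf o_def map_spmf_conv_bind_spmf)
      finally show ?thesis by (simp add: bind_map_spmf o_def)
    qed
    then have mc: "measure (measure_spmf (sem ?w c)) {c. G (store c)}
      = (measure (measure_spmf (sem ?w (c2 True))) {c. G (store c)}
        + measure (measure_spmf (sem ?w (c2 False))) {c. G (store c)}) / 2"
      by (simp only: measure_bind_coin)
    have pc: "measure (measure_spmf (sem ?w (c2 x))) {c. G (store c)}
        = card {S \<in> Pow {Suc t..<N}. G (fin (Suc t) (store (c2 x)) S)} / 2 ^ (N - Suc t)" for x
      by (rule Suc.hyps(1)) (use t Suc.prems in \<open>auto simp: s2\<close>)
    have fT: "fin (Suc t) (store (c2 True)) S = fin t (store c) (insert t S)" if "S \<subseteq> {Suc t..<N}" for S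
      using that t av by (auto simp: fin_def s2 fun_eq_iff)
    have fF: "fin (Suc t) (store (c2 False)) S = fin t (store c) S" if "S \<subseteq> {Suc t..<N}" for S
      using that t av by (auto simp: fin_def s2 fun_eq_iff)
    have prob: "measure (measure_spmf (sem ?w c)) {c. G (store c)} =
        (card {S \<in> Pow {Suc t..<N}. G (fin (Suc t) (store (c2 True)) S)} / 2 ^ (N - Suc t) +
         card {S \<in> Pow {Suc t..<N}. G (fin (Suc t) (store (c2 False)) S)} / 2 ^ (N - Suc t)) / 2"
      unfolding mc pc ..
    \<comment> \<open>Sets of outcomes split according to the bit drawn for \<open>t\<close>; the
      factor 2 from the two halves matches one power of 2 in the denominator.\<close>
    let ?P = "{S \<in> Pow {Suc t..<N}. G (fin t (store c) (insert t S))}"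
    let ?Q = "{S \<in> Pow {Suc t..<N}. G (fin t (store c) S)}"
    have eqs: "{S \<in> Pow {Suc t..<N}. G (fin (Suc t) (store (c2 True)) S)} = ?P"
      "{S \<in> Pow {Suc t..<N}. G (fin (Suc t) (store (c2 False)) S)} = ?Q"
      using fT fF by auto
    have ivl: "{t..<N} = insert t {Suc t..<N}" using t by auto
    have "{S \<in> Pow {t..<N}. G (fin t (store c) S)} = insert t ` ?P \<union> ?Q"
      unfolding ivl Pow_insert by auto
    moreover have "card (insert t ` ?P \<union> ?Q) = card (insert t ` ?P) + card ?Q"
      by (rule card_Un_disjoint) auto
    moreover have "card (insert t ` ?P) = card ?P"
    proof (rule card_image, rule inj_onI)
      fix S S' assume *: "S \<in> ?P" "S' \<in> ?P" "insert t S = insert t S'"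
      then have "t \<notin> S" "t \<notin> S'" by auto
      then show "S = S'" using *(3) by (simp add: insert_ident)
    qed
    moreover have "(2::real) ^ (N - t) = 2 * 2 ^ (N - Suc t)"
      using t by (metis Suc_diff_Suc power_Suc)
    ultimately show ?case unfolding prob eqs by (simp add: add_divide_distrib)
  qed
  define c1 where "c1 = put v 0 0 (charge (cost s (Num 0) + cost s (Num 0) + 1 + len 0 + len 0) c)"
  have s1: "store c1 = upd s v 0 0" using c by (simp add: c1_def)
  have "sem (For v b (Flip a (Var v))) c = sem ?w c1"
    using c by (simp add: For_def c1_def Let_def)
  then have "measure (measure_spmf (sem (For v b (Flip a (Var v))) c)) {c. G (store c)}
      = card {S \<in> Pow {0..<N}. G (fin 0 (store c1) S)} / 2 ^ (N - 0)"
    using main[of c1 0] s1 by simp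
  moreover have "fin 0 (store c1) S = s(a := \<lambda>i. if i < N then of_bool (i \<in> S) else s a i, v := (s v)(0 := N))" for S
    using av by (auto simp: fin_def s1 fun_eq_iff)
  ultimately show ?thesis by (simp add: atLeast0LessThan)
qed

section \<open>The algorithm\<close>

text \<open>Arrays 0 to 4 are fixed by the input and output convention. \<open>pw\<close> caches
  powers of 2, as expressions offer neither shifts nor exponentiation.\<close>

abbreviation (input) "vn \<equiv> 0 :: nat"
abbreviation (input) "adj \<equiv> 1 :: nat"
abbreviation (input) "din \<equiv> 2 :: nat"
abbreviation (input) "dout \<equiv> 3 :: nat"
abbreviation (input) "ans \<equiv> 4 :: nat"
abbreviation (input) "pw \<equiv> 5 :: nat"
abbreviation (input) "vu \<equiv> 6 :: nat"
abbreviation (input) "vv \<equiv> 7 :: nat"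
abbreviation (input) "flag \<equiv> 8 :: nat"
abbreviation (input) "vX \<equiv> 9 :: nat"
abbreviation (input) "sumo \<equiv> 10 :: nat"
abbreviation (input) "sumi \<equiv> 11 :: nat"
abbreviation (input) "vy \<equiv> 12 :: nat"
abbreviation (input) "vx \<equiv> 13 :: nat"
abbreviation (input) "nb \<equiv> 14 :: nat"
abbreviation (input) "vN \<equiv> 16 :: nat"
abbreviation (input) "vN' \<equiv> 17 :: nat"
abbreviation (input) "vra \<equiv> 18 :: nat"
abbreviation (input) "vca \<equiv> 19 :: nat"
abbreviation (input) "vt \<equiv> 20 :: nat"
abbreviation (input) "vk \<equiv> 21 :: nat"
abbreviation (input) "vD \<equiv> 22 :: nat"
abbreviation (input) "vL \<equiv> 23 :: nat"
abbreviation (input) "rnd \<equiv> 24 :: nat"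
abbreviation (input) "vf \<equiv> 25 :: nat"
abbreviation (input) "vW \<equiv> 26 :: nat"
abbreviation (input) "vi \<equiv> 27 :: nat"
abbreviation (input) "vj \<equiv> 28 :: nat"
abbreviation (input) "vd \<equiv> 29 :: nat"
abbreviation (input) "ve \<equiv> 30 :: nat"
abbreviation (input) "vrep \<equiv> 31 :: nat"
abbreviation (input) "vkk \<equiv> 32 :: nat"
abbreviation (input) "sx \<equiv> 33 :: nat"
abbreviation (input) "sy \<equiv> 34 :: nat"
abbreviation (input) "sz \<equiv> 35 :: nat"

definition Mod2 :: "aexp \<Rightarrow> aexp" where
  "Mod2 e = Sub e (Mul (Num 2) (Div e (Num 2)))"

text \<open>In truncated subtraction one of the two differences is 0, so their sum is the
  distance.\<close>

definition EqE :: "aexp \<Rightarrow> aexp \<Rightarrow> aexp" where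
  "EqE e f = Sub (Num 1) (Add (Sub e f) (Sub f e))"

text \<open>Membership of a vertex in the set coded by \<open>vX\<close>; compare
  \<open>mset_of\<close>.\<close>

definition BitE :: "aexp \<Rightarrow> aexp" where
  "BitE e = Mod2 (Div (Var vX) (Cell pw e))"

lemma val_Mod2 [simp]: "val s (Mod2 e) = val s e mod 2"
  by (simp add: Mod2_def minus_mult_div_eq_mod)

lemma val_EqE [simp]: "val s (EqE e f) = of_bool (val s e = val s f)"
  by (auto simp: EqE_def)

lemma val_BitE [simp]: "val s (BitE e) = s vX 0 div s pw (val s e) mod 2"
  by (simp add: BitE_def)

definition same :: "nat set \<Rightarrow> store \<Rightarrow> store \<Rightarrow> bool" where
  "same A s s' \<longleftrightarrow> (\<forall>x. x \<notin> A \<longrightarrow> s' x = s x)"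

lemma same_refl [simp]: "same A s s" by (simp add: same_def)
lemma same_upd [simp]: "x \<in> A \<Longrightarrow> same A s (s'(x := f)) \<longleftrightarrow> same A s s'"
  by (auto simp: same_def)
lemma same_trans: "same A s s' \<Longrightarrow> same A' s' s'' \<Longrightarrow> A \<union> A' \<subseteq> C \<Longrightarrow> same C s s''"
  unfolding same_def by (metis UnI1 UnI2 subsetD)
lemma same_mono: "same A s s' \<Longrightarrow> A \<subseteq> C \<Longrightarrow> same C s s'"
  by (auto simp: same_def)
lemma sameD: "same A s s' \<Longrightarrow> x \<notin> A \<Longrightarrow> s' x = s x"
  by (auto simp: same_def)


subsection \<open>Polynomial arithmetic modulo \<open>w\<^sup>L\<close>\<close>

text \<open>
  The array \<open>vW\<close> is divided into slots of length \<open>L\<close>, each of them holding the coefficients of a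
  polynomial over \<open>GF(2)\<close>.
\<close>

definition slot :: "nat \<Rightarrow> (nat \<Rightarrow> nat) \<Rightarrow> nat \<Rightarrow> bit poly" where
  "slot L w x = (\<Sum>d<L. monom (of_nat (w (x * L + d))) d)"

lemma coeff_slot: "coeff (slot L w x) d = (if d < L then of_nat (w (x * L + d)) else 0)"
  by (simp add: slot_def coeff_sum if_distrib cong: if_cong)

lemma slot_cong: "(\<And>d. d < L \<Longrightarrow> w (x * L + d) = w' (x * L + d)) \<Longrightarrow> slot L w x = slot L w' x"
  unfolding slot_def by (intro sum.cong) auto

lemma slot_disjoint:
  assumes "y \<noteq> x" "d < L"
  shows "y * L + d < x * L \<or> (x + 1) * L \<le> y * L + (d::nat)"
proof (cases "y < x")
  case True
  then have "(y + 1) * L \<le> x * L" by (intro mult_le_mono1) simp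
  then show ?thesis using assms(2) by simp
next
  case False
  then have "(x + 1) * L \<le> y * L" using assms(1) by (intro mult_le_mono1) simp
  then show ?thesis by simp
qed

lemma slot_index:
  assumes "d < L" "(x + 1) * L \<le> I"
  shows "x * L + d < (I::nat)"
  using assms by simp

lemma of_nat_mod_2_bit: "of_nat (m mod 2) = (of_nat m :: bit)"
proof (cases "even m")
  case True
  then obtain k where "m = 2 * k" by (elim evenE)
  then show ?thesis by simp
next
  case False
  then obtain k where "m = 2 * k + 1" by (elim oddE)
  then show ?thesis by simp
qed

text \<open>Schoolbook multiplication added onto slot \<open>sx\<close>. The inner bound
  \<open>L - d\<close> drops exactly the products of degree at least \<open>L\<close>. As the target
  changes during the loop, it must differ from both factors.\<close>

definition MulAdd :: com where
  "MulAdd = For vd (Var vL) (For ve (Sub (Var vL) (Var vd))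
     (Assign vW (Add (Mul (Var sx) (Var vL)) (Add (Var vd) (Var ve)))
       (Mod2 (Add (Cell vW (Add (Mul (Var sx) (Var vL)) (Add (Var vd) (Var ve))))
          (Mul (Cell vW (Add (Mul (Var sy) (Var vL)) (Var vd)))
               (Cell vW (Add (Mul (Var sz) (Var vL)) (Var ve))))))))"

definition Copy :: com where
  "Copy = For vd (Var vL)
     (Assign vW (Add (Mul (Var sx) (Var vL)) (Var vd)) (Cell vW (Add (Mul (Var sy) (Var vL)) (Var vd))))"

text \<open>For loops that rewrite slot \<open>x\<close> cell by cell: \<open>g\<close> gives its
  current coefficients and \<open>w0\<close> the untouched rest. Keeping all cells at 0 or 1 makes
  the passage to \<open>bit\<close> faithful.\<close>

definition slot_inv :: "nat \<Rightarrow> nat \<Rightarrow> (nat \<Rightarrow> nat) \<Rightarrow> (nat \<Rightarrow> bit) \<Rightarrow> (nat \<Rightarrow> nat) \<Rightarrow> bool" where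
  "slot_inv L x w0 g w \<longleftrightarrow> (\<forall>i. w i \<le> 1) \<and> (\<forall>f<L. of_nat (w (x * L + f)) = g f) \<and>
     (\<forall>i. i < x * L \<or> (x + 1) * L \<le> i \<longrightarrow> w i = w0 i)"

lemma slot_inv_other: "slot_inv L x w0 g w \<Longrightarrow> y \<noteq> x \<Longrightarrow> d < L \<Longrightarrow> w (y * L + d) = w0 (y * L + d)"
  using slot_disjoint[of y x d L] by (auto simp: slot_inv_def)

lemma slot_inv_upd:
  assumes "slot_inv L x w0 g w" "f < L" "b \<le> 1"
  shows "slot_inv L x w0 (g(f := of_nat b)) (w(x * L + f := b))"
  using assms by (auto simp: slot_inv_def)

lemma slot_inv_cong: "slot_inv L x w0 g w \<Longrightarrow> (\<And>f. f < L \<Longrightarrow> g f = g' f) \<Longrightarrow> slot_inv L x w0 g' w"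
  by (auto simp: slot_inv_def)

definition bits :: "(nat \<Rightarrow> nat) \<Rightarrow> bool" where
  "bits w \<longleftrightarrow> (\<forall>i. w i \<le> 1)"

lemma slot_inv_start: "bits w \<Longrightarrow> slot_inv L x w (\<lambda>f. of_nat (w (x * L + f))) w"
  by (auto simp: slot_inv_def bits_def)

definition slot_upd :: "nat \<Rightarrow> nat \<Rightarrow> bit poly \<Rightarrow> (nat \<Rightarrow> nat) \<Rightarrow> (nat \<Rightarrow> nat) \<Rightarrow> bool" where
  "slot_upd L x p w w' \<longleftrightarrow> bits w' \<and> eqp L (slot L w' x) p \<and> (\<forall>y. y \<noteq> x \<longrightarrow> slot L w' y = slot L w y)"

lemma slot_inv_end:
  assumes "slot_inv L x w0 (\<lambda>f. coeff p f) w"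
  shows "slot_upd L x p w0 w"
  using assms slot_inv_other[OF assms]
  by (auto simp: slot_upd_def slot_inv_def bits_def eqp_def coeff_slot intro: slot_cong)

locale bounded_machine = machine +
  assumes I_less: "I < 2 ^ B"
begin

lemma less_B: "x \<le> I \<Longrightarrow> x < 2 ^ B"
  using I_less by simp

lemma bit_less_B: "x \<le> 1 \<Longrightarrow> (x :: nat) < 2 ^ B"
  by (rule less_B) (use I in simp)

lemma mod2_less_B [simp]: "(x :: nat) mod 2 < 2 ^ B"
  by (rule bit_less_B) simp

abbreviation (input) kfor :: "nat \<Rightarrow> nat \<Rightarrow> nat" where
  "kfor N k \<equiv> N * (k + 2) + 2"

lemma tr_Copy:
  assumes s: "s vL 0 = L" "s sx 0 = x" "s sy 0 = y" "bits (s vW)" and xy: "x \<noteq> y"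
    and I': "(x + 1) * L \<le> I" "L \<le> I"
  shows "tr Copy s (kfor L 1) (\<lambda>s'. same {vW, vd} s s' \<and> slot_upd L x (slot L (s vW) y) (s vW) (s' vW))"
proof -
  \<comment> \<open>The first \<open>d\<close> coefficients are already those of slot
    \<open>y\<close>.\<close>
  define g where "g d f = (of_nat (s vW ((if f < d then y else x) * L + f)) :: bit)" for d f
  define J where "J d s' \<longleftrightarrow> same {vW, vd} s s' \<and> slot_inv L x (s vW) (g d) (s' vW)" for d and s' :: store
  show ?thesis
    unfolding Copy_def
  proof (rule tr_for[where J = J])
    have "g 0 = (\<lambda>f. of_nat (s vW (x * L + f)))" by (auto simp: g_def)
    then show "J 0 (upd s vd 0 0)" using slot_inv_start[OF s(4)] by (simp add: J_def)
    show "L < 2 ^ B" by (rule less_B) fact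
    show "val s' (Var vL) = L" if "J d s'" for d s'
      using sameD[of "{vW, vd}" s s'] that s by (simp add: J_def)
  next
    fix d s' assume d: "d < L" and J: "J d s'" and vd: "s' vd 0 = d"
    have v: "s' vL 0 = L" "s' sx 0 = x" "s' sy 0 = y"
      using sameD[of "{vW, vd}" s s'] J s by (simp_all add: J_def)
    have b: "s' vW (y * L + d) = s vW (y * L + d)"
      using slot_inv_other[of L x "s vW" _ "s' vW" y d] J d xy by (auto simp: J_def)
    have b1: "s vW (y * L + d) \<le> 1" using s(4) by (simp add: bits_def)
    have "slot_inv L x (s vW) ((g d)(d := of_nat (s vW (y * L + d)))) ((s' vW)(x * L + d := s vW (y * L + d)))"
      using J d b1 by (intro slot_inv_upd) (auto simp: J_def)
    moreover have "(g d)(d := of_nat (s vW (y * L + d))) = g (Suc d)" by (auto simp: g_def fun_eq_iff less_Suc_eq)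
    ultimately have *: "slot_inv L x (s vW) (g (Suc d)) ((s' vW)(x * L + d := s vW (y * L + d)))" by simp
    show "tr (Assign vW (Add (Mul (Var sx) (Var vL)) (Var vd)) (Cell vW (Add (Mul (Var sy) (Var vL)) (Var vd)))) s' 1
        (\<lambda>s'. s' vd 0 = d \<and> J (Suc d) (upd s' vd 0 (Suc d)))"
      using v vd b b1 d I' J * by (intro tr_assign) (auto simp: J_def intro: slot_index bit_less_B)
  next
    fix s' assume "J L s'"
    then have "same {vW, vd} s s'" and *: "slot_inv L x (s vW) (g L) (s' vW)" by (auto simp: J_def)
    moreover have "slot_upd L x (slot L (s vW) y) (s vW) (s' vW)"
      by (rule slot_inv_end[OF slot_inv_cong[OF *]]) (simp add: g_def coeff_slot)
    ultimately show "same {vW, vd} s s' \<and> slot_upd L x (slot L (s vW) y) (s vW) (s' vW)" by simp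
  qed
qed

lemma tr_MulAdd:
  assumes s: "s vL 0 = L" "s sx 0 = x" "s sy 0 = y" "s sz 0 = z" "bits (s vW)" and xyz: "x \<noteq> y" "x \<noteq> z"
    and I': "(x + 1) * L \<le> I" "L \<le> I"
  shows "tr MulAdd s (kfor L (kfor L 1)) (\<lambda>s'. same {vW, vd, ve} s s' \<and>
    slot_upd L x (slot L (s vW) x + slot L (s vW) y * slot L (s vW) z) (s vW) (s' vW))"
proof -
  \<comment> \<open>\<open>g d\<close> contains the contributions of the first \<open>d\<close>
    coefficients of \<open>y\<close>; \<open>h d e\<close> adds the first \<open>e\<close> products
    with coefficient \<open>d\<close> itself.\<close>
  define g where "g d f = (of_nat (s vW (x * L + f)) +
    (\<Sum>d'<d. if d' \<le> f then of_nat (s vW (y * L + d')) * of_nat (s vW (z * L + (f - d'))) else 0) :: bit)" for d f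
  define h where "h d e f = (g d f + (if d \<le> f \<and> f < d + e
    then of_nat (s vW (y * L + d)) * of_nat (s vW (z * L + (f - d))) else 0))" for d e f
  define J where "J d s' \<longleftrightarrow> same {vW, vd, ve} s s' \<and> slot_inv L x (s vW) (g d) (s' vW)" for d and s' :: store
  define J' where "J' d e s' \<longleftrightarrow> same {vW, vd, ve} s s' \<and> s' vd 0 = d \<and> slot_inv L x (s vW) (h d e) (s' vW)"
    for d e and s' :: store
  show ?thesis
    unfolding MulAdd_def
  proof (rule tr_for[where J = J])
    have "g 0 = (\<lambda>f. of_nat (s vW (x * L + f)))" by (auto simp: g_def)
    then show "J 0 (upd s vd 0 0)" using slot_inv_start[OF s(5)] by (simp add: J_def)
    show "L < 2 ^ B" by (rule less_B) fact
    show "val s' (Var vL) = L" if "J d s'" for d s'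
      using sameD[of "{vW, vd, ve}" s s'] that s by (simp add: J_def)
  next
    fix d s1 assume d: "d < L" and J: "J d s1" and vd: "s1 vd 0 = d"
    let ?A = "Assign vW (Add (Mul (Var sx) (Var vL)) (Add (Var vd) (Var ve)))
       (Mod2 (Add (Cell vW (Add (Mul (Var sx) (Var vL)) (Add (Var vd) (Var ve))))
          (Mul (Cell vW (Add (Mul (Var sy) (Var vL)) (Var vd)))
               (Cell vW (Add (Mul (Var sz) (Var vL)) (Var ve))))))"
    have "tr (For ve (Sub (Var vL) (Var vd)) ?A) s1 (kfor (L - d) 1)
        (\<lambda>s'. s' vd 0 = d \<and> J (Suc d) (upd s' vd 0 (Suc d)))"
    proof (rule tr_for[where J = "J' d"])
      have "h d 0 = g d" by (rule ext) (auto simp: h_def)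
      then show "J' d 0 (upd s1 ve 0 0)" using J vd by (simp add: J_def J'_def)
      show "L - d < 2 ^ B" using less_B[OF I'(2)] by simp
      show "val s' (Sub (Var vL) (Var vd)) = L - d" if "J' d e s'" for e s'
        using that s sameD[of "{vW, vd, ve}" s s'] by (simp add: J'_def)
    next
      fix e s' assume e: "e < L - d" and J: "J' d e s'" and ve: "s' ve 0 = e"
      have v: "s' vL 0 = L" "s' sx 0 = x" "s' sy 0 = y" "s' sz 0 = z" "s' vd 0 = d"
        using sameD[of "{vW, vd, ve}" s s'] J s by (simp_all add: J'_def)
      have inv: "slot_inv L x (s vW) (h d e) (s' vW)" using J by (simp add: J'_def)
      have yb: "s' vW (y * L + d) = s vW (y * L + d)"
        using slot_inv_other[OF inv, of y d] d xyz by auto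
      have zb: "s' vW (z * L + e) = s vW (z * L + e)"
        using slot_inv_other[OF inv, of z e] e xyz by auto
      define b where "b = (s' vW (x * L + (d + e)) + s vW (y * L + d) * s vW (z * L + e)) mod 2"
      have b1: "b \<le> 1" by (simp add: b_def)
      have "slot_inv L x (s vW) ((h d e)(d + e := of_nat b)) ((s' vW)(x * L + (d + e) := b))"
        using inv e b1 by (intro slot_inv_upd) auto
      moreover have "(h d e)(d + e := of_nat b) = h d (Suc e)"
      proof
        fix f
        have "of_nat (s' vW (x * L + (d + e))) = h d e (d + e)" using inv e by (auto simp: slot_inv_def)
        then have "of_nat b = h d e (d + e) + of_nat (s vW (y * L + d)) * of_nat (s vW (z * L + e))"
          unfolding b_def of_nat_mod_2_bit of_nat_add of_nat_mult by simp
        then show "((h d e)(d + e := of_nat b)) f = h d (Suc e) f"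
          by (auto simp: h_def)
      qed
      ultimately have *: "slot_inv L x (s vW) (h d (Suc e)) ((s' vW)(x * L + (d + e) := b))" by simp
      have ix: "x * L + (d + e) < I" using e by (intro slot_index[OF _ I'(1)]) simp
      show "tr ?A s' 1 (\<lambda>s'. s' ve 0 = e \<and> J' d (Suc e) (upd s' ve 0 (Suc e)))"
      proof (rule tr_assign, goal_cases)
        case 3
        have "s'' ve 0 = e \<and> J' d (Suc e) (upd s'' ve 0 (Suc e))"
          if "s'' = upd s' vW (val s' (Add (Mul (Var sx) (Var vL)) (Add (Var vd) (Var ve))))
            (val s' (Mod2 (Add (Cell vW (Add (Mul (Var sx) (Var vL)) (Add (Var vd) (Var ve))))
          (Mul (Cell vW (Add (Mul (Var sy) (Var vL)) (Var vd)))
               (Cell vW (Add (Mul (Var sz) (Var vL)) (Var ve)))))))" for s''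
          unfolding that using v ve yb zb J * by (simp add: J'_def b_def)
        then show ?case by blast
      qed (use v ve ix in simp_all)
    next
      fix s' assume J': "J' d (L - d) s'"
      then have inv: "slot_inv L x (s vW) (h d (L - d)) (s' vW)" by (simp add: J'_def)
      have "slot_inv L x (s vW) (g (Suc d)) (s' vW)"
        by (rule slot_inv_cong[OF inv]) (use d in \<open>auto simp: h_def g_def\<close>)
      then show "s' vd 0 = d \<and> J (Suc d) (upd s' vd 0 (Suc d))" using J' by (simp add: J_def J'_def)
    qed
    then show "tr (For ve (Sub (Var vL) (Var vd)) ?A) s1 (kfor L 1)
        (\<lambda>s'. s' vd 0 = d \<and> J (Suc d) (upd s' vd 0 (Suc d)))"
      by (rule tr_conseq) auto
  next
    fix s' assume J: "J L s'"
    then have inv: "slot_inv L x (s vW) (g L) (s' vW)" by (simp add: J_def)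
    have "g L f = coeff (slot L (s vW) x + slot L (s vW) y * slot L (s vW) z) f" if f: "f < L" for f
    proof -
      have "(\<Sum>d'<L. if d' \<le> f then of_nat (s vW (y * L + d')) * of_nat (s vW (z * L + (f - d'))) else 0 :: bit)
        = (\<Sum>d'\<le>f. of_nat (s vW (y * L + d')) * of_nat (s vW (z * L + (f - d'))))"
        using f by (intro sum.mono_neutral_cong_right) auto
      also have "\<dots> = coeff (slot L (s vW) y * slot L (s vW) z) f"
        unfolding coeff_mult using f by (intro sum.cong) (auto simp: coeff_slot)
      finally show ?thesis using f by (simp add: g_def coeff_slot)
    qed
    from slot_inv_end[OF slot_inv_cong[OF inv this]]
    show "same {vW, vd, ve} s s' \<and>
        slot_upd L x (slot L (s vW) x + slot L (s vW) y * slot L (s vW) z) (s vW) (s' vW)"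
      using J by (simp add: J_def)
  qed
qed

end

section \<open>The program for the sum of determinants\<close>

definition ModE :: "aexp \<Rightarrow> aexp \<Rightarrow> aexp" where
  "ModE e f = Sub e (Mul f (Div e f))"

lemma val_ModE [simp]: "val s (ModE e f) = val s e mod val s f"
  by (simp add: ModE_def minus_mult_div_eq_mod)

definition CopyTo :: "aexp \<Rightarrow> aexp \<Rightarrow> com" where
  "CopyTo x y = Seq (Set sx x) (Seq (Set sy y) Copy)"

definition MulAddTo :: "aexp \<Rightarrow> aexp \<Rightarrow> aexp \<Rightarrow> com" where
  "MulAddTo x y z = Seq (Set sx x) (Seq (Set sy y) (Seq (Set sz z) MulAdd))"

abbreviation Entry :: "aexp \<Rightarrow> aexp \<Rightarrow> aexp" where
  "Entry i j \<equiv> Add (Mul i (Var vN)) j"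

text \<open>Six slots behind the matrix: 0 the multiplier of a row operation, 1 the running product,
  2 scratch space, 3 the sum of the determinants, 4 the constant zero, 5 the constant one.\<close>

abbreviation Extra :: "nat \<Rightarrow> aexp" where
  "Extra m \<equiv> Add (Mul (Var vN) (Var vN)) (Num m)"

text \<open>Writes one coefficient of an entry of \<open>I + w^D A\<close>: below degree
  \<open>D\<close> only the identity contributes, the next \<open>k\<close> degrees hold the random
  bits if the arc is present and uncut, and the rest is 0.\<close>

definition FillEntry :: com where
  "FillEntry = Cond (Sub (Var vD) (Var vd))
       (Assign vW (Var vf) (Mul (EqE (Var vi) (Var vj)) (EqE (Var vd) (Num 0))))
       (Cond (Sub (Add (Var vD) (Var vk)) (Var vd))
         (Assign vW (Var vf)
           (Mul (Mul (Cell adj (Add (Mul (Cell vra (Var vi)) (Var vn)) (Cell vca (Var vj))))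
                     (EqE (BitE (Cell vra (Var vi))) (BitE (Cell vca (Var vj)))))
                (Cell rnd (Add (Mul (Entry (Var vi) (Var vj)) (Var vk)) (Sub (Var vd) (Var vD))))))
         (Assign vW (Var vf) (Num 0)))"

definition Fill :: com where
  "Fill = For vf (Mul (Mul (Var vN) (Var vN)) (Var vL))
     (Seq (Set vi (Div (Div (Var vf) (Var vL)) (Var vN)))
     (Seq (Set vj (ModE (Div (Var vf) (Var vL)) (Var vN)))
     (Seq (Set vd (ModE (Var vf) (Var vL)))
       FillEntry)))"

text \<open>The row operation is repeated \<open>N\<close> times. The entry starts divisible by
  \<open>w ^ D\<close> and gains such a factor in each round, so it ends divisible by
  \<open>w ^ ((N + 1) * D)\<close>, that is by \<open>w ^ L\<close>. Its value is saved first
  because the operation overwrites it when it comes to its own column.\<close>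

definition Eliminate :: com where
  "Eliminate = For vkk (Var vN) (For vi (Var vN) (Cond (Sub (Var vi) (Var vkk))
     (For vrep (Var vN) (Seq (CopyTo (Extra 0) (Entry (Var vi) (Var vkk)))
        (For vj (Var vN) (MulAddTo (Entry (Var vi) (Var vj)) (Extra 0) (Entry (Var vkk) (Var vj))))))
     Skip))"

text \<open>\<open>MulAdd\<close> only accumulates and cannot work in place, so each product is
  formed in the scratch slot, cleared beforehand, and copied back.\<close>

definition Product :: com where
  "Product = Seq (CopyTo (Extra 1) (Extra 5)) (For vi (Var vN)
     (Seq (CopyTo (Extra 2) (Extra 4)) (Seq (MulAddTo (Extra 2) (Extra 1) (Entry (Var vi) (Var vi)))
        (CopyTo (Extra 1) (Extra 2)))))"

text \<open>
  The binary digits of \<open>vX\<close> encode a set of vertices; vertex \<open>n - 1\<close> is never in it.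
\<close>

definition SumDets :: com where
  "SumDets = For vX (Cell pw (Sub (Var vn) (Num 1)))
     (Seq Fill (Seq Eliminate (Seq Product (MulAddTo (Extra 3) (Extra 1) (Extra 5)))))"

text \<open>The first assignment makes slot 5 the constant one. In the final scan,
  \<open>d + 1 - N * D\<close> is nonzero exactly when \<open>N * D \<le> d\<close>; the 1 makes the
  truncated comparison non-strict.\<close>

definition Decide :: com where
  "Decide = Seq (Assign vW (Mul (Extra 5) (Var vL)) (Num 1)) (Seq SumDets
     (For vd (Var vL) (Cond (Mul (Sub (Add (Var vd) (Num 1)) (Mul (Var vN) (Var vD)))
          (Cell vW (Add (Mul (Extra 3) (Var vL)) (Var vd))))
        (Set ans (Num 1)) Skip)))"

definition mset_of :: "nat \<Rightarrow> nat set" where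
  "mset_of X = {x. odd (X div 2 ^ x)}"

text \<open>Injectivity and equal cardinalities give surjectivity.\<close>

lemma bij_mset_of: "bij_betw mset_of {..<2 ^ m} (Pow {..<m})"
proof -
  have eq: "mset_of X = {x. bit X x}" for X by (auto simp: mset_of_def bit_iff_odd)
  have inj: "inj_on mset_of {..<2 ^ m}"
    by (auto simp: inj_on_def eq bit_eq_iff set_eq_iff)
  have "x < m" if "X < 2 ^ m" "bit X x" for X x :: nat
  proof (rule ccontr)
    assume "\<not> x < m"
    then have "(2::nat) ^ m \<le> 2 ^ x" by simp
    then have "X < 2 ^ x" using that(1) by linarith
    then have "X div 2 ^ x = 0" by simp
    then show False using that(2) by (simp add: bit_iff_odd)
  qed
  then have "mset_of ` {..<2 ^ m} \<subseteq> Pow {..<m}" by (auto simp: eq)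
  moreover have "card (mset_of ` {..<2 ^ m}) = card (Pow {..<m})"
    using inj by (simp add: card_image card_Pow)
  ultimately have "mset_of ` {..<2 ^ m} = Pow {..<m}" by (intro card_subset_eq) auto
  then show ?thesis using inj by (simp add: bij_betw_def)
qed

context bounded_machine begin

lemma tr_set:
  assumes "val s e < 2 ^ B" "tr q (upd s a 0 (val s e)) k Q"
  shows "tr (Seq (Set a e) q) s (1 + k) Q"
  using assms I by (intro tr_seq tr_assign) auto

lemma tr_call:
  assumes "tr p s k P" "\<And>s'. P s' \<Longrightarrow> tr q s' l Q"
  shows "tr (Seq p q) s (k + l) Q"
  by (rule tr_seq, rule tr_conseq[OF assms(1) order.refl]) (rule assms(2))

text \<open>The second argument is evaluated after \<open>sx\<close> has been overwritten, so the
  values must be the same in all stores that differ only in the parameter cells.\<close>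

lemma tr_CopyTo:
  assumes e: "\<And>s'. same {sx, sy} s s' \<Longrightarrow> val s' ex = x \<and> val s' ey = y"
    and s: "s vL 0 = L" "bits (s vW)" and xy: "x \<noteq> y" "x < S" "y < S" "S * L \<le> I" "1 \<le> L"
  shows "tr (CopyTo ex ey) s (1 + (1 + kfor L 1)) (\<lambda>s'. same {vW, vd, sx, sy} s s' \<and>
    slot_upd L x (slot L (s vW) y) (s vW) (s' vW))"
proof -
  have "S \<le> S * L" using xy by simp
  then have le: "x \<le> I" "y \<le> I" using xy by linarith+
  have xL: "(x + 1) * L \<le> I" using mult_le_mono1[of "x + 1" S L] xy by simp
  have L: "L \<le> I" using mult_le_mono1[of 1 "x + 1" L] xL by simp
  have vals: "val s ex = x" "val (upd s sx 0 x) ey = y" using e by auto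
  let ?s = "upd (upd s sx 0 x) sy 0 y"
  have "tr Copy ?s (kfor L 1) (\<lambda>s'. same {vW, vd} ?s s' \<and>
      slot_upd L x (slot L (?s vW) y) (?s vW) (s' vW))"
    by (rule tr_Copy) (use s xy xL L in auto)
  then have "tr Copy ?s (kfor L 1) (\<lambda>s'. same {vW, vd, sx, sy} s s' \<and>
      slot_upd L x (slot L (s vW) y) (s vW) (s' vW))"
  proof (rule tr_conseq)
    fix s' assume *: "same {vW, vd} ?s s' \<and> slot_upd L x (slot L (?s vW) y) (?s vW) (s' vW)"
    have "same {vW, vd, sx, sy} s s'"
      by (rule same_trans[where A = "{sx, sy}" and s' = ?s and A' = "{vW, vd}"]) (use * in auto)
    then show "same {vW, vd, sx, sy} s s' \<and> slot_upd L x (slot L (s vW) y) (s vW) (s' vW)"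
      using * by simp
  qed simp
  then show ?thesis unfolding CopyTo_def using vals le less_B by (intro tr_set) auto
qed

lemma tr_MulAddTo:
  assumes e: "\<And>s'. same {sx, sy, sz} s s' \<Longrightarrow> val s' ex = x \<and> val s' ey = y \<and> val s' ez = z"
    and s: "s vL 0 = L" "bits (s vW)" and xyz: "x \<noteq> y" "x \<noteq> z" "x < S" "y < S" "z < S" "S * L \<le> I" "1 \<le> L"
  shows "tr (MulAddTo ex ey ez) s (1 + (1 + (1 + kfor L (kfor L 1)))) (\<lambda>s'. same {vW, vd, ve, sx, sy, sz} s s' \<and>
    slot_upd L x (slot L (s vW) x + slot L (s vW) y * slot L (s vW) z) (s vW) (s' vW))"
proof -
  have "S \<le> S * L" using xyz by simp
  then have le: "x \<le> I" "y \<le> I" "z \<le> I" using xyz by linarith+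
  have xL: "(x + 1) * L \<le> I" using mult_le_mono1[of "x + 1" S L] xyz by simp
  have L: "L \<le> I" using mult_le_mono1[of 1 "x + 1" L] xL by simp
  have vals: "val s ex = x" "val (upd s sx 0 x) ey = y" "val (upd (upd s sx 0 x) sy 0 y) ez = z"
    using e by auto
  let ?s = "upd (upd (upd s sx 0 x) sy 0 y) sz 0 z"
  let ?p = "slot L (s vW) x + slot L (s vW) y * slot L (s vW) z"
  have "tr MulAdd ?s (kfor L (kfor L 1)) (\<lambda>s'. same {vW, vd, ve} ?s s' \<and>
      slot_upd L x (slot L (?s vW) x + slot L (?s vW) y * slot L (?s vW) z) (?s vW) (s' vW))"
    by (rule tr_MulAdd) (use s xyz xL L in auto)
  then have "tr MulAdd ?s (kfor L (kfor L 1)) (\<lambda>s'. same {vW, vd, ve, sx, sy, sz} s s' \<and>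
      slot_upd L x ?p (s vW) (s' vW))"
  proof (rule tr_conseq)
    fix s' assume *: "same {vW, vd, ve} ?s s' \<and>
      slot_upd L x (slot L (?s vW) x + slot L (?s vW) y * slot L (?s vW) z) (?s vW) (s' vW)"
    have "same {vW, vd, ve, sx, sy, sz} s s'"
      by (rule same_trans[where A = "{sx, sy, sz}" and s' = ?s and A' = "{vW, vd, ve}"]) (use * in auto)
    then show "same {vW, vd, ve, sx, sy, sz} s s' \<and> slot_upd L x ?p (s vW) (s' vW)"
      using * by simp
  qed simp
  then show ?thesis unfolding MulAddTo_def using vals le less_B by (intro tr_set) auto
qed

end

section \<open>Correctness of the program for determinants\<close>

text \<open>\<open>D\<close> is the shift of \<open>coeff_perm_shift\<close> and exceeds the degree
  \<open>N * k\<close> of the permanent sought, so the degrees from \<open>N * D\<close> up to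
  \<open>L = (N + 1) * D\<close> show it completely. \<open>SL\<close> provides room for the matrix
  and six further slots.\<close>

locale det_machine = bounded_machine +
  fixes n N k D L :: nat and E :: "nat rel"
  assumes n: "1 \<le> n" and D: "D = N * k + 1" and L: "L = (N + 1) * D"
    and SL: "(N * N + 6) * L \<le> I" and NNk: "N * N * k \<le> I" and pw_less: "(2::nat) ^ n < 2 ^ B"
begin

definition env :: "store \<Rightarrow> bool" where
  "env s \<longleftrightarrow> s vn 0 = n \<and> (\<forall>u<n. \<forall>v<n. s adj (u * n + v) = of_bool ((u, v) \<in> E)) \<and>
     (\<forall>x\<le>n. s pw x = 2 ^ x) \<and> s vN 0 = N \<and> s vk 0 = k \<and> s vD 0 = D \<and> s vL 0 = L \<and>
     (\<forall>r<N. s vra r < n \<and> s vca r < n) \<and> (\<forall>i. s rnd i \<le> 1)"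

definition frame :: "nat set" where
  "frame = {ans, vX, vf, vW, vi, vj, vd, ve, vrep, vkk, sx, sy, sz}"

lemma env_same: "env s \<Longrightarrow> same A s s' \<Longrightarrow> A \<subseteq> frame \<Longrightarrow> env s'"
proof -
  assume env: "env s" and "same A s s'" "A \<subseteq> frame"
  then have "s' x = s x" if "x \<notin> frame" for x using that by (auto simp: same_def)
  then have "s' vn = s vn" "s' adj = s adj" "s' pw = s pw" "s' vN = s vN" "s' vk = s vk" "s' vD = s vD"
    "s' vL = s vL" "s' vra = s vra" "s' vca = s vca" "s' rnd = s rnd"
    by (simp_all add: frame_def)
  then show "env s'" using env by (simp add: env_def)
qed

lemma D1: "1 \<le> D" and L1: "1 \<le> L" and NL: "N \<le> I" "L \<le> I" "N * N * L \<le> I"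
proof -
  show "1 \<le> D" using D by simp
  then show L1: "1 \<le> L" using L by simp
  show "L \<le> I" "N * N * L \<le> I" using SL by (simp_all add: distrib_right)
  have "N \<le> L" using L mult_le_mono2[OF \<open>1 \<le> D\<close>, of "N + 1"] by simp
  then show "N \<le> I" using \<open>L \<le> I\<close> by simp
qed

definition rpoly :: "(nat \<Rightarrow> nat) \<Rightarrow> nat \<Rightarrow> nat \<Rightarrow> bit poly" where
  "rpoly R i j = bits_poly k (\<lambda>d. odd (R ((i * N + j) * k + d)))"

definition slot_mat :: "store \<Rightarrow> nat \<Rightarrow> nat \<Rightarrow> nat \<Rightarrow> bit poly" where
  "slot_mat s X i j = of_bool ((s vra i, s vca j) \<in> E \<and> (s vra i \<in> mset_of X \<longleftrightarrow> s vca j \<in> mset_of X)) *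
     rpoly (s rnd) i j"

definition start_mat :: "store \<Rightarrow> nat \<Rightarrow> nat \<Rightarrow> nat \<Rightarrow> bit poly" where
  "start_mat s X i j = of_bool (i = j) + monom 1 D * slot_mat s X i j"

lemma mod2_eq: "(a mod 2 = b mod 2) = (odd a = odd (b::nat))"
  by presburger

lemma coeff_start_mat:
  "coeff (start_mat s X i j) d = (if d < D then of_bool (i = j \<and> d = 0)
     else if d < D + k then of_bool ((s vra i, s vca j) \<in> E \<and> (s vra i \<in> mset_of X \<longleftrightarrow> s vca j \<in> mset_of X) \<and>
       odd (s rnd ((i * N + j) * k + (d - D)))) else 0)"
  using D1 by (auto simp: start_mat_def slot_mat_def rpoly_def coeff_monom_mult coeff_bits_poly)

lemma tr_Fill:
  assumes env: "env s" and b: "bits (s vW)"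
  shows "tr Fill s (kfor (N * N * L) 6) (\<lambda>s'. same {vW, vf, vi, vj, vd} s s' \<and> bits (s' vW) \<and>
    (\<forall>i<N. \<forall>j<N. eqp L (slot L (s' vW) (i * N + j)) (start_mat s (s vX 0) i j)) \<and>
    (\<forall>y\<ge>N * N. slot L (s' vW) y = slot L (s vW) y))"
proof -
  \<comment> \<open>The intended content of cell \<open>m\<close>, whose digits are row, column and
    degree.\<close>
  define F where "F m = (let i = m div L div N; j = m div L mod N; d = m mod L in
    if d < D then of_bool (i = j \<and> d = 0) else if d < D + k then
      of_bool ((s vra i, s vca j) \<in> E \<and> (s vra i \<in> mset_of (s vX 0) \<longleftrightarrow> s vca j \<in> mset_of (s vX 0))) *
        s rnd ((i * N + j) * k + (d - D)) else 0)" for m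
  define J where "J m s' \<longleftrightarrow> same {vW, vf, vi, vj, vd} s s' \<and> bits (s' vW) \<and>
    (\<forall>m'. s' vW m' = (if m' < m then F m' else s vW m'))" for m and s' :: store
  note env' = env[unfolded env_def]
  show ?thesis
    unfolding Fill_def
  proof (rule tr_for[where J = J])
    show "J 0 (upd s vf 0 0)" using b by (simp add: J_def)
    show "N * N * L < 2 ^ B" using NL by (intro less_B)
    show "val s' (Mul (Mul (Var vN) (Var vN)) (Var vL)) = N * N * L" if "J m s'" for m s'
      using that env' sameD[of "{vW, vf, vi, vj, vd}" s s'] by (simp add: J_def)
  next
    fix m s' assume m: "m < N * N * L" and J: "J m s'" and vf: "s' vf 0 = m"
    have fr: "s' x = s x" if "x \<notin> {vW, vf, vi, vj, vd}" for x using J that by (auto simp: J_def same_def)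
    define i j d where "i = m div L div N" and "j = m div L mod N" and "d = m mod L"
    have "m div L < N * N" using m by (simp add: less_mult_imp_div_less)
    moreover have "0 < N" using m by (auto intro: gr0I)
    ultimately have ij: "i < N" "j < N" using L1 by (simp_all add: i_def j_def less_mult_imp_div_less)
    have d: "d < L" using L1 by (simp add: d_def)
    have mI: "m < I" using m NL by simp
    have B': "i < 2 ^ B" "j < 2 ^ B" "d < 2 ^ B" using ij d NL by (auto intro!: less_B)
    have rac: "s vra i < n" "s vca j < n" using env' ij by auto
    define s3 where "s3 = upd (upd (upd s' vi 0 i) vj 0 j) vd 0 d"
    have F1: "F m \<le> 1" using env' by (auto simp: F_def Let_def)
    have fin: "s'' vf 0 = m \<and> J (Suc m) (upd s'' vf 0 (Suc m))" if "s'' = upd s3 vW m (F m)" for s''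
    proof -
      have "s' vW x \<le> 1" for x using J unfolding J_def bits_def by blast
      then have "bits ((s' vW)(m := F m))" using F1 by (simp add: bits_def)
      then show ?thesis unfolding that using J vf by (auto simp: J_def s3_def less_Suc_eq)
    qed
    have v: "s3 vN 0 = N" "s3 vL 0 = L" "s3 vf 0 = m" "s3 vi 0 = i" "s3 vj 0 = j" "s3 vd 0 = d"
      "s3 vD 0 = D" "s3 vk 0 = k" "s3 vn 0 = n" "s3 vra = s vra" "s3 vca = s vca" "s3 adj = s adj"
      "s3 rnd = s rnd" "s3 pw = s pw" "s3 vX = s vX"
      using vf env' by (auto simp: s3_def fr)
    have f1: "tr (Assign vW (Var vf) (Mul (EqE (Var vi) (Var vj)) (EqE (Var vd) (Num 0)))) s3 1
        (\<lambda>s''. s'' vf 0 = m \<and> J (Suc m) (upd s'' vf 0 (Suc m)))" if "d < D"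
    proof -
      have "val s3 (Mul (EqE (Var vi) (Var vj)) (EqE (Var vd) (Num 0))) = F m"
        using that v by (simp add: F_def i_def j_def d_def)
      then show ?thesis using v mI fin F1 by (intro tr_assign) (auto intro: bit_less_B)
    qed
    have f2: "tr (Assign vW (Var vf)
             (Mul (Mul (Cell adj (Add (Mul (Cell vra (Var vi)) (Var vn)) (Cell vca (Var vj))))
                       (EqE (BitE (Cell vra (Var vi))) (BitE (Cell vca (Var vj)))))
                  (Cell rnd (Add (Mul (Entry (Var vi) (Var vj)) (Var vk)) (Sub (Var vd) (Var vD)))))) s3 1
        (\<lambda>s''. s'' vf 0 = m \<and> J (Suc m) (upd s'' vf 0 (Suc m)))" (is "tr (Assign _ _ ?e) _ _ _")
      if "\<not> d < D" "d < D + k"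
    proof -
      have "s adj (s vra i * n + s vca j) = of_bool ((s vra i, s vca j) \<in> E)"
        "s pw (s vra i) = 2 ^ s vra i" "s pw (s vca j) = 2 ^ s vca j" using env' rac by auto
      then have "val s3 ?e = F m"
        using that v by (simp add: F_def Let_def i_def[symmetric] j_def[symmetric] d_def[symmetric] mset_of_def mod2_eq)
      then show ?thesis using v mI fin F1 by (intro tr_assign) (auto intro: bit_less_B)
    qed
    have f3: "tr (Assign vW (Var vf) (Num 0)) s3 1
        (\<lambda>s''. s'' vf 0 = m \<and> J (Suc m) (upd s'' vf 0 (Suc m)))" if "\<not> d < D" "\<not> d < D + k"
    proof -
      have "val s3 (Num 0) = F m"
        using that v by (simp add: F_def Let_def d_def[symmetric])
      then show ?thesis using v mI fin F1 by (intro tr_assign) (auto intro: bit_less_B)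
    qed
    have tail: "tr FillEntry s3 ((1 + 1) + 1)
        (\<lambda>s''. s'' vf 0 = m \<and> J (Suc m) (upd s'' vf 0 (Suc m)))"
      unfolding FillEntry_def
    proof (rule tr_cond, goal_cases)
      case 1
      then show ?case using v by (intro tr_conseq[OF f1]) auto
    next
      case 2
      then have "\<not> d < D" using v by simp
      then show ?case using v by (intro tr_cond f2 f3) auto
    qed
    have "tr (Seq (Set vi (Div (Div (Var vf) (Var vL)) (Var vN)))
     (Seq (Set vj (ModE (Div (Var vf) (Var vL)) (Var vN)))
     (Seq (Set vd (ModE (Var vf) (Var vL)))
       FillEntry))) s' (1 + (1 + (1 + ((1 + 1) + 1))))
        (\<lambda>s''. s'' vf 0 = m \<and> J (Suc m) (upd s'' vf 0 (Suc m)))"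
      using B' tail vf env'
      by (intro tr_set) (simp_all add: fr i_def[symmetric] j_def[symmetric] d_def[symmetric] s3_def)
    then show "tr (Seq (Set vi (Div (Div (Var vf) (Var vL)) (Var vN)))
     (Seq (Set vj (ModE (Div (Var vf) (Var vL)) (Var vN)))
     (Seq (Set vd (ModE (Var vf) (Var vL)))
       FillEntry))) s' 6
        (\<lambda>s''. s'' vf 0 = m \<and> J (Suc m) (upd s'' vf 0 (Suc m)))"
      by (rule tr_conseq) auto
  next
    fix s' assume J: "J (N * N * L) s'"
    have "eqp L (slot L (s' vW) (i * N + j)) (start_mat s (s vX 0) i j)" if ij: "i < N" "j < N" for i j
      unfolding eqp_def
    proof (intro allI impI)
      fix d assume d: "d < L"
      have "i * N + j < N * N" using slot_index[OF ij(2), of i "N * N"] ij mult_le_mono1[of "i + 1" N N] by simp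
      then have "(i * N + j) * L + d < N * N * L" using d mult_le_mono1[of "Suc (i * N + j)" "N * N" L] by simp
      then have "s' vW ((i * N + j) * L + d) = F ((i * N + j) * L + d)" using J by (simp add: J_def)
      moreover have "((i * N + j) * L + d) div L = i * N + j" "((i * N + j) * L + d) mod L = d"
        using d by simp_all
      moreover have "(i * N + j) div N = i" "(i * N + j) mod N = j" using ij by simp_all
      moreover have "s rnd m \<le> 1" for m using env' by auto
      then have "s rnd m = of_bool (odd (s rnd m))" for m
        by (metis even_zero le_0_eq le_Suc_eq odd_one of_bool_eq One_nat_def)
      then have "of_nat (s rnd m) = (of_bool (odd (s rnd m)) :: bit)" for m
        by (metis of_nat_of_bool)
      ultimately show "coeff (slot L (s' vW) (i * N + j)) d = coeff (start_mat s (s vX 0) i j) d"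
        using d by (simp add: coeff_slot coeff_start_mat F_def)
    qed
    moreover have "slot L (s' vW) y = slot L (s vW) y" if "N * N \<le> y" for y
    proof (rule slot_cong)
      fix d
      have "N * N * L \<le> y * L + d" using mult_le_mono1[OF that, of L] by (rule trans_le_add1)
      then show "s' vW (y * L + d) = s vW (y * L + d)" using J by (simp add: J_def)
    qed
    ultimately show "same {vW, vf, vi, vj, vd} s s' \<and> bits (s' vW) \<and>
      (\<forall>i<N. \<forall>j<N. eqp L (slot L (s' vW) (i * N + j)) (start_mat s (s vX 0) i j)) \<and>
      (\<forall>y\<ge>N * N. slot L (s' vW) y = slot L (s vW) y)"
      using J by (simp add: J_def)
  qed
qed


definition mat_of :: "store \<Rightarrow> nat \<Rightarrow> nat \<Rightarrow> bit poly" where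
  "mat_of s i j = slot L (s vW) (i * N + j)"

lemma entry_less: "i < N \<Longrightarrow> j < N \<Longrightarrow> i * N + j < N * N"
  using slot_index[of j N i "N * N"] mult_le_mono1[of "i + 1" N N] by simp

lemma entry_eq_iff: "j < N \<Longrightarrow> j' < N \<Longrightarrow> i * N + j = i' * N + j' \<longleftrightarrow> i = i' \<and> j = j'"
  by (metis div_mult_self3 div_less add.right_neutral mod_mult_self3 mod_less not_less_zero)

lemma env_vals: "env s \<Longrightarrow> s vN 0 = N \<and> s vL 0 = L \<and> s vD 0 = D \<and> s vk 0 = k \<and> s vn 0 = n"
  by (simp add: env_def)

definition k_row :: nat where
  "k_row = (1 + (1 + kfor L 1)) + kfor N (1 + (1 + (1 + kfor L (kfor L 1))))"

abbreviation elim_vars :: "nat set" where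
  "elim_vars \<equiv> {vW, vd, ve, sx, sy, sz, vj}"

text \<open>One row operation in the sense of \<open>elim_step\<close>, exact up to multiples of
  \<open>w ^ L\<close>.\<close>

lemma tr_row_op:
  assumes env: "env s" and b: "bits (s vW)" and ik: "i < N" "k' < N" "i \<noteq> k'" and v: "s vi 0 = i" "s vkk 0 = k'"
  shows "tr (Seq (CopyTo (Extra 0) (Entry (Var vi) (Var vkk)))
      (For vj (Var vN) (MulAddTo (Entry (Var vi) (Var vj)) (Extra 0) (Entry (Var vkk) (Var vj))))) s k_row
    (\<lambda>s'. same elim_vars s s' \<and> bits (s' vW) \<and> (\<forall>y>N * N. slot L (s' vW) y = slot L (s vW) y) \<and>
      (\<forall>i'<N. \<forall>j<N. i' \<noteq> i \<longrightarrow> mat_of s' i' j = mat_of s i' j) \<and>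
      (\<forall>j<N. eqp L (mat_of s' i j) (mat_of s i j + mat_of s i k' * mat_of s k' j)))"
  unfolding k_row_def
proof (rule tr_call)
  show "tr (CopyTo (Extra 0) (Entry (Var vi) (Var vkk))) s (1 + (1 + kfor L 1)) (\<lambda>s'. same {vW, vd, sx, sy} s s' \<and>
    slot_upd L (N * N) (slot L (s vW) (i * N + k')) (s vW) (s' vW))"
  proof (rule tr_CopyTo)
    fix s' assume "same {sx, sy} s s'"
    then show "val s' (Extra 0) = N * N \<and> val s' (Entry (Var vi) (Var vkk)) = i * N + k'"
      using env_vals[OF env] v by (simp add: sameD[where A = "{sx, sy}" and s = s and s' = s'])
  next
    show "s vL 0 = L" using env_vals[OF env] by simp
    show "N * N < N * N + 6" "i * N + k' < N * N + 6" "N * N \<noteq> i * N + k'" using entry_less[OF ik(1,2)] by auto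
  qed (use b SL L1 in auto)
next
  fix s1 assume s1: "same {vW, vd, sx, sy} s s1 \<and> slot_upd L (N * N) (slot L (s vW) (i * N + k')) (s vW) (s1 vW)"
  define c where "c = slot L (s1 vW) (N * N)"
  have c: "eqp L c (mat_of s i k')" using s1 by (simp add: c_def slot_upd_def mat_of_def)
  have s1y: "slot L (s1 vW) y = slot L (s vW) y" if "y \<noteq> N * N" for y using s1 that by (auto simp: slot_upd_def)
  \<comment> \<open>Slots not yet reached still hold their contents from \<open>s1\<close>; in
    particular row \<open>k'\<close> is never touched, since \<open>i\<close> differs from
    \<open>k'\<close>.\<close>
  define J where "J j s' \<longleftrightarrow> same elim_vars s s' \<and> bits (s' vW) \<and>
    (\<forall>y. (\<forall>j'<j. y \<noteq> i * N + j') \<longrightarrow> slot L (s' vW) y = slot L (s1 vW) y) \<and>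
    (\<forall>j'<j. eqp L (mat_of s' i j') (mat_of s i j' + c * mat_of s k' j'))" for j and s' :: store
  show "tr (For vj (Var vN) (MulAddTo (Entry (Var vi) (Var vj)) (Extra 0) (Entry (Var vkk) (Var vj)))) s1
    (kfor N (1 + (1 + (1 + kfor L (kfor L 1)))))
    (\<lambda>s'. same elim_vars s s' \<and> bits (s' vW) \<and> (\<forall>y>N * N. slot L (s' vW) y = slot L (s vW) y) \<and>
      (\<forall>i'<N. \<forall>j<N. i' \<noteq> i \<longrightarrow> mat_of s' i' j = mat_of s i' j) \<and>
      (\<forall>j<N. eqp L (mat_of s' i j) (mat_of s i j + mat_of s i k' * mat_of s k' j)))"
  proof (rule tr_for[where J = J])
    have "same elim_vars s s1" using s1 by (auto intro: same_mono)
    then show "J 0 (upd s1 vj 0 0)" using s1 by (simp add: J_def slot_upd_def)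
    show "N < 2 ^ B" using NL by (intro less_B)
    show "val s' (Var vN) = N" if "J j s'" for j s'
      using that env_vals[OF env] by (simp add: J_def sameD[where A = elim_vars and s = s and s' = s'])
  next
    fix j s' assume j: "j < N" and J: "J j s'" and vj: "s' vj 0 = j"
    have sm: "same elim_vars s s'" and bs: "bits (s' vW)" using J by (auto simp: J_def)
    have old: "slot L (s' vW) y = slot L (s1 vW) y" if "\<And>j'. j' < j \<Longrightarrow> y \<noteq> i * N + j'" for y
      using J that by (auto simp: J_def)
    have e1: "slot L (s' vW) (i * N + j) = mat_of s i j"
      using old[of "i * N + j"] s1y[of "i * N + j"] entry_less[OF ik(1) j] by (auto simp: mat_of_def)
    have e2: "slot L (s' vW) (k' * N + j) = mat_of s k' j"
      using old[of "k' * N + j"] s1y[of "k' * N + j"] entry_less[OF ik(2) j] ik j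
      by (auto simp: mat_of_def entry_eq_iff)
    have e3: "slot L (s' vW) (N * N) = c"
    proof -
      have "N * N \<noteq> i * N + j'" if "j' < j" for j' using entry_less[OF ik(1), of j'] that j by auto
      then show ?thesis using old[of "N * N"] by (simp add: c_def)
    qed
    have "tr (MulAddTo (Entry (Var vi) (Var vj)) (Extra 0) (Entry (Var vkk) (Var vj))) s'
        (1 + (1 + (1 + kfor L (kfor L 1))))
        (\<lambda>s''. same {vW, vd, ve, sx, sy, sz} s' s'' \<and>
          slot_upd L (i * N + j) (slot L (s' vW) (i * N + j) + slot L (s' vW) (N * N) * slot L (s' vW) (k' * N + j)) (s' vW) (s'' vW))"
    proof (rule tr_MulAddTo)
      fix s'' assume "same {sx, sy, sz} s' s''"
      then show "val s'' (Entry (Var vi) (Var vj)) = i * N + j \<and> val s'' (Extra 0) = N * N \<and>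
          val s'' (Entry (Var vkk) (Var vj)) = k' * N + j"
        using env_vals[OF env] v vj sm
        by (simp add: sameD[where A = "{sx, sy, sz}" and s = s' and s' = s''] sameD[where A = elim_vars and s = s and s' = s'])
    next
      show "s' vL 0 = L" using env_vals[OF env] sm by (simp add: sameD[where A = elim_vars and s = s and s' = s'])
      show "i * N + j \<noteq> N * N" "i * N + j < N * N + 6" "N * N < N * N + 6" "k' * N + j < N * N + 6"
        "i * N + j \<noteq> k' * N + j"
        using entry_less[OF ik(1) j] entry_less[OF ik(2) j] ik j by (auto simp: entry_eq_iff)
    qed (use bs SL L1 in auto)
    then show "tr (MulAddTo (Entry (Var vi) (Var vj)) (Extra 0) (Entry (Var vkk) (Var vj))) s'
        (1 + (1 + (1 + kfor L (kfor L 1)))) (\<lambda>s''. s'' vj 0 = j \<and> J (Suc j) (upd s'' vj 0 (Suc j)))"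
    proof (rule tr_conseq, goal_cases)
      case (2 s'')
      then have sm2: "same {vW, vd, ve, sx, sy, sz} s' s''" and su: "slot_upd L (i * N + j) (mat_of s i j + c * mat_of s k' j) (s' vW) (s'' vW)"
        unfolding e1 e2 e3 by auto
      have "same elim_vars s s''" by (rule same_trans[OF sm sm2]) auto
      moreover have "s'' vj 0 = j" using sm2 vj by (simp add: sameD[where A = "{vW, vd, ve, sx, sy, sz}" and s = s' and s' = s''])
      moreover have "bits (s'' vW)" using su by (simp add: slot_upd_def)
      moreover have "slot L (s'' vW) y = slot L (s1 vW) y" if "\<forall>j'<Suc j. y \<noteq> i * N + j'" for y
        using su old[of y] that by (simp add: slot_upd_def)
      moreover have "eqp L (mat_of s'' i j') (mat_of s i j' + c * mat_of s k' j')" if "j' < Suc j" for j'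
      proof (cases "j' = j")
        case True
        then show ?thesis using su by (simp add: slot_upd_def mat_of_def)
      next
        case False
        then have "j' < j" "i * N + j' \<noteq> i * N + j" using that by auto
        then have "mat_of s'' i j' = mat_of s' i j'" using su by (simp add: slot_upd_def mat_of_def)
        then show ?thesis using J \<open>j' < j\<close> by (simp add: J_def)
      qed
      ultimately show ?case by (simp add: J_def mat_of_def)
    qed simp
  next
    fix s' assume J: "J N s'"
    have ne: "y \<noteq> i * N + j'" if "N * N \<le> y" "j' < N" for y j' using entry_less[OF ik(1) that(2)] that(1) by auto
    have "slot L (s' vW) y = slot L (s vW) y" if "N * N < y" for y
      using J that ne s1y by (simp add: J_def)
    moreover have "mat_of s' i' j = mat_of s i' j" if "i' < N" "j < N" "i' \<noteq> i" for i' j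
    proof -
      have "i' * N + j \<noteq> i * N + j'" if "j' < N" for j'
        using that \<open>j < N\<close> \<open>i' \<noteq> i\<close> by (simp add: entry_eq_iff)
      then have "slot L (s' vW) (i' * N + j) = slot L (s1 vW) (i' * N + j)" using J by (simp add: J_def)
      also have "\<dots> = slot L (s vW) (i' * N + j)" using s1y entry_less[OF that(1,2)] by simp
      finally show ?thesis by (simp add: mat_of_def)
    qed
    moreover have "eqp L (mat_of s' i j) (mat_of s i j + mat_of s i k' * mat_of s k' j)" if "j < N" for j
    proof -
      have "eqp L (mat_of s' i j) (mat_of s i j + c * mat_of s k' j)" using J that by (simp add: J_def)
      moreover have "eqp L (mat_of s i j + c * mat_of s k' j) (mat_of s i j + mat_of s i k' * mat_of s k' j)"
        using c by (intro eqp_add eqp_mult) auto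
      ultimately show ?thesis by (rule eqp_trans)
    qed
    ultimately show "same elim_vars s s' \<and> bits (s' vW) \<and> (\<forall>y>N * N. slot L (s' vW) y = slot L (s vW) y) \<and>
      (\<forall>i'<N. \<forall>j<N. i' \<noteq> i \<longrightarrow> mat_of s' i' j = mat_of s i' j) \<and>
      (\<forall>j<N. eqp L (mat_of s' i j) (mat_of s i j + mat_of s i k' * mat_of s k' j))"
      using J by (auto simp: J_def)
  qed
qed

definition k_elim :: nat where
  "k_elim = kfor N (kfor N (kfor N k_row + 1))"

lemma tr_Eliminate:
  assumes env: "env s" and b: "bits (s vW)"
    and A: "\<And>i j. i < N \<Longrightarrow> j < N \<Longrightarrow> eqp D (mat_of s i j) (of_bool (i = j))"
  shows "tr Eliminate s k_elim (\<lambda>s'. same (elim_vars \<union> {vi, vrep, vkk}) s s' \<and> bits (s' vW) \<and>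
    (\<forall>y>N * N. slot L (s' vW) y = slot L (s vW) y) \<and> elim_inv N D L (mat_of s) N 0 (mat_of s'))"
proof -
  let ?F = "elim_vars \<union> {vi, vrep, vkk}"
  define J0 where "J0 s' \<longleftrightarrow> same ?F s s' \<and> bits (s' vW) \<and> (\<forall>y>N * N. slot L (s' vW) y = slot L (s vW) y)"
    for s' :: store
  define J1 where "J1 k' s' \<longleftrightarrow> J0 s' \<and> elim_inv N D L (mat_of s) k' 0 (mat_of s')" for k' and s' :: store
  define J2 where "J2 k' i s' \<longleftrightarrow> J0 s' \<and> s' vkk 0 = k' \<and> elim_inv N D L (mat_of s) k' i (mat_of s')"
    for k' i and s' :: store
  \<comment> \<open>After \<open>t\<close> repetitions the entry to be cleared is divisible by
    \<open>w ^ ((t + 1) * D)\<close>, up to the truncation.\<close>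
  define J3 where "J3 k' i t s' \<longleftrightarrow> J2 k' i s' \<and> s' vi 0 = i \<and> eqp (min L ((t + 1) * D)) (mat_of s' i k') 0"
    for k' i t and s' :: store
  have upd: "J0 (s'(x := f)) = J0 s'" "mat_of (s'(x := f)) = mat_of s'" if "x \<in> {vi, vrep, vkk}" for s' x f
    using that by (auto simp: J0_def mat_of_def fun_eq_iff)
  have vN: "s' vN 0 = N" and env': "env s'" if "J0 s'" for s'
    using env_vals[OF env] that env_same[OF env, of ?F] by (auto simp: J0_def sameD[where A = ?F and s = s and s' = s'] frame_def)
  have NB: "N < 2 ^ B" using NL by (intro less_B)
  have DL: "D \<le> L" using L by simp
  show ?thesis
    unfolding Eliminate_def k_elim_def
  proof (rule tr_for[where J = J1])
    show "J1 0 (upd s vkk 0 0)" using b A by (simp add: J1_def upd) (auto simp: J0_def intro: elim_inv_start)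
    show "val s' (Var vN) = N" if "J1 k' s'" for k' s' using that vN by (simp add: J1_def)
  next
    fix k' s1 assume k': "k' < N" and J1: "J1 k' s1" and vkk: "s1 vkk 0 = k'"
    show "tr (For vi (Var vN) (Cond (Sub (Var vi) (Var vkk))
       (For vrep (Var vN) (Seq (CopyTo (Extra 0) (Entry (Var vi) (Var vkk)))
        (For vj (Var vN) (MulAddTo (Entry (Var vi) (Var vj)) (Extra 0) (Entry (Var vkk) (Var vj)))))) Skip)) s1
        (kfor N (kfor N k_row + 1)) (\<lambda>s'. s' vkk 0 = k' \<and> J1 (Suc k') (upd s' vkk 0 (Suc k')))"
    proof (rule tr_for[where J = "J2 k'"])
      show "J2 k' 0 (upd s1 vi 0 0)" using J1 vkk by (simp add: J1_def J2_def upd)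
      show "val s' (Var vN) = N" if "J2 k' i s'" for i s' using that vN by (simp add: J2_def)
    next
      fix i s2 assume i: "i < N" and J2: "J2 k' i s2" and vi: "s2 vi 0 = i"
      show "tr (Cond (Sub (Var vi) (Var vkk))
         (For vrep (Var vN) (Seq (CopyTo (Extra 0) (Entry (Var vi) (Var vkk)))
          (For vj (Var vN) (MulAddTo (Entry (Var vi) (Var vj)) (Extra 0) (Entry (Var vkk) (Var vj)))))) Skip) s2
          (kfor N k_row + 1) (\<lambda>s'. s' vi 0 = i \<and> J2 k' (Suc i) (upd s' vi 0 (Suc i)))"
      proof (rule tr_cond)
        assume "val s2 (Sub (Var vi) (Var vkk)) \<noteq> 0"
        then have ki: "k' < i" using vi J2 by (simp add: J2_def)
        show "tr (For vrep (Var vN) (Seq (CopyTo (Extra 0) (Entry (Var vi) (Var vkk)))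
          (For vj (Var vN) (MulAddTo (Entry (Var vi) (Var vj)) (Extra 0) (Entry (Var vkk) (Var vj)))))) s2
          (kfor N k_row) (\<lambda>s'. s' vi 0 = i \<and> J2 k' (Suc i) (upd s' vi 0 (Suc i)))"
        proof (rule tr_for[where J = "J3 k' i"])
          have "eqp D (mat_of s2 i k') (of_bool (i = k'))"
            using J2 i k' unfolding J2_def elim_inv_def by blast
          then have "eqp D (mat_of s2 i k') 0" using ki by simp
          then have "eqp (min L D) (mat_of s2 i k') 0" by (rule eqp_mono) simp
          then show "J3 k' i 0 (upd s2 vrep 0 0)" using J2 vi by (simp add: J3_def J2_def upd)
          show "val s' (Var vN) = N" if "J3 k' i t s'" for t s' using that vN by (simp add: J2_def J3_def)
        next
          fix t s3 assume t: "t < N" and J3: "J3 k' i t s3" and vrep: "s3 vrep 0 = t"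
          have J0: "J0 s3" using J3 by (simp add: J3_def J2_def)
          have v: "s3 vi 0 = i" "s3 vkk 0 = k'" using J3 by (auto simp: J3_def J2_def)
          have bs: "bits (s3 vW)" using J0 by (simp add: J0_def)
          from tr_row_op[OF env'[OF J0] bs i k' _ v] ki
          have "tr (Seq (CopyTo (Extra 0) (Entry (Var vi) (Var vkk)))
            (For vj (Var vN) (MulAddTo (Entry (Var vi) (Var vj)) (Extra 0) (Entry (Var vkk) (Var vj))))) s3 k_row
            (\<lambda>s'. same elim_vars s3 s' \<and> bits (s' vW) \<and> (\<forall>y>N * N. slot L (s' vW) y = slot L (s3 vW) y) \<and>
            (\<forall>i'<N. \<forall>j<N. i' \<noteq> i \<longrightarrow> mat_of s' i' j = mat_of s3 i' j) \<and>
            (\<forall>j<N. eqp L (mat_of s' i j) (mat_of s3 i j + mat_of s3 i k' * mat_of s3 k' j)))" by simp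
          then show "tr (Seq (CopyTo (Extra 0) (Entry (Var vi) (Var vkk)))
            (For vj (Var vN) (MulAddTo (Entry (Var vi) (Var vj)) (Extra 0) (Entry (Var vkk) (Var vj))))) s3 k_row
            (\<lambda>s'. s' vrep 0 = t \<and> J3 k' i (Suc t) (upd s' vrep 0 (Suc t)))"
          proof (rule tr_conseq, goal_cases)
            case (2 s')
            then have sm: "same elim_vars s3 s'" and bs': "bits (s' vW)"
              and sl: "\<And>y. N * N < y \<Longrightarrow> slot L (s' vW) y = slot L (s3 vW) y"
              and A1: "\<And>i' j. i' < N \<Longrightarrow> j < N \<Longrightarrow> i' \<noteq> i \<Longrightarrow> mat_of s' i' j = mat_of s3 i' j"
              and A2: "\<And>j. j < N \<Longrightarrow> eqp L (mat_of s' i j) (mat_of s3 i j + mat_of s3 i k' * mat_of s3 k' j)"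
              by auto
            have inv3: "elim_inv N D L (mat_of s) k' i (mat_of s3)" and m3: "eqp (min L ((t + 1) * D)) (mat_of s3 i k') 0"
              using J3 by (auto simp: J3_def J2_def)
            note st = elim_step[OF inv3 ki i DL A1 A2 m3]
            have same': "same ?F s s'"
              by (rule same_trans[OF _ sm, where A = ?F]) (use J0 in \<open>auto simp: J0_def\<close>)
            have J0': "J0 s'" using J0 same' bs' sl by (simp add: J0_def)
            have "eqp (min L ((Suc t + 1) * D)) (mat_of s' i k') 0"
              by (rule eqp_mono[OF st(2)]) (auto simp: min_def)
            then show ?case using J0' st(1) v vrep sm
              by (simp add: J3_def J2_def upd sameD[where A = elim_vars and s = s3 and s' = s'])
          qed simp
        next
          fix s' assume J3: "J3 k' i N s'"
          \<comment> \<open>Here \<open>t = N\<close>, and \<open>(N + 1) * D\<close> is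
            \<open>L\<close>.\<close>
          then have "eqp L (mat_of s' i k') 0" using L by (simp add: J3_def)
          then show "s' vi 0 = i \<and> J2 k' (Suc i) (upd s' vi 0 (Suc i))"
            using J3 elim_inv_next_row by (auto simp: J3_def J2_def upd)
        qed (rule NB)
      next
        assume "val s2 (Sub (Var vi) (Var vkk)) = 0"
        then have ik: "i \<le> k'" using vi J2 by (simp add: J2_def)
        \<comment> \<open>Rows on or above the diagonal have nothing to clear.\<close>
        have "elim_inv N D L (mat_of s) k' (Suc i) (mat_of s2)"
          using J2 ik by (auto simp: J2_def elim_inv_def less_Suc_eq)
        then have "s2 vi 0 = i \<and> J2 k' (Suc i) (upd s2 vi 0 (Suc i))" using J2 vi by (simp add: J2_def upd)
        from tr_skip[of "\<lambda>s'. s' vi 0 = i \<and> J2 k' (Suc i) (upd s' vi 0 (Suc i))", OF this]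
        show "tr Skip s2 (kfor N k_row) (\<lambda>s'. s' vi 0 = i \<and> J2 k' (Suc i) (upd s' vi 0 (Suc i)))"
          by (rule tr_conseq) auto
      qed
    next
      fix s' assume "J2 k' N s'"
      then show "s' vkk 0 = k' \<and> J1 (Suc k') (upd s' vkk 0 (Suc k'))"
        using elim_inv_next_col by (auto simp: J2_def J1_def upd)
    qed (rule NB)
  next
    fix s' assume "J1 N s'"
    then show "same ?F s s' \<and> bits (s' vW) \<and>
      (\<forall>y>N * N. slot L (s' vW) y = slot L (s vW) y) \<and> elim_inv N D L (mat_of s) N 0 (mat_of s')"
      by (simp add: J1_def J0_def)
  qed (rule NB)
qed

end

section \<open>Product of the diagonal, sum over cuts and decision\<close>

context det_machine begin

lemma val_Extra:
  assumes "env s" "same A s s'" "A \<subseteq> frame"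
  shows "val s' (Extra m) = N * N + m"
  using env_vals[OF env_same[OF assms]] by simp

definition k_copy :: nat where "k_copy = 1 + (1 + kfor L 1)"
definition k_muladd :: nat where "k_muladd = 1 + (1 + (1 + kfor L (kfor L 1)))"
definition k_prod :: nat where "k_prod = k_copy + kfor N (k_copy + (k_muladd + k_copy))"

abbreviation prod_vars :: "nat set" where
  "prod_vars \<equiv> {vW, vd, ve, sx, sy, sz}"

lemma slot_updD:
  assumes "slot_upd L x p w w'"
  shows "bits w'" "eqp L (slot L w' x) p" "y \<noteq> x \<Longrightarrow> slot L w' y = slot L w y"
  using assms by (auto simp: slot_upd_def)

lemma tr_copy_extra:
  assumes env: "env s" and b: "bits (s vW)" and ab: "a < 6" "c < 6" "a \<noteq> c"
  shows "tr (CopyTo (Extra a) (Extra c)) s k_copy (\<lambda>s'. same prod_vars s s' \<and>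
    slot_upd L (N * N + a) (slot L (s vW) (N * N + c)) (s vW) (s' vW))"
proof -
  have "tr (CopyTo (Extra a) (Extra c)) s k_copy (\<lambda>s'. same {vW, vd, sx, sy} s s' \<and>
    slot_upd L (N * N + a) (slot L (s vW) (N * N + c)) (s vW) (s' vW))"
    unfolding k_copy_def
  proof (rule tr_CopyTo)
    fix s' assume sm: "same {sx, sy} s s'"
    show "val s' (Extra a) = N * N + a \<and> val s' (Extra c) = N * N + c"
      using val_Extra[OF env sm] by (simp add: frame_def)
  next
    show "s vL 0 = L" using env_vals[OF env] by simp
    show "(N * N + 6) * L \<le> I" by (rule SL)
  qed (use b L1 ab in auto)
  then show ?thesis by (rule tr_conseq) (auto intro: same_mono)
qed

lemma tr_muladd_extra:
  assumes env: "env s" and b: "bits (s vW)" and ab: "a < 6" "c < 6" "a \<noteq> c"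
    and e: "\<And>s'. same {sx, sy, sz} s s' \<Longrightarrow> val s' ez = z" and z: "z \<noteq> N * N + a" "z < N * N + 6"
  shows "tr (MulAddTo (Extra a) (Extra c) ez) s k_muladd (\<lambda>s'. same prod_vars s s' \<and>
    slot_upd L (N * N + a) (slot L (s vW) (N * N + a) + slot L (s vW) (N * N + c) * slot L (s vW) z) (s vW) (s' vW))"
  unfolding k_muladd_def
proof (rule tr_MulAddTo)
  fix s' assume sm: "same {sx, sy, sz} s s'"
  show "val s' (Extra a) = N * N + a \<and> val s' (Extra c) = N * N + c \<and> val s' ez = z"
    using val_Extra[OF env sm] e[OF sm] by (simp add: frame_def)
next
  show "s vL 0 = L" using env_vals[OF env] by simp
  show "(N * N + 6) * L \<le> I" by (rule SL)
qed (use b L1 ab z in auto)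

lemma tr_Product:
  assumes env: "env s" and b: "bits (s vW)"
    and zero: "slot L (s vW) (N * N + 4) = 0" and one: "slot L (s vW) (N * N + 5) = 1"
  shows "tr Product s k_prod (\<lambda>s'. same (insert vi prod_vars) s s' \<and> bits (s' vW) \<and>
    (\<forall>y. y \<noteq> N * N + 1 \<and> y \<noteq> N * N + 2 \<longrightarrow> slot L (s' vW) y = slot L (s vW) y) \<and>
    eqp L (slot L (s' vW) (N * N + 1)) (\<Prod>i<N. mat_of s i i))"
  unfolding Product_def k_prod_def
proof (rule tr_call[OF tr_copy_extra[OF env b]])
  fix s1 assume s1: "same prod_vars s s1 \<and>
    slot_upd L (N * N + 1) (slot L (s vW) (N * N + 5)) (s vW) (s1 vW)"
  define J where "J i s' \<longleftrightarrow> same (insert vi prod_vars) s s' \<and> bits (s' vW) \<and>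
    (\<forall>y. y \<noteq> N * N + 1 \<and> y \<noteq> N * N + 2 \<longrightarrow> slot L (s' vW) y = slot L (s vW) y) \<and>
    eqp L (slot L (s' vW) (N * N + 1)) (\<Prod>i'<i. mat_of s i' i')" for i and s' :: store
  have envJ: "env s'" if "J i s'" for i s'
    using that env_same[OF env, of "insert vi prod_vars" s'] by (auto simp: J_def frame_def)
  show "tr (For vi (Var vN) (Seq (CopyTo (Extra 2) (Extra 4))
      (Seq (MulAddTo (Extra 2) (Extra 1) (Entry (Var vi) (Var vi))) (CopyTo (Extra 1) (Extra 2))))) s1
      (kfor N (k_copy + (k_muladd + k_copy))) (\<lambda>s'. same (insert vi prod_vars) s s' \<and> bits (s' vW) \<and>
    (\<forall>y. y \<noteq> N * N + 1 \<and> y \<noteq> N * N + 2 \<longrightarrow> slot L (s' vW) y = slot L (s vW) y) \<and>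
    eqp L (slot L (s' vW) (N * N + 1)) (\<Prod>i<N. mat_of s i i))"
  proof (rule tr_for[where J = J])
    have "same (insert vi prod_vars) s s1" by (rule same_mono[of prod_vars]) (use s1 in auto)
    then show "J 0 (upd s1 vi 0 0)" using s1 one by (auto simp: J_def slot_upd_def)
    show "N < 2 ^ B" using NL by (intro less_B)
    show "val s' (Var vN) = N" if "J i s'" for i s' using env_vals[OF envJ[OF that]] by simp
  next
    fix i s2 assume i: "i < N" and J: "J i s2" and vi: "s2 vi 0 = i"
    have env2: "env s2" and b2: "bits (s2 vW)" using J envJ by (auto simp: J_def)
    show "tr (Seq (CopyTo (Extra 2) (Extra 4))
      (Seq (MulAddTo (Extra 2) (Extra 1) (Entry (Var vi) (Var vi))) (CopyTo (Extra 1) (Extra 2)))) s2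
      (k_copy + (k_muladd + k_copy)) (\<lambda>s'. s' vi 0 = i \<and> J (Suc i) (upd s' vi 0 (Suc i)))"
    proof (rule tr_call[OF tr_copy_extra[OF env2 b2]])
      fix s3 assume s3: "same prod_vars s2 s3 \<and>
        slot_upd L (N * N + 2) (slot L (s2 vW) (N * N + 4)) (s2 vW) (s3 vW)"
      note u3 = slot_updD[OF conjunct2[OF s3]]
      have env3: "env s3" using env_same[OF env2, of prod_vars s3] s3 by (auto simp: frame_def)
      have vi3: "s3 vi 0 = i" using sameD[OF conjunct1[OF s3], of vi] vi by simp
      show "tr (Seq (MulAddTo (Extra 2) (Extra 1) (Entry (Var vi) (Var vi))) (CopyTo (Extra 1) (Extra 2))) s3
        (k_muladd + k_copy) (\<lambda>s'. s' vi 0 = i \<and> J (Suc i) (upd s' vi 0 (Suc i)))"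
      proof (rule tr_call[OF tr_muladd_extra[OF env3 u3(1), where z = "i * N + i"]])
        fix s' assume sm: "same {sx, sy, sz} s3 s'"
        show "val s' (Entry (Var vi) (Var vi)) = i * N + i"
          using env_vals[OF env_same[OF env3 sm]] sameD[OF sm, of vi] vi3 by (simp add: frame_def)
      next
        show "i * N + i \<noteq> N * N + 2" "i * N + i < N * N + 6" using entry_less[OF i i] by auto
      next
        fix s4 assume s4: "same prod_vars s3 s4 \<and> slot_upd L (N * N + 2)
          (slot L (s3 vW) (N * N + 2) + slot L (s3 vW) (N * N + 1) * slot L (s3 vW) (i * N + i)) (s3 vW) (s4 vW)"
        note u4 = slot_updD[OF conjunct2[OF s4]]
        have env4: "env s4" using env_same[OF env3, of prod_vars s4] s4 by (auto simp: frame_def)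
        show "tr (CopyTo (Extra 1) (Extra 2)) s4 k_copy (\<lambda>s'. s' vi 0 = i \<and> J (Suc i) (upd s' vi 0 (Suc i)))"
        proof (rule tr_conseq[OF tr_copy_extra[OF env4 u4(1)]])
          fix s5 assume s5: "same prod_vars s4 s5 \<and>
            slot_upd L (N * N + 1) (slot L (s4 vW) (N * N + 2)) (s4 vW) (s5 vW)"
          note u5 = slot_updD[OF conjunct2[OF s5]]
          have "same prod_vars s3 s5" by (rule same_trans[OF conjunct1[OF s4] conjunct1[OF s5]]) simp
          then have sm: "same prod_vars s2 s5" by (rule same_trans[OF conjunct1[OF s3]]) simp
          have "same (insert vi prod_vars) s s5"
            by (rule same_trans[OF _ sm, where A = "insert vi prod_vars"]) (use J in \<open>auto simp: J_def\<close>)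
          moreover have "s5 vi 0 = i" using sameD[OF sm, of vi] vi by simp
          moreover have "slot L (s5 vW) y = slot L (s vW) y" if "y \<noteq> N * N + 1 \<and> y \<noteq> N * N + 2" for y
            using u5(3)[of y] u4(3)[of y] u3(3)[of y] that J by (simp add: J_def)
          moreover have "eqp L (slot L (s5 vW) (N * N + 1)) (\<Prod>i'<Suc i. mat_of s i' i')"
          proof -
            have z4: "slot L (s2 vW) (N * N + 4) = 0" and m: "slot L (s2 vW) (i * N + i) = mat_of s i i"
              using J zero entry_less[OF i i] by (auto simp: J_def mat_of_def)
            have 2: "eqp L (slot L (s3 vW) (N * N + 2)) 0" using u3(2) z4 by simp
            have 1: "slot L (s3 vW) (N * N + 1) = slot L (s2 vW) (N * N + 1)" using u3(3) by simp
            have 3: "slot L (s3 vW) (i * N + i) = mat_of s i i" using u3(3)[of "i * N + i"] m entry_less[OF i i] by simp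
            have "eqp L (slot L (s3 vW) (N * N + 2) + slot L (s3 vW) (N * N + 1) * slot L (s3 vW) (i * N + i))
                (0 + (\<Prod>i'<i. mat_of s i' i') * mat_of s i i)"
              unfolding 1 3 by (intro eqp_add eqp_mult 2) (use J in \<open>auto simp: J_def\<close>)
            then have "eqp L (slot L (s4 vW) (N * N + 2)) ((\<Prod>i'<i. mat_of s i' i') * mat_of s i i)"
              using eqp_trans[OF u4(2)] by simp
            then show ?thesis using eqp_trans[OF u5(2)] by simp
          qed
          ultimately show "s5 vi 0 = i \<and> J (Suc i) (upd s5 vi 0 (Suc i))"
            using u5(1) by (simp add: J_def)
        qed auto
      qed auto
    qed auto
  qed (auto simp: J_def)
qed auto

lemma eqp_start_mat: "eqp D (start_mat s X i j) (of_bool (i = j))"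
  unfolding eqp_def coeff_start_mat by auto

abbreviation det_vars :: "nat set" where
  "det_vars \<equiv> {vX, vf, vW, vi, vj, vd, ve, vrep, vkk, sx, sy, sz}"

definition k_det :: nat where
  "k_det = kfor (N * N * L) 6 + (k_elim + (k_prod + k_muladd))"

lemma tr_SumDets_body:
  assumes env: "env s" and b: "bits (s vW)"
    and zero: "slot L (s vW) (N * N + 4) = 0" and one: "slot L (s vW) (N * N + 5) = 1"
  shows "tr (Seq Fill (Seq Eliminate (Seq Product (MulAddTo (Extra 3) (Extra 1) (Extra 5))))) s k_det
    (\<lambda>s'. same (det_vars - {vX}) s s' \<and> bits (s' vW) \<and>
      slot L (s' vW) (N * N + 4) = 0 \<and> slot L (s' vW) (N * N + 5) = 1 \<and>
      eqp L (slot L (s' vW) (N * N + 3)) (slot L (s vW) (N * N + 3) + perm N (start_mat s (s vX 0))))"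
  unfolding k_det_def
proof (rule tr_call[OF tr_Fill[OF env b]], elim conjE)
  fix s1 assume sm1: "same {vW, vf, vi, vj, vd} s s1" and b1: "bits (s1 vW)"
    and m1: "\<forall>i<N. \<forall>j<N. eqp L (slot L (s1 vW) (i * N + j)) (start_mat s (s vX 0) i j)"
    and y1: "\<forall>y\<ge>N * N. slot L (s1 vW) y = slot L (s vW) y"
  have env1: "env s1" using env_same[OF env sm1] by (simp add: frame_def)
  have DL: "D \<le> L" using L by simp
  have A: "eqp D (mat_of s1 i j) (of_bool (i = j))" if "i < N" "j < N" for i j
  proof -
    have "eqp L (mat_of s1 i j) (start_mat s (s vX 0) i j)" using m1 that by (simp add: mat_of_def)
    from eqp_trans[OF eqp_mono[OF this DL] eqp_start_mat] show ?thesis .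
  qed
  show "tr (Seq Eliminate (Seq Product (MulAddTo (Extra 3) (Extra 1) (Extra 5)))) s1 (k_elim + (k_prod + k_muladd))
    (\<lambda>s'. same (det_vars - {vX}) s s' \<and> bits (s' vW) \<and>
      slot L (s' vW) (N * N + 4) = 0 \<and> slot L (s' vW) (N * N + 5) = 1 \<and>
      eqp L (slot L (s' vW) (N * N + 3)) (slot L (s vW) (N * N + 3) + perm N (start_mat s (s vX 0))))"
  proof (rule tr_call[OF tr_Eliminate[OF env1 b1 A]], assumption, assumption, elim conjE)
    fix s2 assume sm2: "same (elim_vars \<union> {vi, vrep, vkk}) s1 s2" and b2: "bits (s2 vW)"
      and y2: "\<forall>y>N * N. slot L (s2 vW) y = slot L (s1 vW) y"
      and inv: "elim_inv N D L (mat_of s1) N 0 (mat_of s2)"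
    have env2: "env s2" using env_same[OF env1 sm2] by (simp add: frame_def)
    have z2: "slot L (s2 vW) (N * N + 4) = 0" "slot L (s2 vW) (N * N + 5) = 1"
      using y1 y2 zero one by auto
    show "tr (Seq Product (MulAddTo (Extra 3) (Extra 1) (Extra 5))) s2 (k_prod + k_muladd)
      (\<lambda>s'. same (det_vars - {vX}) s s' \<and> bits (s' vW) \<and>
      slot L (s' vW) (N * N + 4) = 0 \<and> slot L (s' vW) (N * N + 5) = 1 \<and>
      eqp L (slot L (s' vW) (N * N + 3)) (slot L (s vW) (N * N + 3) + perm N (start_mat s (s vX 0))))"
    proof (rule tr_call[OF tr_Product[OF env2 b2 z2]], elim conjE)
      fix s3 assume sm3: "same (insert vi prod_vars) s2 s3" and b3: "bits (s3 vW)"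
        and y3: "\<forall>y. y \<noteq> N * N + 1 \<and> y \<noteq> N * N + 2 \<longrightarrow> slot L (s3 vW) y = slot L (s2 vW) y"
        and p3: "eqp L (slot L (s3 vW) (N * N + 1)) (\<Prod>i<N. mat_of s2 i i)"
      have env3: "env s3" using env_same[OF env2 sm3] by (simp add: frame_def)
      have "tr (MulAddTo (Extra 3) (Extra 1) (Extra 5)) s3 k_muladd (\<lambda>s'. same prod_vars s3 s' \<and>
          slot_upd L (N * N + 3) (slot L (s3 vW) (N * N + 3) +
            slot L (s3 vW) (N * N + 1) * slot L (s3 vW) (N * N + 5)) (s3 vW) (s' vW))"
        by (rule tr_muladd_extra[OF env3 b3])
          (use val_Extra[OF env3, of "{sx, sy, sz}"] in \<open>auto simp: frame_def\<close>)
      then show "tr (MulAddTo (Extra 3) (Extra 1) (Extra 5)) s3 k_muladd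
        (\<lambda>s'. same (det_vars - {vX}) s s' \<and> bits (s' vW) \<and>
        slot L (s' vW) (N * N + 4) = 0 \<and> slot L (s' vW) (N * N + 5) = 1 \<and>
        eqp L (slot L (s' vW) (N * N + 3)) (slot L (s vW) (N * N + 3) + perm N (start_mat s (s vX 0))))"
      proof (rule tr_conseq, goal_cases)
        case (2 s4)
        then have sm4: "same prod_vars s3 s4" by simp
        note u4 = slot_updD[OF conjunct2[OF 2]]
        have "same (det_vars - {vX}) s1 s3" by (rule same_trans[OF sm2 sm3]) auto
        then have "same (det_vars - {vX}) s1 s4" by (rule same_trans[OF _ sm4]) auto
        then have "same (det_vars - {vX}) s s4" by (rule same_trans[OF sm1]) auto
        moreover have "slot L (s4 vW) (N * N + 4) = 0" "slot L (s4 vW) (N * N + 5) = 1"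
          using u4(3) y3 z2 by auto
        moreover have "eqp L (slot L (s4 vW) (N * N + 3)) (slot L (s vW) (N * N + 3) + perm N (start_mat s (s vX 0)))"
        proof -
          have "eqp L (\<Prod>i<N. mat_of s2 i i) (perm N (mat_of s1))" by (rule elim_inv_end[OF inv])
          also have "eqp L (perm N (mat_of s1)) (perm N (start_mat s (s vX 0)))"
            by (rule eqp_perm) (use m1 in \<open>auto simp: mat_of_def\<close>)
          finally have "eqp L (slot L (s3 vW) (N * N + 1)) (perm N (start_mat s (s vX 0)))"
            by (rule eqp_trans[OF p3])
          moreover have "slot L (s3 vW) (N * N + 5) = 1" "slot L (s3 vW) (N * N + 3) = slot L (s vW) (N * N + 3)"
            using y1 y2 y3 one by auto
          ultimately have "eqp L (slot L (s3 vW) (N * N + 3) + slot L (s3 vW) (N * N + 1) * slot L (s3 vW) (N * N + 5))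
            (slot L (s vW) (N * N + 3) + perm N (start_mat s (s vX 0)))"
            by (intro eqp_add) auto
          then show ?thesis by (rule eqp_trans[OF u4(2)])
        qed
        ultimately show ?case using u4(1) by blast
      qed simp
    qed
  qed
qed

definition k_decide :: nat where
  "k_decide = 1 + (kfor (2 ^ (n - 1)) k_det + kfor L 2)"

lemma start_mat_cong:
  "s' vra = s vra \<Longrightarrow> s' vca = s vca \<Longrightarrow> s' rnd = s rnd \<Longrightarrow> start_mat s' = start_mat s"
  by (intro ext) (simp add: start_mat_def slot_mat_def)

lemma tr_SumDets:
  assumes env: "env s" and b: "bits (s vW)"
    and zero: "slot L (s vW) (N * N + 4) = 0" and one: "slot L (s vW) (N * N + 5) = 1"
    and acc: "slot L (s vW) (N * N + 3) = 0"
  shows "tr SumDets s (kfor (2 ^ (n - 1)) k_det) (\<lambda>s'. same det_vars s s' \<and> bits (s' vW) \<and>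
    eqp L (slot L (s' vW) (N * N + 3)) (\<Sum>X<2 ^ (n - 1). perm N (start_mat s X)))"
proof -
  define J where "J X s' \<longleftrightarrow> same det_vars s s' \<and> bits (s' vW) \<and>
    slot L (s' vW) (N * N + 4) = 0 \<and> slot L (s' vW) (N * N + 5) = 1 \<and>
    eqp L (slot L (s' vW) (N * N + 3)) (\<Sum>X'<X. perm N (start_mat s X'))" for X and s' :: store
  have envJ: "env s'" if "J X s'" for X s'
    using that env_same[OF env, of det_vars s'] by (auto simp: J_def frame_def)
  show ?thesis
    unfolding SumDets_def
  proof (rule tr_for[where J = J])
    show "J 0 (upd s vX 0 0)" using b zero one acc by (simp add: J_def)
    have "(2::nat) ^ (n - 1) \<le> 2 ^ n" by (rule power_increasing) auto
    then show "(2::nat) ^ (n - 1) < 2 ^ B" by (rule le_less_trans[OF _ pw_less])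
    show "val s' (Cell pw (Sub (Var vn) (Num 1))) = 2 ^ (n - 1)" if "J X s'" for X s'
      using envJ[OF that] by (simp add: env_def)
  next
    fix X s1 assume J: "J X s1" and vX: "s1 vX 0 = X"
    have "tr (Seq Fill (Seq Eliminate (Seq Product (MulAddTo (Extra 3) (Extra 1) (Extra 5))))) s1 k_det
    (\<lambda>s'. same (det_vars - {vX}) s1 s' \<and> bits (s' vW) \<and>
      slot L (s' vW) (N * N + 4) = 0 \<and> slot L (s' vW) (N * N + 5) = 1 \<and>
      eqp L (slot L (s' vW) (N * N + 3)) (slot L (s1 vW) (N * N + 3) + perm N (start_mat s1 (s1 vX 0))))"
      by (rule tr_SumDets_body[OF envJ[OF J]]) (use J in \<open>auto simp: J_def\<close>)
    then show "tr (Seq Fill (Seq Eliminate (Seq Product (MulAddTo (Extra 3) (Extra 1) (Extra 5))))) s1 k_det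
      (\<lambda>s'. s' vX 0 = X \<and> J (Suc X) (upd s' vX 0 (Suc X)))"
    proof (rule tr_conseq, goal_cases)
      case (2 s2)
      then have sm: "same (det_vars - {vX}) s1 s2" by simp
      have sm1: "same det_vars s s1" using J by (simp add: J_def)
      have "same det_vars s s2" by (rule same_trans[OF sm1 sm]) auto
      moreover have "s2 vX 0 = X" using sameD[OF sm, of vX] vX by simp
      moreover have "start_mat s1 = start_mat s"
        by (rule start_mat_cong) (use sameD[OF sm1] in auto)
      moreover have "eqp L (slot L (s1 vW) (N * N + 3) + perm N (start_mat s X))
          ((\<Sum>X'<X. perm N (start_mat s X')) + perm N (start_mat s X))"
        using J by (intro eqp_add) (auto simp: J_def)
      ultimately show ?case using 2 vX eqp_trans by (auto simp: J_def)
    qed simp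
  qed (auto simp: J_def)
qed

definition det_value :: "(nat \<Rightarrow> nat) \<Rightarrow> (nat \<Rightarrow> nat) \<Rightarrow> (nat \<Rightarrow> nat) \<Rightarrow> bit poly" where
  "det_value ra ca R = (\<Sum>\<rho>\<in>conn_perms N ra ca {..<n} E. \<Prod>r<N. rpoly R r (\<rho> r))"

text \<open>Vertex \<open>n - 1\<close> is the fixed vertex of \<open>sum_perm_uncut\<close>: the
  numbers below \<open>2 ^ (n - 1)\<close> code exactly the vertex sets avoiding it.\<close>

lemma sum_perm_slot_mat:
  assumes "env s"
  shows "(\<Sum>X<2 ^ (n - 1). perm N (slot_mat s X)) = det_value (s vra) (s vca) (s rnd)"
proof -
  have V: "{..<n} - {n - 1} = {..<n - 1}" using n by auto
  have "(\<Sum>X<2 ^ (n - 1). perm N (slot_mat s X)) = (\<Sum>X\<in>Pow {..<n - 1}. perm N (\<lambda>i j.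
      of_bool ((s vra i, s vca j) \<in> E \<and> (s vra i \<in> X \<longleftrightarrow> s vca j \<in> X)) * rpoly (s rnd) i j))"
    unfolding slot_mat_def by (rule sum.reindex_bij_betw[OF bij_mset_of])
  also have "\<dots> = det_value (s vra) (s vca) (s rnd)"
    unfolding V[symmetric] det_value_def
    by (rule sum_perm_uncut) (use assms n in \<open>auto simp: env_def\<close>)
  finally show ?thesis .
qed

text \<open>By \<open>coeff_perm_shift\<close> the coefficients from degree \<open>N * D\<close> on
  are those of \<open>det_value\<close>. The latter has degree at most \<open>N * k < D\<close>, so
  the window below \<open>L = N * D + D\<close> contains all of them.\<close>

lemma sum_coeff_iff:
  assumes env: "env s" and k: "1 \<le> k"
  shows "(\<exists>d. N * D \<le> d \<and> d < L \<and> coeff (\<Sum>X<2 ^ (n - 1). perm N (start_mat s X)) d \<noteq> 0) \<longleftrightarrow>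
    det_value (s vra) (s vca) (s rnd) \<noteq> 0"
proof -
  let ?S = "det_value (s vra) (s vca) (s rnd)"
  have deg: "degree (slot_mat s X i j) < k" for X i j
    using degree_bits_poly[of k] k by (cases "(s vra i, s vca j) \<in> E \<and> (s vra i \<in> mset_of X \<longleftrightarrow> s vca j \<in> mset_of X)")
      (auto simp: slot_mat_def rpoly_def)
  have sm: "start_mat s X = (\<lambda>i j. of_bool (i = j) + monom 1 D * slot_mat s X i j)" for X
    by (intro ext) (simp add: start_mat_def)
  have "coeff (perm N (start_mat s X)) d = coeff (perm N (slot_mat s X)) (d - N * D)" if "N * D \<le> d" for X d
    unfolding sm by (rule coeff_perm_shift[OF deg D that])
  then have c: "coeff (\<Sum>X<2 ^ (n - 1). perm N (start_mat s X)) d = coeff ?S (d - N * D)" if "N * D \<le> d" for d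
    using that unfolding sum_perm_slot_mat[OF env, symmetric] by (simp add: coeff_sum)
  have "degree ?S \<le> N * k"
    unfolding sum_perm_slot_mat[OF env, symmetric]
    by (rule degree_sum_le) (auto intro: degree_perm_le deg)
  then have dS: "degree ?S < D" using D by simp
  have LD: "L = N * D + D" using L by simp
  show ?thesis
  proof
    assume "?S \<noteq> 0"
    then have "coeff ?S (degree ?S) \<noteq> 0" by simp
    then have "coeff (\<Sum>X<2 ^ (n - 1). perm N (start_mat s X)) (N * D + degree ?S) \<noteq> 0"
      unfolding c[OF le_add1] by simp
    then show "\<exists>d. N * D \<le> d \<and> d < L \<and> coeff (\<Sum>X<2 ^ (n - 1). perm N (start_mat s X)) d \<noteq> 0"
      using dS LD by (intro exI[of _ "N * D + degree ?S"]) auto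
  next
    assume "\<exists>d. N * D \<le> d \<and> d < L \<and> coeff (\<Sum>X<2 ^ (n - 1). perm N (start_mat s X)) d \<noteq> 0"
    then obtain d where "N * D \<le> d" "coeff (\<Sum>X<2 ^ (n - 1). perm N (start_mat s X)) d \<noteq> 0" by blast
    then have "coeff ?S (d - N * D) \<noteq> 0" using c by metis
    then show "?S \<noteq> 0" by auto
  qed
qed

lemma tr_Decide:
  assumes env: "env s" and W: "\<And>i. s vW i = 0" and ans: "s ans 0 = 0" and k: "1 \<le> k"
  shows "tr Decide s k_decide (\<lambda>s'. s' ans 0 \<noteq> 0 \<longleftrightarrow> det_value (s vra) (s vca) (s rnd) \<noteq> 0)"
proof -
  define s1 where "s1 = upd s vW ((N * N + 5) * L) 1"
  have env1: "env s1" by (rule env_same[OF env, of "{vW}"]) (auto simp: s1_def frame_def)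
  have b1: "bits (s1 vW)" using W by (auto simp: s1_def bits_def)
  have one: "slot L (s1 vW) (N * N + 5) = 1"
    by (rule poly_eqI) (use L1 W in \<open>auto simp: coeff_slot s1_def\<close>)
  have sl: "slot L (s1 vW) y = 0" if "y \<noteq> N * N + 5" for y
  proof (rule poly_eqI)
    fix d
    show "coeff (slot L (s1 vW) y) d = coeff 0 d"
      using slot_disjoint[OF that, of d L] L1 W by (auto simp: coeff_slot s1_def)
  qed
  have "(N * N + 6) * L = (N * N + 5) * L + L" by (simp add: algebra_simps)
  then have idx: "(N * N + 5) * L < I" using SL L1 by linarith
  let ?Q = "\<lambda>s'. s' ans 0 \<noteq> 0 \<longleftrightarrow> det_value (s vra) (s vca) (s rnd) \<noteq> 0"
  let ?loop = "For vd (Var vL) (Cond (Mul (Sub (Add (Var vd) (Num 1)) (Mul (Var vN) (Var vD)))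
          (Cell vW (Add (Mul (Extra 3) (Var vL)) (Var vd)))) (Set ans (Num 1)) Skip)"
  have "tr (Seq SumDets ?loop) s1 (kfor (2 ^ (n - 1)) k_det + kfor L 2) ?Q"
  proof (rule tr_call[OF tr_SumDets[OF env1 b1 sl one sl]])
    fix s2 assume s2: "same det_vars s1 s2 \<and> bits (s2 vW) \<and>
      eqp L (slot L (s2 vW) (N * N + 3)) (\<Sum>X<2 ^ (n - 1). perm N (start_mat s1 X))"
    have sm2: "same det_vars s1 s2" using s2 by simp
    have env2: "env s2" by (rule env_same[OF env1 sm2]) (auto simp: frame_def)
    have ans2: "s2 ans 0 = 0" using sameD[OF sm2, of ans] ans by (simp add: s1_def)
    define J where "J d s' \<longleftrightarrow> same {vd, ans} s2 s' \<and>
      (s' ans 0 \<noteq> 0 \<longleftrightarrow> (\<exists>d'<d. N * D \<le> d' \<and> s2 vW ((N * N + 3) * L + d') \<noteq> 0))" for d and s' :: store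
    have envJ: "env s'" if "J d s'" for d s'
      using that env_same[OF env2, of "{vd, ans}" s'] by (auto simp: J_def frame_def)
    show "tr ?loop s2 (kfor L 2) ?Q"
    proof (rule tr_for[where J = J])
      show "J 0 (upd s2 vd 0 0)" using ans2 by (simp add: J_def)
      show "L < 2 ^ B" using NL by (intro less_B)
      show "val s' (Var vL) = L" if "J d s'" for d s' using env_vals[OF envJ[OF that]] by simp
    next
      fix d s' assume d: "d < L" and J: "J d s'" and vd: "s' vd 0 = d"
      have sm: "same {vd, ans} s2 s'" using J by (simp add: J_def)
      have vW': "s' vW = s2 vW" using sameD[OF sm, of vW] by simp
      have v: "val s' (Mul (Sub (Add (Var vd) (Num 1)) (Mul (Var vN) (Var vD)))
          (Cell vW (Add (Mul (Extra 3) (Var vL)) (Var vd)))) = (d + 1 - N * D) * s2 vW ((N * N + 3) * L + d)"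
        using env_vals[OF envJ[OF J]] vd vW' by simp
      have "tr (Cond (Mul (Sub (Add (Var vd) (Num 1)) (Mul (Var vN) (Var vD)))
          (Cell vW (Add (Mul (Extra 3) (Var vL)) (Var vd)))) (Set ans (Num 1)) Skip) s' (1 + 1)
          (\<lambda>s'. s' vd 0 = d \<and> J (Suc d) (upd s' vd 0 (Suc d)))"
      proof (rule tr_cond, goal_cases)
        case 1
        then have "J (Suc d) (upd (upd s' ans 0 1) vd 0 (Suc d))"
          using J sm unfolding v by (auto simp: J_def intro!: exI[of _ d])
        then show ?case using vd I by (intro tr_assign) (auto intro: bit_less_B)
      next
        case 2
        then have "J (Suc d) (upd s' vd 0 (Suc d))"
          using J sm unfolding v by (auto simp: J_def less_Suc_eq)
        then show ?case using vd by (intro tr_skip) auto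
      qed
      then show "tr (Cond (Mul (Sub (Add (Var vd) (Num 1)) (Mul (Var vN) (Var vD)))
          (Cell vW (Add (Mul (Extra 3) (Var vL)) (Var vd)))) (Set ans (Num 1)) Skip) s' 2
          (\<lambda>s'. s' vd 0 = d \<and> J (Suc d) (upd s' vd 0 (Suc d)))"
        by (rule tr_conseq) auto
    next
      fix s' assume J: "J L s'"
      have "s2 vW ((N * N + 3) * L + d') \<noteq> 0 \<longleftrightarrow>
          coeff (\<Sum>X<2 ^ (n - 1). perm N (start_mat s1 X)) d' \<noteq> 0" if "d' < L" for d'
      proof -
        have "coeff (\<Sum>X<2 ^ (n - 1). perm N (start_mat s1 X)) d' = of_nat (s2 vW ((N * N + 3) * L + d'))"
          using s2 that by (auto simp: eqp_def coeff_slot)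
        \<comment> \<open>Cells contain bits, so a cell is nonzero exactly when the coefficient it
          stands for is.\<close>
        moreover have "s2 vW ((N * N + 3) * L + d') = 0 \<or> s2 vW ((N * N + 3) * L + d') = 1"
          using s2 by (auto simp: bits_def le_Suc_eq)
        ultimately show ?thesis by (metis of_nat_0 of_nat_1 zero_neq_one)
      qed
      then have "(s' ans 0 \<noteq> 0) = (\<exists>d. N * D \<le> d \<and> d < L \<and> coeff (\<Sum>X<2 ^ (n - 1). perm N (start_mat s1 X)) d \<noteq> 0)"
        using J by (auto simp: J_def)
      also have "\<dots> = (det_value (s1 vra) (s1 vca) (s1 rnd) \<noteq> 0)" by (rule sum_coeff_iff[OF env1 k])
      finally show "?Q s'" by (simp add: s1_def)
    qed
  qed auto
  moreover have "val s (Mul (Extra 5) (Var vL)) = (N * N + 5) * L" using env_vals[OF env] by simp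
  ultimately show ?thesis
    unfolding Decide_def k_decide_def using idx
    by (intro tr_call[OF tr_assign[where Q = "\<lambda>s'. s' = s1"]]) (auto simp: s1_def intro: bit_less_B)
qed

end

section \<open>Reducing the degrees by machine\<close>

definition Powers :: com where
  "Powers = Seq (Assign pw (Num 0) (Num 1))
     (For vx (Var vn) (Assign pw (Add (Var vx) (Num 1)) (Mul (Num 2) (Cell pw (Var vx)))))"

definition SumLoop :: "nat \<Rightarrow> nat \<Rightarrow> aexp \<Rightarrow> com" where
  "SumLoop v a e = Seq (Set a (Num 0)) (For v (Var vn) (Set a (Add (Var a) e)))"

definition Neighbours :: com where
  "Neighbours = For vy (Var vn) (Seq (Assign nb (Var vy) (Num 0))
     (For vx (Var vn) (Cond (Mul (BitE (Var vx)) (Cell adj (Add (Mul (Var vx) (Var vn)) (Var vy))))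
        (Assign nb (Var vy) (Num 1)) Skip)))"

definition CheckSet :: com where
  "CheckSet = Seq (SumLoop vx sumo (Mul (BitE (Var vx)) (Cell dout (Var vx)))) (Seq Neighbours
     (Seq (SumLoop vy sumi (Mul (Cell nb (Var vy)) (Cell din (Var vy))))
       (Cond (Mul (Sub (Num 1) (BitE (Var vu))) (Cell nb (Var vv)))
         (Cond (Sub (Var sumi) (Add (Var sumo) (Var vn))) Skip (Set flag (Num 0))) Skip)))"

text \<open>\<open>flag\<close> records the two conditions on the degrees first; a vertex set with
  too little slack clears it, and no set raises it again.\<close>

definition Check :: com where
  "Check = Seq (Cond (Sub (Cell dout (Var vu)) (Var vn))
       (Cond (Sub (Cell din (Var vv)) (Var vn)) (Set flag (Num 1)) (Set flag (Num 0))) (Set flag (Num 0)))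
     (For vX (Cell pw (Var vn)) CheckSet)"

text \<open>Every successful round lowers the degree of \<open>vu\<close> by one, so at most
  \<open>M + 1\<close> checks are made; this puts a factor \<open>M + 1\<close> into the running
  time.\<close>

definition Reduce :: com where
  "Reduce = Seq (Set flag (Num 1)) (While (Var flag) (Seq Check (Cond (Var flag)
     (Seq (Assign dout (Var vu) (Sub (Cell dout (Var vu)) (Num 1)))
          (Assign din (Var vv) (Sub (Cell din (Var vv)) (Num 1)))) Skip)))"

definition Kernel :: com where
  "Kernel = For vu (Var vn) (For vv (Var vn)
     (Cond (Cell adj (Add (Mul (Var vu) (Var vn)) (Var vv))) Reduce Skip))"

definition Slots :: "nat \<Rightarrow> nat \<Rightarrow> com" where
  "Slots src dst = Seq (Set vt (Num 0)) (For vu (Var vn) (For vv (Cell src (Var vu))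
     (Seq (Assign dst (Var vt) (Var vu)) (Set vt (Add (Var vt) (Num 1))))))"

section \<open>Correctness of the degree reduction\<close>

text \<open>\<open>sum_less\<close> lets every sum of degrees over a vertex set, plus the slack
  \<open>n\<close>, fit into a cell.\<close>

locale graph_machine = bounded_machine +
  fixes n M :: nat and E :: "nat rel"
  assumes n: "1 \<le> n" and E: "E \<subseteq> {..<n} \<times> {..<n}" and nI: "n + 1 \<le> I"
    and pw_less: "(2::nat) ^ n < 2 ^ B" and sum_less: "n * M + n + 1 < 2 ^ B"
begin

abbreviation "V \<equiv> {..<n}"

definition genv :: "store \<Rightarrow> bool" where
  "genv s \<longleftrightarrow> s vn 0 = n \<and> (\<forall>u<n. \<forall>v<n. s adj (u * n + v) = of_bool ((u, v) \<in> E)) \<and> (\<forall>x\<le>n. s pw x = 2 ^ x)"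

lemma genv_same: "genv s \<Longrightarrow> same A s s' \<Longrightarrow> A \<inter> {vn, adj, pw} = {} \<Longrightarrow> genv s'"
proof -
  assume g: "genv s" and "same A s s'" "A \<inter> {vn, adj, pw} = {}"
  then have "s' vn = s vn" "s' adj = s adj" "s' pw = s pw" by (auto simp: same_def)
  then show "genv s'" using g by (simp add: genv_def)
qed

lemma nB: "n < 2 ^ B" using nI by (intro less_B) simp

lemma tr_Powers:
  assumes vn: "s vn 0 = n"
  shows "tr Powers s (1 + kfor n 1) (\<lambda>s'. same {pw, vx} s s' \<and> (\<forall>x\<le>n. s' pw x = 2 ^ x))"
proof -
  define s1 where "s1 = upd s pw 0 1"
  define J where "J i s' \<longleftrightarrow> same {pw, vx} s s' \<and> (\<forall>x\<le>i. s' pw x = 2 ^ x)" for i and s' :: store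
  have vnJ: "s' vn 0 = n" if "J i s'" for i s' using that vn sameD[of "{pw, vx}" s s' vn] by (simp add: J_def)
  have "tr (For vx (Var vn) (Assign pw (Add (Var vx) (Num 1)) (Mul (Num 2) (Cell pw (Var vx))))) s1
      (kfor n 1) (\<lambda>s'. same {pw, vx} s s' \<and> (\<forall>x\<le>n. s' pw x = 2 ^ x))"
  proof (rule tr_for[where J = J])
    show "J 0 (upd s1 vx 0 0)" by (simp add: J_def s1_def)
    show "val s' (Var vn) = n" if "J i s'" for i s' using vnJ[OF that] by simp
  next
    fix i s' assume i: "i < n" and J: "J i s'" and vx: "s' vx 0 = i"
    have "(2::nat) ^ Suc i \<le> 2 ^ n" using i by (intro power_increasing) auto
    then have "(2::nat) ^ Suc i < 2 ^ B" using pw_less by (rule le_less_trans)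
    then have "(2::nat) * 2 ^ i < 2 ^ B" by (simp only: power_Suc)
    then show "tr (Assign pw (Add (Var vx) (Num 1)) (Mul (Num 2) (Cell pw (Var vx)))) s' 1
        (\<lambda>s'. s' vx 0 = i \<and> J (Suc i) (upd s' vx 0 (Suc i)))"
      using J vx i nI by (intro tr_assign) (auto simp: J_def le_Suc_eq)
  qed (auto simp: J_def nB)
  then show ?thesis
    unfolding Powers_def using I by (intro tr_call[OF tr_assign[where Q = "\<lambda>s'. s' = s1"]])
      (auto simp: s1_def intro: bit_less_B)
qed

lemma tr_SumLoop:
  assumes vn: "s vn 0 = n" and av: "a \<noteq> v" "a \<noteq> vn" "v \<noteq> vn"
    and e: "\<And>i s'. i < n \<Longrightarrow> same {a, v} s s' \<Longrightarrow> s' v 0 = i \<Longrightarrow> val s' e = f i"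
    and less: "(\<Sum>i<n. f i) < 2 ^ B"
  shows "tr (SumLoop v a e) s (1 + kfor n 1) (\<lambda>s'. same {a, v} s s' \<and> s' a 0 = (\<Sum>i<n. f i))"
proof -
  define J where "J i s' \<longleftrightarrow> same {a, v} s s' \<and> s' a 0 = (\<Sum>i'<i. f i')" for i and s' :: store
  have vnJ: "s' vn 0 = n" if "J i s'" for i s' using that vn sameD[of "{a, v}" s s' vn] av by (simp add: J_def)
  have "tr (For v (Var vn) (Set a (Add (Var a) e))) (upd s a 0 0) (kfor n 1)
      (\<lambda>s'. same {a, v} s s' \<and> s' a 0 = (\<Sum>i<n. f i))"
  proof (rule tr_for[where J = J])
    show "J 0 (upd (upd s a 0 0) v 0 0)" using av by (simp add: J_def)
    show "val s' (Var vn) = n" if "J i s'" for i s' using vnJ[OF that] by simp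
  next
    fix i s' assume i: "i < n" and J: "J i s'" and v: "s' v 0 = i"
    have "val s' e = f i" using e[of i s'] i v J by (simp add: J_def)
    moreover have "(\<Sum>i'<Suc i. f i') \<le> (\<Sum>i'<n. f i')" using i by (intro sum_mono2) auto
    ultimately show "tr (Set a (Add (Var a) e)) s' 1 (\<lambda>s'. s' v 0 = i \<and> J (Suc i) (upd s' v 0 (Suc i)))"
      using J v av less I by (intro tr_assign) (auto simp: J_def)
  qed (auto simp: J_def nB)
  then show ?thesis unfolding SumLoop_def using I by (intro tr_set) auto
qed

definition k_nb :: nat where "k_nb = kfor n (1 + kfor n 2)"

lemma tr_Neighbours:
  assumes g: "genv s"
  shows "tr Neighbours s k_nb (\<lambda>s'. same {nb, vx, vy} s s' \<and>
    (\<forall>y<n. s' nb y = of_bool (y \<in> E `` mset_of (s vX 0))))"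
proof -
  define S where "S = mset_of (s vX 0)"
  define J where "J y s' \<longleftrightarrow> same {nb, vx, vy} s s' \<and> (\<forall>y'<y. s' nb y' = of_bool (y' \<in> E `` S))" for y and s' :: store
  define J' where "J' y x s' \<longleftrightarrow> same {nb, vx, vy} s s' \<and> s' vy 0 = y \<and> (\<forall>y'<y. s' nb y' = of_bool (y' \<in> E `` S)) \<and>
    s' nb y = of_bool (\<exists>x'<x. x' \<in> S \<and> (x', y) \<in> E)" for y x and s' :: store
  have gJ: "genv s'" "s' vX = s vX" if "same {nb, vx, vy} s s'" for s'
    using genv_same[OF g that] sameD[OF that, of vX] by auto
  show ?thesis
    unfolding Neighbours_def k_nb_def S_def[symmetric]
  proof (rule tr_for[where J = J])
    show "J 0 (upd s vy 0 0)" by (simp add: J_def)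
    show "val s' (Var vn) = n" if "J y s'" for y s' using gJ(1)[of s'] that by (auto simp: J_def genv_def)
  next
    fix y s1 assume y: "y < n" and J: "J y s1" and vy: "s1 vy 0 = y"
    have "J' y 0 (upd s1 nb y 0)" using J vy by (auto simp: J_def J'_def)
    then have start: "J' y 0 (upd (upd s1 nb y 0) vx 0 0)" by (simp add: J'_def)
    have "tr (For vx (Var vn) (Cond (Mul (BitE (Var vx)) (Cell adj (Add (Mul (Var vx) (Var vn)) (Var vy))))
        (Assign nb (Var vy) (Num 1)) Skip)) (upd s1 nb y 0) (kfor n 2)
        (\<lambda>s'. s' vy 0 = y \<and> J (Suc y) (upd s' vy 0 (Suc y)))"
    proof (rule tr_for[where J = "J' y"], rule start)
      show "val s' (Var vn) = n" if "J' y x s'" for x s' using gJ(1)[of s'] that by (auto simp: J'_def genv_def)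
    next
      fix x s2 assume x: "x < n" and J': "J' y x s2" and vx: "s2 vx 0 = x"
      have g2: "genv s2" "s2 vX = s vX" using gJ[of s2] J' by (auto simp: J'_def)
      have v: "val s2 (Mul (BitE (Var vx)) (Cell adj (Add (Mul (Var vx) (Var vn)) (Var vy)))) \<noteq> 0 \<longleftrightarrow>
          x \<in> S \<and> (x, y) \<in> E"
        using g2 J' vx x y by (auto simp: genv_def J'_def S_def mset_of_def odd_iff_mod_2_eq_one)
      have "tr (Cond (Mul (BitE (Var vx)) (Cell adj (Add (Mul (Var vx) (Var vn)) (Var vy))))
        (Assign nb (Var vy) (Num 1)) Skip) s2 (1 + 1) (\<lambda>s'. s' vx 0 = x \<and> J' y (Suc x) (upd s' vx 0 (Suc x)))"
      proof (rule tr_cond)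
        assume nz: "val s2 (Mul (BitE (Var vx)) (Cell adj (Add (Mul (Var vx) (Var vn)) (Var vy)))) \<noteq> 0"
        have "J' y (Suc x) (upd (upd s2 nb y 1) vx 0 (Suc x))"
          using J' nz[unfolded v] by (auto simp: J'_def)
        moreover have "s2 vy 0 = y" using J' by (simp add: J'_def)
        ultimately show "tr (Assign nb (Var vy) (Num 1)) s2 1 (\<lambda>s'. s' vx 0 = x \<and> J' y (Suc x) (upd s' vx 0 (Suc x)))"
          using vx y nI by (intro tr_assign) (auto intro: bit_less_B)
      next
        assume z: "val s2 (Mul (BitE (Var vx)) (Cell adj (Add (Mul (Var vx) (Var vn)) (Var vy)))) = 0"
        then have "\<not> (x \<in> S \<and> (x, y) \<in> E)" using v by blast
        then have "J' y (Suc x) (upd s2 vx 0 (Suc x))" using J' by (auto simp: J'_def less_Suc_eq)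
        then show "tr Skip s2 1 (\<lambda>s'. s' vx 0 = x \<and> J' y (Suc x) (upd s' vx 0 (Suc x)))"
          using vx by (intro tr_skip) auto
      qed
      then show "tr (Cond (Mul (BitE (Var vx)) (Cell adj (Add (Mul (Var vx) (Var vn)) (Var vy))))
        (Assign nb (Var vy) (Num 1)) Skip) s2 2 (\<lambda>s'. s' vx 0 = x \<and> J' y (Suc x) (upd s' vx 0 (Suc x)))"
        by (rule tr_conseq) auto
    next
      fix s' assume J': "J' y n s'"
      have "(\<exists>x'<n. x' \<in> S \<and> (x', y) \<in> E) \<longleftrightarrow> y \<in> E `` S" using E by auto
      then show "s' vy 0 = y \<and> J (Suc y) (upd s' vy 0 (Suc y))"
        using J' by (auto simp: J_def J'_def less_Suc_eq)
    qed (rule nB)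
    then show "tr (Seq (Assign nb (Var vy) (Num 0)) (For vx (Var vn)
        (Cond (Mul (BitE (Var vx)) (Cell adj (Add (Mul (Var vx) (Var vn)) (Var vy))))
        (Assign nb (Var vy) (Num 1)) Skip))) s1 (1 + kfor n 2)
        (\<lambda>s'. s' vy 0 = y \<and> J (Suc y) (upd s' vy 0 (Suc y)))"
      using vy y nI by (intro tr_call[OF tr_assign[where Q = "\<lambda>s'. s' = upd s1 nb y 0"]]) auto
  qed (auto simp: J_def nB)
qed

definition good_set :: "(nat \<Rightarrow> nat) \<Rightarrow> (nat \<Rightarrow> nat) \<Rightarrow> nat \<Rightarrow> nat \<Rightarrow> nat set \<Rightarrow> bool" where
  "good_set a b u v S \<longleftrightarrow> (u \<notin> S \<and> v \<in> E `` S \<longrightarrow> sum a S + n < sum b (E `` S))"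

abbreviation check_vars :: "nat set" where
  "check_vars \<equiv> {flag, vX, sumo, sumi, vy, vx, nb}"

definition k_set :: nat where
  "k_set = (1 + kfor n 1) + (k_nb + ((1 + kfor n 1) + 3))"

lemma sum_le_nM: "(\<And>i. i < n \<Longrightarrow> f i \<le> M) \<Longrightarrow> (\<Sum>i<n. f i) \<le> n * M"
  using sum_bounded_above[of "{..<n}" f M] by simp

lemma tr_CheckSet:
  assumes g: "genv s" and X: "s vX 0 = X" "X < 2 ^ n" and uv: "s vu 0 = u" "s vv 0 = v" "u < n" "v < n"
    and M: "\<And>x. x < n \<Longrightarrow> s dout x \<le> M" "\<And>x. x < n \<Longrightarrow> s din x \<le> M"
  shows "tr CheckSet s k_set (\<lambda>s'. same (check_vars - {vX}) s s' \<and>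
    (s' flag 0 \<noteq> 0 \<longleftrightarrow> s flag 0 \<noteq> 0 \<and> good_set (s dout) (s din) u v (mset_of X)))"
proof -
  define S where "S = mset_of X"
  have S: "S \<subseteq> {..<n}" using bij_betwE[OF bij_mset_of[of n]] X by (auto simp: S_def)
  have ES: "E `` S \<subseteq> {..<n}" using E by auto
  have bitS: "X div 2 ^ x mod 2 = of_bool (x \<in> S)" for x
    by (auto simp: S_def mset_of_def odd_iff_mod_2_eq_one)
  have so: "(\<Sum>x<n. of_bool (x \<in> S) * s dout x) = sum (s dout) S"
    using S by (intro sum.mono_neutral_cong_right) auto
  have si: "(\<Sum>x<n. of_bool (x \<in> E `` S) * s din x) = sum (s din) (E `` S)"
    using ES by (intro sum.mono_neutral_cong_right) auto
  have so_le: "sum (s dout) S \<le> n * M" unfolding so[symmetric] by (rule sum_le_nM) (use M in auto)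
  have si_le: "sum (s din) (E `` S) \<le> n * M" unfolding si[symmetric] by (rule sum_le_nM) (use M in auto)
  let ?Q = "\<lambda>s'. same (check_vars - {vX}) s s' \<and>
    (s' flag 0 \<noteq> 0 \<longleftrightarrow> s flag 0 \<noteq> 0 \<and> good_set (s dout) (s din) u v S)"
  have vn: "s vn 0 = n" using g by (simp add: genv_def)
  have 1: "tr (SumLoop vx sumo (Mul (BitE (Var vx)) (Cell dout (Var vx)))) s (1 + kfor n 1)
      (\<lambda>s'. same {sumo, vx} s s' \<and> s' sumo 0 = (\<Sum>x<n. of_bool (x \<in> S) * s dout x))"
  proof (rule tr_SumLoop[where s = s and f = "\<lambda>x. of_bool (x \<in> S) * s dout x", OF vn])
    fix i s' assume i: "i < n" and sm: "same {sumo, vx} s s'" and v: "s' vx 0 = i"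
    have "s' pw = s pw" "s' dout = s dout" "s' vX = s vX" using sameD[OF sm] by auto
    then show "val s' (Mul (BitE (Var vx)) (Cell dout (Var vx))) = of_bool (i \<in> S) * s dout i"
      using v i g X bitS by (simp add: genv_def)
  next
    show "(\<Sum>x<n. of_bool (x \<in> S) * s dout x) < 2 ^ B" unfolding so using so_le sum_less by linarith
  qed simp_all
  have "tr (Seq (SumLoop vx sumo (Mul (BitE (Var vx)) (Cell dout (Var vx)))) (Seq Neighbours
     (Seq (SumLoop vy sumi (Mul (Cell nb (Var vy)) (Cell din (Var vy))))
       (Cond (Mul (Sub (Num 1) (BitE (Var vu))) (Cell nb (Var vv)))
         (Cond (Sub (Var sumi) (Add (Var sumo) (Var vn))) Skip (Set flag (Num 0))) Skip)))) s
       ((1 + kfor n 1) + (k_nb + ((1 + kfor n 1) + ((1 + 1) + 1)))) ?Q"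
  proof (rule tr_call[OF 1], elim conjE)
    fix s1 assume sm1: "same {sumo, vx} s s1" and so1: "s1 sumo 0 = (\<Sum>x<n. of_bool (x \<in> S) * s dout x)"
    have g1: "genv s1" using genv_same[OF g sm1] by simp
    have X1: "s1 vX 0 = X" using sameD[OF sm1, of vX] X by simp
    show "tr (Seq Neighbours (Seq (SumLoop vy sumi (Mul (Cell nb (Var vy)) (Cell din (Var vy))))
       (Cond (Mul (Sub (Num 1) (BitE (Var vu))) (Cell nb (Var vv)))
         (Cond (Sub (Var sumi) (Add (Var sumo) (Var vn))) Skip (Set flag (Num 0))) Skip))) s1
         (k_nb + ((1 + kfor n 1) + ((1 + 1) + 1))) ?Q"
    proof (rule tr_call[OF tr_Neighbours[OF g1]], elim conjE, unfold X1 S_def[symmetric])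
      fix s2 assume sm2: "same {nb, vx, vy} s1 s2" and nb2: "\<forall>y<n. s2 nb y = of_bool (y \<in> E `` S)"
      have sm2': "same {sumo, vx, nb, vy} s s2" by (rule same_trans[OF sm1 sm2]) auto
      have g2: "genv s2" using genv_same[OF g sm2'] by simp
      have vn2: "s2 vn 0 = n" using g2 by (simp add: genv_def)
      have 2: "tr (SumLoop vy sumi (Mul (Cell nb (Var vy)) (Cell din (Var vy)))) s2 (1 + kfor n 1)
        (\<lambda>s'. same {sumi, vy} s2 s' \<and> s' sumi 0 = (\<Sum>x<n. of_bool (x \<in> E `` S) * s din x))"
      proof (rule tr_SumLoop[where s = s2 and f = "\<lambda>x. of_bool (x \<in> E `` S) * s din x", OF vn2])
        fix i s' assume i: "i < n" and sm: "same {sumi, vy} s2 s'" and v: "s' vy 0 = i"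
        have "s' nb = s2 nb" "s' din = s din" using sameD[OF sm] sameD[OF sm2'] by auto
        then show "val s' (Mul (Cell nb (Var vy)) (Cell din (Var vy))) = of_bool (i \<in> E `` S) * s din i"
          using v i nb2 by simp
      next
        show "(\<Sum>x<n. of_bool (x \<in> E `` S) * s din x) < 2 ^ B" unfolding si using si_le sum_less by linarith
      qed simp_all
      show "tr (Seq (SumLoop vy sumi (Mul (Cell nb (Var vy)) (Cell din (Var vy))))
       (Cond (Mul (Sub (Num 1) (BitE (Var vu))) (Cell nb (Var vv)))
         (Cond (Sub (Var sumi) (Add (Var sumo) (Var vn))) Skip (Set flag (Num 0))) Skip)) s2
         ((1 + kfor n 1) + ((1 + 1) + 1)) ?Q"
      proof (rule tr_call[OF 2], elim conjE)
        fix s3 assume sm3: "same {sumi, vy} s2 s3" and si3: "s3 sumi 0 = (\<Sum>x<n. of_bool (x \<in> E `` S) * s din x)"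
        have sm: "same (check_vars - {vX, flag}) s s3" by (rule same_trans[OF sm2' sm3]) auto
        have g3: "genv s3" using genv_same[OF g sm] by simp
        have v3: "s3 vu 0 = u" "s3 vv 0 = v" "s3 vX 0 = X" "s3 flag = s flag" using sameD[OF sm] uv X by auto
        have s3: "s3 sumo 0 = sum (s dout) S" "s3 sumi 0 = sum (s din) (E `` S)"
          using so1 sameD[OF sm2, of sumo] sameD[OF sm3, of sumo] si3 so si by auto
        have nb3: "s3 nb v = of_bool (v \<in> E `` S)" using nb2 uv sameD[OF sm3, of nb] by simp
        have sm': "same (check_vars - {vX}) s s3" by (rule same_mono[OF sm]) auto
        have c1: "val s3 (Mul (Sub (Num 1) (BitE (Var vu))) (Cell nb (Var vv))) \<noteq> 0 \<longleftrightarrow> u \<notin> S \<and> v \<in> E `` S"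
          using g3 v3 nb3 uv bitS by (simp add: genv_def)
        have c2: "val s3 (Sub (Var sumi) (Add (Var sumo) (Var vn))) \<noteq> 0 \<longleftrightarrow> sum (s dout) S + n < sum (s din) (E `` S)"
          using g3 s3 by (auto simp: genv_def)
        show "tr (Cond (Mul (Sub (Num 1) (BitE (Var vu))) (Cell nb (Var vv)))
         (Cond (Sub (Var sumi) (Add (Var sumo) (Var vn))) Skip (Set flag (Num 0))) Skip) s3 ((1 + 1) + 1) ?Q"
        proof (rule tr_cond)
          assume nz: "val s3 (Mul (Sub (Num 1) (BitE (Var vu))) (Cell nb (Var vv))) \<noteq> 0"
          show "tr (Cond (Sub (Var sumi) (Add (Var sumo) (Var vn))) Skip (Set flag (Num 0))) s3 (1 + 1) ?Q"
          proof (rule tr_cond)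
            assume "val s3 (Sub (Var sumi) (Add (Var sumo) (Var vn))) \<noteq> 0"
            then show "tr Skip s3 1 ?Q" using c2 sm' v3 by (intro tr_skip) (auto simp: good_set_def)
          next
            assume "val s3 (Sub (Var sumi) (Add (Var sumo) (Var vn))) = 0"
            then have "\<not> good_set (s dout) (s din) u v S" using c1 c2 nz by (auto simp: good_set_def)
            then show "tr (Set flag (Num 0)) s3 1 ?Q" using sm' I by (intro tr_assign) auto
          qed
        next
          assume "val s3 (Mul (Sub (Num 1) (BitE (Var vu))) (Cell nb (Var vv))) = 0"
          then have "good_set (s dout) (s din) u v S" using c1 by (auto simp: good_set_def)
          then have "tr Skip s3 1 ?Q" using sm' v3 by (intro tr_skip) auto
          then show "tr Skip s3 (1 + 1) ?Q" by (rule tr_conseq) auto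
        qed
      qed
    qed
  qed
  then show ?thesis unfolding CheckSet_def k_set_def S_def by (rule tr_conseq) auto
qed

definition k_check :: nat where
  "k_check = 3 + kfor (2 ^ n) k_set"

lemma tr_Check:
  assumes g: "genv s" and uv: "s vu 0 = u" "s vv 0 = v" "u < n" "v < n"
    and M: "\<And>x. x < n \<Longrightarrow> s dout x \<le> M" "\<And>x. x < n \<Longrightarrow> s din x \<le> M"
  shows "tr Check s k_check (\<lambda>s'. same check_vars s s' \<and>
    (s' flag 0 \<noteq> 0 \<longleftrightarrow> reducible V E (s dout) (s din) u v))"
proof -
  define P0 where "P0 \<longleftrightarrow> n < s dout u \<and> n < s din v"
  define J where "J X s' \<longleftrightarrow> same check_vars s s' \<and>
    (s' flag 0 \<noteq> 0 \<longleftrightarrow> P0 \<and> (\<forall>X'<X. good_set (s dout) (s din) u v (mset_of X')))" for X and s' :: store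
  have vn: "s vn 0 = n" using g by (simp add: genv_def)
  have "tr (Cond (Sub (Cell dout (Var vu)) (Var vn))
       (Cond (Sub (Cell din (Var vv)) (Var vn)) (Set flag (Num 1)) (Set flag (Num 0))) (Set flag (Num 0))) s ((1 + 1) + 1) (J 0)"
  proof (rule tr_cond)
    assume 1: "val s (Sub (Cell dout (Var vu)) (Var vn)) \<noteq> 0"
    show "tr (Cond (Sub (Cell din (Var vv)) (Var vn)) (Set flag (Num 1)) (Set flag (Num 0))) s (1 + 1) (J 0)"
      by (rule tr_cond; rule tr_assign) (use 1 uv vn I in \<open>auto simp: J_def P0_def intro: bit_less_B\<close>)
  next
    assume "val s (Sub (Cell dout (Var vu)) (Var vn)) = 0"
    then have "tr (Set flag (Num 0)) s 1 (J 0)"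
      using uv vn I by (intro tr_assign) (auto simp: J_def P0_def)
    then show "tr (Set flag (Num 0)) s (1 + 1) (J 0)" by (rule tr_conseq) auto
  qed
  then have 0: "tr (Cond (Sub (Cell dout (Var vu)) (Var vn))
       (Cond (Sub (Cell din (Var vv)) (Var vn)) (Set flag (Num 1)) (Set flag (Num 0))) (Set flag (Num 0))) s 3 (J 0)"
    by (rule tr_conseq) auto
  show ?thesis
    unfolding Check_def k_check_def
  proof (rule tr_call[OF 0])
    fix s1 assume J0: "J 0 s1"
    show "tr (For vX (Cell pw (Var vn)) CheckSet) s1 (kfor (2 ^ n) k_set)
      (\<lambda>s'. same check_vars s s' \<and> (s' flag 0 \<noteq> 0 \<longleftrightarrow> reducible V E (s dout) (s din) u v))"
    proof (rule tr_for[where J = J])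
      show "J 0 (upd s1 vX 0 0)" using J0 by (simp add: J_def)
      show "(2::nat) ^ n < 2 ^ B" by (rule pw_less)
      show "val s' (Cell pw (Var vn)) = 2 ^ n" if "J X s'" for X s'
        using genv_same[OF g, of check_vars s'] that by (simp add: J_def genv_def)
    next
      fix X s2 assume X: "X < 2 ^ n" and J: "J X s2" and vX: "s2 vX 0 = X"
      have sm: "same check_vars s s2" using J by (simp add: J_def)
      have e: "s2 dout = s dout" "s2 din = s din" "s2 vu = s vu" "s2 vv = s vv" using sameD[OF sm] by auto
      have "tr CheckSet s2 k_set (\<lambda>s'. same (check_vars - {vX}) s2 s' \<and>
        (s' flag 0 \<noteq> 0 \<longleftrightarrow> s2 flag 0 \<noteq> 0 \<and> good_set (s2 dout) (s2 din) u v (mset_of X)))"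
        by (rule tr_CheckSet[OF genv_same[OF g sm] vX X]) (use uv M in \<open>auto simp: e\<close>)
      then show "tr CheckSet s2 k_set (\<lambda>s'. s' vX 0 = X \<and> J (Suc X) (upd s' vX 0 (Suc X)))"
      proof (rule tr_conseq, goal_cases)
        case (2 s3)
        have "same check_vars s s3" by (rule same_trans[OF sm conjunct1[OF 2]]) auto
        moreover have "s3 vX 0 = X" using sameD[OF conjunct1[OF 2], of vX] vX by simp
        ultimately show ?case using 2 J by (auto simp: J_def e less_Suc_eq)
      qed simp
    next
      fix s' assume J: "J (2 ^ n) s'"
      have "(\<forall>X'<2 ^ n. good_set (s dout) (s din) u v (mset_of X')) \<longleftrightarrow>
          (\<forall>S\<in>mset_of ` {..<2 ^ n}. good_set (s dout) (s din) u v S)" by auto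
      \<comment> \<open>The codes below \<open>2 ^ n\<close> run through all vertex sets, here
        including those with the last vertex.\<close>
      also have "mset_of ` {..<2 ^ n} = Pow {..<n}" using bij_mset_of by (rule bij_betw_imp_surj_on)
      finally show "same check_vars s s' \<and> (s' flag 0 \<noteq> 0 \<longleftrightarrow> reducible V E (s dout) (s din) u v)"
        using J by (auto simp: J_def reducible_def good_set_def P0_def)
    qed
  qed
qed

text \<open>\<open>P\<close> collects the arcs along which no further lowering is possible. It can
  only grow, because of \<open>reducible_dec\<close>.\<close>

definition kernel_inv :: "store \<Rightarrow> nat rel \<Rightarrow> store \<Rightarrow> bool" where
  "kernel_inv s P s' \<longleftrightarrow> same (check_vars \<union> {vu, vv, dout, din}) s s' \<and>
     (conn_flow V E (s' dout) (s' din) \<longleftrightarrow> conn_flow V E (s dout) (s din)) \<and>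
     (\<forall>x<n. s' dout x \<le> M \<and> s' din x \<le> M) \<and>
     (\<forall>(u, v)\<in>P. \<not> reducible V E (s' dout) (s' din) u v)"

lemma kernel_inv_same:
  "kernel_inv s P s' \<Longrightarrow> same (check_vars \<union> {vu, vv}) s' s'' \<Longrightarrow> kernel_inv s P s''"
  unfolding kernel_inv_def
  using same_trans[of "check_vars \<union> {vu, vv, dout, din}" s s' "check_vars \<union> {vu, vv}" s'' "check_vars \<union> {vu, vv, dout, din}"]
    sameD[of "check_vars \<union> {vu, vv}" s' s'' dout] sameD[of "check_vars \<union> {vu, vv}" s' s'' din]
  by auto

definition k_reduce :: nat where
  "k_reduce = 1 + ((M + 1) * ((k_check + 3) + 1) + 1)"

lemma tr_Reduce:
  assumes g: "genv s0" and inv: "kernel_inv s0 P s" and uv: "s vu 0 = u" "s vv 0 = v" "(u, v) \<in> E"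
  shows "tr Reduce s k_reduce (\<lambda>s'. s' vu 0 = u \<and> s' vv 0 = v \<and> kernel_inv s0 (insert (u, v) P) s')"
proof -
  have un: "u < n" "v < n" using uv E by auto
  \<comment> \<open>The flag is counted in the variant: it pays for the last check, which lowers no
    degree and only clears the flag.\<close>
  define J where "J t s' \<longleftrightarrow> kernel_inv s0 P s' \<and> s' vu 0 = u \<and> s' vv 0 = v \<and>
    t = s' dout u + of_bool (s' flag 0 \<noteq> 0) \<and>
    (s' flag 0 = 0 \<longrightarrow> \<not> reducible V E (s' dout) (s' din) u v)" for t and s' :: store
  define t where "t = s dout u + 1"
  have t: "t \<le> M + 1" using inv un by (auto simp: t_def kernel_inv_def)
  have "tr (While (Var flag) (Seq Check (Cond (Var flag)
     (Seq (Assign dout (Var vu) (Sub (Cell dout (Var vu)) (Num 1)))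
          (Assign din (Var vv) (Sub (Cell din (Var vv)) (Num 1)))) Skip))) (upd s flag 0 1)
     (t * ((k_check + 3) + 1) + 1) (\<lambda>s'. s' vu 0 = u \<and> s' vv 0 = v \<and> kernel_inv s0 (insert (u, v) P) s')"
  proof (rule tr_while[where J = J])
    have "kernel_inv s0 P (upd s flag 0 1)" by (rule kernel_inv_same[OF inv]) simp
    then show "J t (upd s flag 0 1)" using uv by (simp add: J_def t_def)
  next
    fix t s1 assume J: "J t s1" and "val s1 (Var flag) \<noteq> 0"
    then have t: "t = s1 dout u + 1" by (simp add: J_def)
    have inv1: "kernel_inv s0 P s1" and uv1: "s1 vu 0 = u" "s1 vv 0 = v" using J by (auto simp: J_def)
    have g1: "genv s1" using inv1 genv_same[OF g] by (auto simp: kernel_inv_def)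
    have M1: "s1 dout x \<le> M" "s1 din x \<le> M" if "x < n" for x using inv1 that by (auto simp: kernel_inv_def)
    have chk: "tr Check s1 k_check (\<lambda>s'. same check_vars s1 s' \<and>
        (s' flag 0 \<noteq> 0 \<longleftrightarrow> reducible V E (s1 dout) (s1 din) u v))"
      by (rule tr_Check[OF g1 uv1 un]) (fact M1)+
    show "tr (Seq Check (Cond (Var flag)
     (Seq (Assign dout (Var vu) (Sub (Cell dout (Var vu)) (Num 1)))
          (Assign din (Var vv) (Sub (Cell din (Var vv)) (Num 1)))) Skip)) s1 (k_check + 3) (\<lambda>s'. \<exists>t'<t. J t' s')"
    proof (rule tr_call[OF chk], elim conjE)
      fix s2 assume sm: "same check_vars s1 s2"
        and fl: "s2 flag 0 \<noteq> 0 \<longleftrightarrow> reducible V E (s1 dout) (s1 din) u v"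
      have e: "s2 dout = s1 dout" "s2 din = s1 din" "s2 vu = s1 vu" "s2 vv = s1 vv" using sameD[OF sm] by auto
      have inv2: "kernel_inv s0 P s2" by (rule kernel_inv_same[OF inv1 same_mono[OF sm]]) auto
      have "tr (Cond (Var flag) (Seq (Assign dout (Var vu) (Sub (Cell dout (Var vu)) (Num 1)))
          (Assign din (Var vv) (Sub (Cell din (Var vv)) (Num 1)))) Skip) s2 ((1 + 1) + 1) (\<lambda>s'. \<exists>t'<t. J t' s')"
      proof (rule tr_cond)
        assume "val s2 (Var flag) \<noteq> 0"
        then have red: "reducible V E (s1 dout) (s1 din) u v" and flag: "s2 flag 0 \<noteq> 0" using fl by auto
        define s3 where "s3 = s2(dout := dec (s1 dout) u, din := dec (s1 din) v)"
        have pos: "0 < s1 dout u" "0 < s1 din v" using red by (auto simp: reducible_def)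
        have fin: "finite V" by simp
        have "conn_flow V E (dec (s1 dout) u) (dec (s1 din) v) \<longleftrightarrow> conn_flow V E (s1 dout) (s1 din)"
          using conn_flow_dec[OF _ E uv(3) red]
            conn_flow_inc[where a = "s1 dout" and b = "s1 din", OF _ _ _ uv(3) pos] un by blast
        moreover have "\<not> reducible V E (dec (s1 dout) u) (dec (s1 din) v) x y"
          if "\<not> reducible V E (s1 dout) (s1 din) x y" for x y
          using reducible_dec[where a = "s1 dout" and b = "s1 din", OF _ E uv(3) pos] that by blast
        moreover have "same (check_vars \<union> {vu, vv, dout, din}) s0 s3"
          using inv2 by (auto simp: s3_def kernel_inv_def)
        moreover have "s3 dout x \<le> M \<and> s3 din x \<le> M" if "x < n" for x
          using M1[OF that] by (auto simp: s3_def)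
        moreover have "s3 dout = dec (s1 dout) u" "s3 din = dec (s1 din) v" by (simp_all add: s3_def)
        ultimately have "kernel_inv s0 P s3"
          using inv1 unfolding kernel_inv_def by (metis (no_types, lifting) case_prodD case_prodI2)
        then have "J (s1 dout u - 1 + 1) s3"
          using uv1 flag by (auto simp: J_def s3_def e)
        then have ex: "\<exists>t'<t. J t' s3" using t pos by (intro exI[of _ "s1 dout u - 1 + 1"]) auto
        have MB: "x \<le> M \<Longrightarrow> x < 2 ^ B" for x
        proof -
          assume "x \<le> M"
          moreover have "M \<le> n * M" using n by simp
          ultimately show ?thesis using sum_less by linarith
        qed
        have 1: "tr (Assign din (Var vv) (Sub (Cell din (Var vv)) (Num 1))) (s2(dout := dec (s1 dout) u)) 1 (\<lambda>s'. \<exists>t'<t. J t' s')"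
        proof (rule tr_assign)
          show "val (s2(dout := dec (s1 dout) u)) (Var vv) < I" using e uv1 un nI by simp
          show "val (s2(dout := dec (s1 dout) u)) (Sub (Cell din (Var vv)) (Num 1)) < 2 ^ B"
            using M1(2)[OF un(2)] e uv1 by (auto intro!: MB)
          show "\<exists>t'<t. J t' (upd (s2(dout := dec (s1 dout) u)) din (val (s2(dout := dec (s1 dout) u)) (Var vv))
            (val (s2(dout := dec (s1 dout) u)) (Sub (Cell din (Var vv)) (Num 1))))"
            using ex e uv1 by (simp add: s3_def)
        qed
        show "tr (Seq (Assign dout (Var vu) (Sub (Cell dout (Var vu)) (Num 1)))
          (Assign din (Var vv) (Sub (Cell din (Var vv)) (Num 1)))) s2 (1 + 1) (\<lambda>s'. \<exists>t'<t. J t' s')"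
        proof (rule tr_seq, rule tr_assign)
          show "val s2 (Var vu) < I" using e uv1 un nI by simp
          show "val s2 (Sub (Cell dout (Var vu)) (Num 1)) < 2 ^ B"
            using M1(1)[OF un(1)] e uv1 by (auto intro!: MB)
        qed (use 1 e uv1 in simp)
      next
        assume "val s2 (Var flag) = 0"
        then have "J (s1 dout u) s2" using inv2 fl uv1 by (simp add: J_def e)
        then have "\<exists>t'<t. J t' s2" using t by (intro exI[of _ "s1 dout u"]) simp
        from tr_skip[of "\<lambda>s'. \<exists>t'<t. J t' s'", OF this]
        show "tr Skip s2 (1 + 1) (\<lambda>s'. \<exists>t'<t. J t' s')" by (rule tr_conseq) auto
      qed
      then show "tr (Cond (Var flag) (Seq (Assign dout (Var vu) (Sub (Cell dout (Var vu)) (Num 1)))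
          (Assign din (Var vv) (Sub (Cell din (Var vv)) (Num 1)))) Skip) s2 3 (\<lambda>s'. \<exists>t'<t. J t' s')"
        by (rule tr_conseq) auto
    qed
  next
    fix t s' assume "J t s'" "val s' (Var flag) = 0"
    then show "s' vu 0 = u \<and> s' vv 0 = v \<and> kernel_inv s0 (insert (u, v) P) s'"
      by (auto simp: J_def kernel_inv_def)
  qed
  then have "tr Reduce s (1 + (t * ((k_check + 3) + 1) + 1))
      (\<lambda>s'. s' vu 0 = u \<and> s' vv 0 = v \<and> kernel_inv s0 (insert (u, v) P) s')"
    unfolding Reduce_def using I by (intro tr_set) (auto intro: bit_less_B)
  then show ?thesis
  proof (rule tr_conseq)
    have "t * ((k_check + 3) + 1) \<le> (M + 1) * ((k_check + 3) + 1)" using t by (rule mult_le_mono1)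
    then show "1 + (t * ((k_check + 3) + 1) + 1) \<le> k_reduce" by (simp add: k_reduce_def)
  qed
qed

definition k_kernel :: nat where
  "k_kernel = kfor n (kfor n (k_reduce + 1))"

lemma tr_Kernel:
  assumes g: "genv s" and M: "\<And>x. x < n \<Longrightarrow> s dout x \<le> M" "\<And>x. x < n \<Longrightarrow> s din x \<le> M"
  shows "tr Kernel s k_kernel (kernel_inv s E)"
proof -
  \<comment> \<open>Arcs before \<open>(u, v)\<close> in lexicographic order, the order of the two
    loops.\<close>
  define P where "P u v = {(u', v')\<in>E. u' < u \<or> u' = u \<and> v' < v}" for u v
  have P0: "P 0 0 = {}" by (auto simp: P_def)
  have Pn: "P u n = P (Suc u) 0" for u using E by (auto simp: P_def less_Suc_eq)
  have PE: "P n 0 = E" using E by (auto simp: P_def)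
  have PS: "P u (Suc v) \<subseteq> insert (u, v) (P u v)" for u v by (auto simp: P_def less_Suc_eq)
  have PSn: "P u (Suc v) = P u v" if "(u, v) \<notin> E" for u v using that by (auto simp: P_def less_Suc_eq)
  have mono: "kernel_inv s Q s' \<Longrightarrow> Q' \<subseteq> Q \<Longrightarrow> kernel_inv s Q' s'" for Q Q' s'
    by (auto simp: kernel_inv_def)
  have upd: "kernel_inv s Q (upd s' x 0 m)" if "kernel_inv s Q s'" "x \<in> {vu, vv}" for Q s' x m
    using that(2) by (intro kernel_inv_same[OF that(1)]) auto
  define J where "J u s' \<longleftrightarrow> kernel_inv s (P u 0) s'" for u s'
  define J' where "J' u v s' \<longleftrightarrow> kernel_inv s (P u v) s' \<and> s' vu 0 = u" for u v s'
  have g': "genv s'" if "kernel_inv s Q s'" for Q s'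
    using that genv_same[OF g] by (auto simp: kernel_inv_def)
  show ?thesis
    unfolding Kernel_def k_kernel_def
  proof (rule tr_for[where J = J])
    have "kernel_inv s {} s" using M by (simp add: kernel_inv_def)
    then show "J 0 (upd s vu 0 0)" unfolding J_def P0 by (intro upd) auto
    show "val s' (Var vn) = n" if "J u s'" for u s' using g' that by (auto simp: J_def genv_def)
  next
    fix u s1 assume u: "u < n" and J: "J u s1" and vu: "s1 vu 0 = u"
    show "tr (For vv (Var vn) (Cond (Cell adj (Add (Mul (Var vu) (Var vn)) (Var vv))) Reduce Skip)) s1
        (kfor n (k_reduce + 1)) (\<lambda>s'. s' vu 0 = u \<and> J (Suc u) (upd s' vu 0 (Suc u)))"
    proof (rule tr_for[where J = "J' u"])
      show "J' u 0 (upd s1 vv 0 0)" using J vu upd by (simp add: J_def J'_def)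
      show "val s' (Var vn) = n" if "J' u v s'" for v s' using g' that by (auto simp: J'_def genv_def)
    next
      fix v s2 assume v: "v < n" and J': "J' u v s2" and vv: "s2 vv 0 = v"
      have inv: "kernel_inv s (P u v) s2" and vu2: "s2 vu 0 = u" using J' by (auto simp: J'_def)
      have c: "val s2 (Cell adj (Add (Mul (Var vu) (Var vn)) (Var vv))) \<noteq> 0 \<longleftrightarrow> (u, v) \<in> E"
        using g'[OF inv] u v vu2 vv by (simp add: genv_def)
      show "tr (Cond (Cell adj (Add (Mul (Var vu) (Var vn)) (Var vv))) Reduce Skip) s2 (k_reduce + 1)
          (\<lambda>s'. s' vv 0 = v \<and> J' u (Suc v) (upd s' vv 0 (Suc v)))"
      proof (rule tr_cond)
        assume "val s2 (Cell adj (Add (Mul (Var vu) (Var vn)) (Var vv))) \<noteq> 0"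
        then have "(u, v) \<in> E" using c by simp
        from tr_Reduce[OF g inv vu2 vv this]
        show "tr Reduce s2 k_reduce (\<lambda>s'. s' vv 0 = v \<and> J' u (Suc v) (upd s' vv 0 (Suc v)))"
        proof (rule tr_conseq, goal_cases)
          case (2 s')
          have "kernel_inv s (P u (Suc v)) s'" using 2 mono[OF _ PS] by blast
          then show ?case using 2 upd by (simp add: J'_def)
        qed simp
      next
        assume "val s2 (Cell adj (Add (Mul (Var vu) (Var vn)) (Var vv))) = 0"
        then have "P u (Suc v) = P u v" using c PSn by auto
        then have "s2 vv 0 = v \<and> J' u (Suc v) (upd s2 vv 0 (Suc v))" using J' vv upd by (simp add: J'_def)
        from tr_skip[of "\<lambda>s'. s' vv 0 = v \<and> J' u (Suc v) (upd s' vv 0 (Suc v))", OF this]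
        show "tr Skip s2 k_reduce (\<lambda>s'. s' vv 0 = v \<and> J' u (Suc v) (upd s' vv 0 (Suc v)))"
          by (rule tr_conseq) (auto simp: k_reduce_def)
      qed
    next
      fix s' assume "J' u n s'"
      then show "s' vu 0 = u \<and> J (Suc u) (upd s' vu 0 (Suc u))" using upd by (simp add: J_def J'_def Pn)
    qed (rule nB)
  next
    fix s' assume "J n s'"
    then show "kernel_inv s E s'" by (simp add: J_def PE)
  qed (rule nB)
qed

section \<open>Listing the slots\<close>

definition slots_inv :: "(nat \<Rightarrow> nat) \<Rightarrow> nat \<Rightarrow> (nat \<Rightarrow> nat) \<Rightarrow> bool" where
  "slots_inv c T w \<longleftrightarrow> (\<forall>r<T. w r < n) \<and> (\<forall>u<n. card {r. r < T \<and> w r = u} = c u)"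

lemma slots_inv_step:
  assumes "slots_inv c T w" "u < n"
  shows "slots_inv (c(u := c u + 1)) (Suc T) (w(T := u))"
  unfolding slots_inv_def
proof (intro conjI allI impI)
  fix r assume "r < Suc T"
  then show "(w(T := u)) r < n" using assms by (auto simp: slots_inv_def less_Suc_eq)
next
  fix x assume x: "x < n"
  have "{r. r < Suc T \<and> (w(T := u)) r = x} = {r. r < T \<and> w r = x} \<union> (if x = u then {T} else {})"
    by (auto simp: less_Suc_eq)
  then have "card {r. r < Suc T \<and> (w(T := u)) r = x} = card {r. r < T \<and> w r = x} + of_bool (x = u)"
    by (auto simp: card_insert_if)
  then show "card {r. r < Suc T \<and> (w(T := u)) r = x} = (c(u := c u + 1)) x"
    using assms x by (auto simp: slots_inv_def)
qed

lemma tr_Slots: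
  assumes vn: "s vn 0 = n" and sd: "src \<notin> {dst, vt, vu, vv}" "dst \<notin> {vn, vt, vu, vv}"
    and N: "(\<Sum>u<n. s src u) = N" "N \<le> I"
  shows "tr (Slots src dst) s (1 + kfor n (kfor N 2)) (\<lambda>s'. same {dst, vt, vu, vv} s s' \<and> slots_inv (s src) N (s' dst))"
proof -
  define T where "T u = (\<Sum>u'<u. s src u')" for u
  \<comment> \<open>Slots listed so far for each vertex: all of them before \<open>u\<close>, and
    \<open>v\<close> of them at \<open>u\<close>.\<close>
  define c where "c u v = (\<lambda>x. if x < u then s src x else if x = u then v else 0)" for u v :: nat
  define J where "J u s' \<longleftrightarrow> same {dst, vt, vu, vv} s s' \<and> s' vt 0 = T u \<and> slots_inv (c u 0) (T u) (s' dst)"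
    for u and s' :: store
  define J' where "J' u v s' \<longleftrightarrow> same {dst, vt, vu, vv} s s' \<and> s' vu 0 = u \<and> s' vt 0 = T u + v \<and>
    slots_inv (c u v) (T u + v) (s' dst)" for u v and s' :: store
  have fr: "s' vn = s vn" "s' src = s src" if "same {dst, vt, vu, vv} s s'" for s'
    using sameD[OF that, of vn] sameD[OF that, of src] sd by simp_all
  have TN: "T u + s src u \<le> N" if "u < n" for u
  proof -
    have "(\<Sum>u'<Suc u. s src u') \<le> (\<Sum>u'<n. s src u')" using that by (intro sum_mono2) auto
    then show ?thesis using N by (simp add: T_def)
  qed
  have "tr (For vu (Var vn) (For vv (Cell src (Var vu))
     (Seq (Assign dst (Var vt) (Var vu)) (Set vt (Add (Var vt) (Num 1)))))) (upd s vt 0 0)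
     (kfor n (kfor N 2)) (\<lambda>s'. same {dst, vt, vu, vv} s s' \<and> slots_inv (s src) N (s' dst))"
  proof (rule tr_for[where J = J])
    have "slots_inv (c 0 0) 0 (s dst)" by (simp add: slots_inv_def c_def)
    then show "J 0 (upd (upd s vt 0 0) vu 0 0)" using sd by (simp add: J_def T_def)
    show "val s' (Var vn) = n" if "J u s'" for u s' using that fr(1)[of s'] vn by (simp add: J_def)
  next
    fix u s1 assume u: "u < n" and J: "J u s1" and vu: "s1 vu 0 = u"
    have "tr (For vv (Cell src (Var vu)) (Seq (Assign dst (Var vt) (Var vu)) (Set vt (Add (Var vt) (Num 1))))) s1
      (kfor (s src u) 2) (\<lambda>s'. s' vu 0 = u \<and> J (Suc u) (upd s' vu 0 (Suc u)))"
    proof (rule tr_for[where J = "J' u"])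
      have ne: "vv \<noteq> dst" "vu \<noteq> dst" using sd by auto
      have "same {dst, vt, vu, vv} s (upd s1 vv 0 0)" using J by (simp add: J_def)
      moreover have "(upd s1 vv 0 0) vu 0 = u" "(upd s1 vv 0 0) vt 0 = T u" "(upd s1 vv 0 0) dst = s1 dst"
        using J vu ne by (simp_all add: J_def)
      moreover have "slots_inv (c u 0) (T u) (s1 dst)" using J by (simp only: J_def)
      ultimately show "J' u 0 (upd s1 vv 0 0)" by (simp only: J'_def add_0_right)
      show "val s' (Cell src (Var vu)) = s src u" if "J' u v s'" for v s'
        using that fr(2)[of s'] by (simp add: J'_def)
      show "s src u < 2 ^ B" using TN[OF u] N by (intro less_B) simp
    next
      fix v s2 assume v: "v < s src u" and J': "J' u v s2" and vv: "s2 vv 0 = v"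
      have Tv: "T u + v < N" using TN[OF u] v by simp
      have "slots_inv ((c u v)(u := c u v u + 1)) (Suc (T u + v)) ((s2 dst)(T u + v := u))"
        using J' u by (intro slots_inv_step) (auto simp: J'_def)
      moreover have "(c u v)(u := c u v u + 1) = c u (Suc v)" by (auto simp: c_def)
      ultimately have si: "slots_inv (c u (Suc v)) (Suc (T u + v)) ((s2 dst)(T u + v := u))" by simp
      define s3 where "s3 = upd s2 dst (T u + v) u"
      have "tr (Set vt (Add (Var vt) (Num 1))) s3 1 (\<lambda>s'. s' vv 0 = v \<and> J' u (Suc v) (upd s' vv 0 (Suc v)))"
      proof (rule tr_assign)
        show "val s3 (Add (Var vt) (Num 1)) < 2 ^ B"
          using J' sd Tv N by (intro less_B) (simp add: J'_def s3_def)
      qed (use J' vv sd si I in \<open>simp_all add: J'_def s3_def\<close>)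
      moreover have "u < 2 ^ B" using u nI by (intro less_B) simp
      moreover have "T u + v < I" using Tv N by simp
      moreover have "s2 vt 0 = T u + v" "s2 vu 0 = u" using J' by (simp_all add: J'_def)
      ultimately have "tr (Seq (Assign dst (Var vt) (Var vu)) (Set vt (Add (Var vt) (Num 1)))) s2 (1 + 1)
          (\<lambda>s'. s' vv 0 = v \<and> J' u (Suc v) (upd s' vv 0 (Suc v)))"
        by (intro tr_call[OF tr_assign[where Q = "\<lambda>s'. s' = s3"]]) (simp_all add: s3_def)
      then show "tr (Seq (Assign dst (Var vt) (Var vu)) (Set vt (Add (Var vt) (Num 1)))) s2 2
          (\<lambda>s'. s' vv 0 = v \<and> J' u (Suc v) (upd s' vv 0 (Suc v)))"
        by (rule tr_conseq) auto
    next
      fix s' assume J': "J' u (s src u) s'"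
      have "c u (s src u) = c (Suc u) 0" by (auto simp: c_def fun_eq_iff less_Suc_eq)
      moreover have "T u + s src u = T (Suc u)" by (simp add: T_def)
      ultimately show "s' vu 0 = u \<and> J (Suc u) (upd s' vu 0 (Suc u))" using J' sd by (simp add: J_def J'_def)
    qed
    then show "tr (For vv (Cell src (Var vu)) (Seq (Assign dst (Var vt) (Var vu)) (Set vt (Add (Var vt) (Num 1))))) s1
      (kfor N 2) (\<lambda>s'. s' vu 0 = u \<and> J (Suc u) (upd s' vu 0 (Suc u)))"
    \<comment> \<open>The inner loops together make \<open>N\<close> rounds; bounding each of them
      by \<open>N\<close> is coarse but still polynomial.\<close>
    proof (rule tr_conseq)
      show "kfor (s src u) 2 \<le> kfor N 2" using TN[OF u] by simp
    qed
  next
    fix s' assume "J n s'"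
    then show "same {dst, vt, vu, vv} s s' \<and> slots_inv (s src) N (s' dst)"
      using N by (simp add: J_def T_def slots_inv_def c_def)
  qed (rule nB)
  then show ?thesis unfolding Slots_def using I by (intro tr_set) auto
qed

end

section \<open>The whole program\<close>

definition Prep :: com where
  "Prep = Seq Powers (Seq Kernel (Seq (SumLoop vx vN (Cell dout (Var vx))) (SumLoop vx vN' (Cell din (Var vx)))))"

text \<open>With \<open>k = N + c\<close> random bits per pair of slots the error
  \<open>N / 2 ^ k\<close> is at most \<open>1 / 2 ^ c\<close>, because
  \<open>N \<le> 2 ^ N\<close>.\<close>

definition Setup :: "nat \<Rightarrow> com" where
  "Setup c = Seq (Slots dout vra) (Seq (Slots din vca) (Seq (Set vk (Add (Var vN) (Num c)))
     (Seq (Set vD (Add (Mul (Var vN) (Var vk)) (Num 1))) (Set vL (Mul (Add (Var vN) (Num 1)) (Var vD))))))"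

definition Flips :: com where
  "Flips = For vf (Mul (Mul (Var vN) (Var vN)) (Var vk)) (Flip rnd (Var vf))"

text \<open>The two tests reject only unsolvable instances: a flow has equal totals, and after the
  reduction a solvable instance has total at most \<open>n ^ 3\<close>. The second test also keeps
  the slots within the space bound when the instance is unsolvable. The answer cell is initially 0,
  so \<open>Skip\<close> rejects.\<close>

definition Prog :: "nat \<Rightarrow> com" where
  "Prog c = Seq Prep (Cond (EqE (Var vN) (Var vN'))
     (Cond (Sub (Add (Mul (Mul (Var vn) (Var vn)) (Var vn)) (Num 1)) (Var vN))
       (Seq (Setup c) (Seq Flips Decide)) Skip) Skip)"

section \<open>Counting operations\<close>

context machine begin

text \<open>Coarse bookkeeping: the exponent \<open>j\<close> grows by one with every loop of at
  most \<open>I\<close> rounds and with every sequential composition, while \<open>W\<close>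
  collects the factors \<open>2 ^ n\<close> and \<open>M + 1\<close>. The 2 on the left absorbs the
  overhead of \<open>For\<close>.\<close>

definition lim :: "nat \<Rightarrow> nat \<Rightarrow> nat \<Rightarrow> bool" where
  "lim W j k \<longleftrightarrow> k + 2 \<le> W * (I + 4) ^ j"

lemma lim_bump:
  assumes "lim W j k" "W \<le> W'" "j \<le> j'"
  shows "lim W' j' k"
proof -
  have "(I + 4) ^ j \<le> (I + 4) ^ j'" using assms(3) by (intro power_increasing) auto
  then have "W * (I + 4) ^ j \<le> W' * (I + 4) ^ j'" using assms(2) by (intro mult_le_mono)
  then show ?thesis using assms(1) unfolding lim_def by linarith
qed

text \<open>For loops whose number of rounds is not bounded by \<open>I\<close>, such as the
  enumeration of vertex sets.\<close>

lemma lim_mult: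
  assumes "lim W j k" "a \<le> A" "1 \<le> A"
  shows "lim (A * W) (Suc j) (a * (k + 2) + 2)"
proof -
  let ?Y = "W * (I + 4) ^ j"
  let ?Z = "A * ?Y"
  have Y: "k + 2 \<le> ?Y" using assms(1) by (simp only: lim_def)
  have "a * (k + 2) \<le> ?Z" using assms(2) Y by (intro mult_le_mono)
  moreover have "1 * 1 \<le> ?Z" using assms(3) Y by (intro mult_le_mono) linarith+
  ultimately have "a * (k + 2) + 2 + 2 \<le> 5 * ?Z" by linarith
  also have "\<dots> \<le> (I + 4) * ?Z" using I by (intro mult_le_mono1) simp
  also have "(I + 4) * ?Z = A * W * (I + 4) ^ Suc j" by (simp only: power_Suc mult_ac)
  finally show ?thesis unfolding lim_def .
qed

lemma lim_for:
  assumes "lim W j k" "a \<le> I"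
  shows "lim W (Suc j) (a * (k + 2) + 2)"
proof -
  let ?Y = "W * (I + 4) ^ j"
  have Y: "k + 2 \<le> ?Y" using assms(1) by (simp only: lim_def)
  have "a * (k + 2) \<le> I * ?Y" using assms(2) Y by (intro mult_le_mono)
  then have "a * (k + 2) + 2 + 2 \<le> I * ?Y + 4 * ?Y" using Y by linarith
  also have "\<dots> = W * (I + 4) ^ Suc j" by (simp only: power_Suc distrib_right mult_ac distrib_left)
  finally show ?thesis unfolding lim_def .
qed

lemma lim_add:
  assumes "lim W i k" "lim W j k'"
  shows "lim W (Suc (max i j)) (k + k')"
proof -
  let ?Z = "W * (I + 4) ^ max i j"
  have "lim W (max i j) k" "lim W (max i j) k'" using assms by (auto intro: lim_bump)
  then have "k + k' + 2 \<le> 5 * ?Z" unfolding lim_def by linarith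
  also have "\<dots> \<le> (I + 4) * ?Z" using I by (intro mult_le_mono1) simp
  also have "\<dots> = W * (I + 4) ^ Suc (max i j)" by (simp only: power_Suc mult_ac)
  finally show ?thesis unfolding lim_def .
qed

lemma lim_const: "k \<le> 3 \<Longrightarrow> lim 1 1 k"
  using I by (simp add: lim_def)

end

context det_machine begin

lemma lim_det: "lim 1 14 k_det"
proof -
  have one: "lim 1 1 1" by (rule lim_const) simp
  have copy: "lim 1 4 k_copy" unfolding k_copy_def
    by (rule lim_bump[OF lim_add[OF one lim_add[OF one lim_for[OF one NL(2)]]]]) simp_all
  have muladd: "lim 1 6 k_muladd" unfolding k_muladd_def
    by (rule lim_bump[OF lim_add[OF one lim_add[OF one lim_add[OF one lim_for[OF lim_for[OF one NL(2)] NL(2)]]]]]) simp_all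
  have row: "lim 1 8 k_row" unfolding k_row_def k_copy_def[symmetric] k_muladd_def[symmetric]
    by (rule lim_bump[OF lim_add[OF copy lim_for[OF muladd NL(1)]]]) simp_all
  have elim: "lim 1 12 k_elim" unfolding k_elim_def
    by (rule lim_bump[OF lim_for[OF lim_for[OF lim_add[OF lim_for[OF row NL(1)] one] NL(1)] NL(1)]]) simp_all
  have prod: "lim 1 10 k_prod" unfolding k_prod_def
    by (rule lim_bump[OF lim_add[OF copy lim_for[OF lim_add[OF copy lim_add[OF muladd copy]] NL(1)]]]) simp_all
  have "4 * 4 \<le> (I + 4) * (I + 4)" by (intro mult_le_mono) simp_all
  then have six: "lim 1 2 6" unfolding lim_def power2_eq_square by linarith
  show ?thesis unfolding k_det_def
    by (rule lim_bump[OF lim_add[OF lim_for[OF six NL(3)] lim_add[OF elim lim_add[OF prod muladd]]]]) simp_all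
qed

lemma lim_decide: "lim (2 ^ n) 17 k_decide"
proof -
  have le: "(2::nat) ^ (n - 1) \<le> 2 ^ n" by (rule power_increasing) auto
  have one: "lim (2 ^ n) 1 1" by (rule lim_bump[OF lim_const]) simp_all
  have two: "lim (2 ^ n) 1 2" by (rule lim_bump[OF lim_const]) simp_all
  have det: "lim (2 ^ n) 15 (2 ^ (n - 1) * (k_det + 2) + 2)"
    by (rule lim_bump[OF lim_mult[OF lim_det le]]) simp_all
  show ?thesis unfolding k_decide_def
    by (rule lim_bump[OF lim_add[OF one lim_add[OF det lim_for[OF two NL(2)]]]]) simp_all
qed

definition k_flips :: nat where "k_flips = kfor (N * N * k) 1"

lemma tr_Flips:
  assumes env: "env s"
  shows "tr Flips s k_flips (\<lambda>s'. env s' \<and> same {rnd, vf} s s')"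
proof -
  define J where "J i s' \<longleftrightarrow> same {rnd, vf} s s' \<and> (\<forall>i. s' rnd i \<le> 1)" for i :: nat and s' :: store
  have fr: "s' vN = s vN" "s' vk = s vk" if "same {rnd, vf} s s'" for s' using sameD[OF that] by auto
  show ?thesis
    unfolding Flips_def k_flips_def
  proof (rule tr_for[where J = J])
    show "J 0 (upd s vf 0 0)" using env by (simp add: J_def env_def)
    show "N * N * k < 2 ^ B" by (rule less_B) (rule NNk)
    show "val s' (Mul (Mul (Var vN) (Var vN)) (Var vk)) = N * N * k" if "J i s'" for i s'
      using that fr[of s'] env_vals[OF env] by (simp add: J_def)
  next
    fix i s' assume i: "i < N * N * k" and J: "J i s'" and vf: "s' vf 0 = i"
    have "J (Suc i) (upd (upd s' rnd i (of_bool b)) vf 0 (Suc i))" for b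
      using J by (simp add: J_def)
    then show "tr (Flip rnd (Var vf)) s' 1 (\<lambda>s'. s' vf 0 = i \<and> J (Suc i) (upd s' vf 0 (Suc i)))"
      using i NNk vf by (intro tr_flip) auto
  next
    fix s' assume J: "J (N * N * k) s'"
    have "s' x = s x" if "x \<notin> {rnd, vf}" for x using J that by (simp add: J_def same_def)
    then have "s' vn = s vn" "s' adj = s adj" "s' pw = s pw" "s' vN = s vN" "s' vk = s vk" "s' vD = s vD"
      "s' vL = s vL" "s' vra = s vra" "s' vca = s vca" by simp_all
    then show "env s' \<and> same {rnd, vf} s s'" using env J by (simp add: env_def J_def)
  qed
qed

lemma lim_flips: "lim 1 2 k_flips"
  unfolding k_flips_def by (rule lim_bump[OF lim_for[OF lim_const NNk]]) simp_all

text \<open>\<open>prob_flips\<close> turns the probability into a count of bit sets, and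
  \<open>card_bad_bits\<close> bounds the bad ones. A permutation addresses only bits below
  \<open>N * N * k\<close>, all of which are freshly drawn.\<close>

lemma prob_Flips:
  assumes env: "env s" and c: "store cf = s"
    and perms: "conn_perms N (s vra) (s vca) {..<n} E \<noteq> {}"
  shows "1 - N / 2 ^ k \<le> measure (measure_spmf (sem Flips cf)) {c. det_value (store c vra) (store c vca) (store c rnd) \<noteq> 0}"
proof -
  let ?P = "conn_perms N (s vra) (s vca) {..<n} E"
  let ?R = "\<lambda>S i. if i < N * N * k then of_bool (i \<in> S) else s rnd i"
  define Z where "Z S = (\<Sum>\<rho>\<in>?P. \<Prod>r<N. bits_poly k (\<lambda>d. (r * N + \<rho> r) * k + d \<in> S))" for S
  have P: "?P \<subseteq> {\<rho>. \<rho> permutes {..<N}}" by (auto simp: conn_perms_def)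
  have val: "det_value (s vra) (s vca) (?R S) = Z S" for S
    unfolding det_value_def rpoly_def Z_def
  proof (intro sum.cong prod.cong refl)
    fix \<rho> r assume "\<rho> \<in> ?P" and r: "r \<in> {..<N}"
    then have \<rho>: "\<rho> r < N" using P permutes_in_image[of \<rho> "{..<N}" r] by auto
    have "(r * N + \<rho> r) * k + d < N * N * k" if "d < k" for d
    proof (rule slot_index[OF that])
      have "r * N + \<rho> r + 1 \<le> N * N" using entry_less[of r "\<rho> r"] r \<rho> by simp
      then show "(r * N + \<rho> r + 1) * k \<le> N * N * k" by (rule mult_le_mono1)
    qed
    then show "bits_poly k (\<lambda>d. odd (?R S ((r * N + \<rho> r) * k + d))) = bits_poly k (\<lambda>d. (r * N + \<rho> r) * k + d \<in> S)"
      unfolding bits_poly_def by (intro sum.cong) auto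
  qed
  define m where "m = N * N * k"
  define g where "g = card {S \<in> Pow {..<m}. Z S \<noteq> 0}"
  define b where "b = card {S \<in> Pow {..<m}. Z S = 0}"
  have "g + b = card ({S \<in> Pow {..<m}. Z S \<noteq> 0} \<union> {S \<in> Pow {..<m}. Z S = 0})"
    unfolding g_def b_def by (rule card_Un_disjoint[symmetric]) auto
  also have "{S \<in> Pow {..<m}. Z S \<noteq> 0} \<union> {S \<in> Pow {..<m}. Z S = 0} = Pow {..<m}" by blast
  finally have gb: "g + b = 2 ^ m" by (simp add: card_Pow)
  have "b * 2 ^ k \<le> N * 2 ^ m" unfolding b_def m_def Z_def by (rule card_bad_bits[OF perms P])
  then have "real (b * 2 ^ k) \<le> real (N * 2 ^ m)" unfolding of_nat_le_iff .
  then have "real b / 2 ^ m \<le> real N / 2 ^ k" by (simp add: field_simps)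
  moreover have "real g + real b = 2 ^ m" using arg_cong[OF gb, of real] by simp
  then have "real g / 2 ^ m + real b / 2 ^ m = 1" by (simp flip: add_divide_distrib)
  moreover have "measure (measure_spmf (sem Flips cf)) {c. det_value (store c vra) (store c vca) (store c rnd) \<noteq> 0}
      = g / 2 ^ m"
    unfolding Flips_def g_def m_def
    by (subst prob_flips[where G = "\<lambda>s. det_value (s vra) (s vca) (s rnd) \<noteq> 0" and s = s and N = "N * N * k"])
      (use env_vals[OF env] c in \<open>simp_all add: val\<close>)
  ultimately show ?thesis by linarith
qed

end

section \<open>Correctness and error of the whole program\<close>

text \<open>The actual \<open>N\<close> is known only at run time; \<open>I\<close> is chosen for
  the largest admissible value \<open>n ^ 3\<close>.\<close>

locale main_machine = graph_machine +
  fixes c :: nat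
  assumes c: "1 \<le> c"
    and I_ge: "(let N = n ^ 3; k = N + c; D = N * k + 1; L = (N + 1) * D in
      (N * N + 6) * L + N * N * k + n * n + n + N + 2) \<le> I"
begin

text \<open>All parameters are monotone in \<open>N\<close>, so the room reserved for
  \<open>n ^ 3\<close> suffices for every smaller \<open>N\<close>.\<close>

lemma det_machine:
  assumes N: "N \<le> n ^ 3" and k: "k = N + c" and D: "D = N * k + 1" and L: "L = (N + 1) * D"
  shows "det_machine B I n N k D L"
proof -
  define N' where "N' = n ^ 3"
  define k' where "k' = N' + c"
  define D' where "D' = N' * k' + 1"
  define L' where "L' = (N' + 1) * D'"
  have NN': "N \<le> N'" using N by (simp add: N'_def)
  have "k \<le> k'" using N by (simp add: k k'_def N'_def)
  then have "D \<le> D'" using NN' mult_le_mono[of N N' k k'] by (simp add: D D'_def)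
  then have "L \<le> L'" using NN' unfolding L L'_def by (intro mult_le_mono) simp_all
  have NN: "N * N \<le> N' * N'" using NN' by (intro mult_le_mono)
  have "(N * N + 6) * L \<le> (N' * N' + 6) * L'" using NN \<open>L \<le> L'\<close> by (intro mult_le_mono) auto
  moreover have "N * N * k \<le> N' * N' * k'" by (rule mult_le_mono[OF NN \<open>k \<le> k'\<close>])
  moreover have "(N' * N' + 6) * L' + N' * N' * k' + n * n + n + N' + 2 \<le> I"
    using I_ge unfolding Let_def N'_def k'_def D'_def L'_def .
  ultimately have *: "(N * N + 6) * L \<le> I" "N * N * k \<le> I" by linarith+
  show ?thesis
    by unfold_locales (fact n D L * pw_less)+
qed

lemma k_le_I:
  assumes "N \<le> n ^ 3"
  shows "N + c \<le> I"
proof -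
  define N' where "N' = n ^ 3"
  define k' where "k' = N' + c"
  define L' where "L' = (N' + 1) * (N' * k' + 1)"
  have "1 * k' \<le> N' * k'" using n by (intro mult_le_mono1) (simp add: N'_def)
  also have "\<dots> \<le> 1 * (N' * k' + 1)" by simp
  also have "\<dots> \<le> L'" unfolding L'_def by (intro mult_le_mono1) simp
  also have "\<dots> \<le> 6 * L'" by simp
  also have "\<dots> \<le> (N' * N' + 6) * L'" by (intro mult_le_mono1) simp
  finally have "k' \<le> (N' * N' + 6) * L'" by simp
  moreover have "(N' * N' + 6) * L' + N' * N' * k' + n * n + n + N' + 2 \<le> I"
    using I_ge unfolding Let_def N'_def k'_def L'_def .
  ultimately show ?thesis using assms unfolding k'_def N'_def by linarith
qed

definition k_prep :: nat where
  "k_prep = (1 + kfor n 1) + (k_kernel + ((1 + kfor n 1) + (1 + kfor n 1)))"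

abbreviation prep_vars :: "nat set" where
  "prep_vars \<equiv> {pw, vx, vu, vv, dout, din, vN, vN'} \<union> check_vars"

definition prep_post :: "store \<Rightarrow> store \<Rightarrow> bool" where
  "prep_post s s' \<longleftrightarrow> same prep_vars s s' \<and> genv s' \<and>
     (conn_flow V E (s' dout) (s' din) \<longleftrightarrow> conn_flow V E (s dout) (s din)) \<and>
     (\<forall>(u, v)\<in>E. \<not> reducible V E (s' dout) (s' din) u v) \<and>
     s' vN 0 = (\<Sum>x<n. s' dout x) \<and> s' vN' 0 = (\<Sum>x<n. s' din x)"

lemma tr_Prep:
  assumes vn: "s vn 0 = n" and adj: "\<And>u v. u < n \<Longrightarrow> v < n \<Longrightarrow> s adj (u * n + v) = of_bool ((u, v) \<in> E)"
    and M: "\<And>x. x < n \<Longrightarrow> s dout x \<le> M" "\<And>x. x < n \<Longrightarrow> s din x \<le> M"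
  shows "tr Prep s k_prep (prep_post s)"
  unfolding Prep_def k_prep_def
proof (rule tr_call[OF tr_Powers[where s = s, OF vn]], elim conjE)
  fix s1 assume sm1: "same {pw, vx} s s1" and pw1: "\<forall>x\<le>n. s1 pw x = 2 ^ x"
  have e1: "s1 dout = s dout" "s1 din = s din" "s1 vn = s vn" "s1 adj = s adj" using sameD[OF sm1] by auto
  have "\<forall>u<n. \<forall>v<n. s adj (u * n + v) = of_bool ((u, v) \<in> E)" using adj by blast
  then have g1: "genv s1" using vn pw1 unfolding genv_def e1 by blast
  have K: "tr Kernel s1 k_kernel (kernel_inv s1 E)"
    by (rule tr_Kernel[OF g1]) (use M in \<open>simp_all add: e1\<close>)
  show "tr (Seq Kernel (Seq (SumLoop vx vN (Cell dout (Var vx))) (SumLoop vx vN' (Cell din (Var vx))))) s1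
      (k_kernel + ((1 + kfor n 1) + (1 + kfor n 1))) (prep_post s)"
  proof (rule tr_call[OF K])
    fix s2 assume k2: "kernel_inv s1 E s2"
    have sm2: "same (check_vars \<union> {vu, vv, dout, din}) s1 s2" using k2 by (simp add: kernel_inv_def)
    have g2: "genv s2" using genv_same[OF g1 sm2] by simp
    have M2: "s2 dout x \<le> M" "s2 din x \<le> M" if "x < n" for x using k2 that by (auto simp: kernel_inv_def)
    have vn2: "s2 vn 0 = n" using g2 by (simp add: genv_def)
    have so: "(\<Sum>x<n. s2 dout x) < 2 ^ B" using sum_le_nM[of "s2 dout"] M2 sum_less by simp
    have si: "(\<Sum>x<n. s2 din x) < 2 ^ B" using sum_le_nM[of "s2 din"] M2 sum_less by simp
    have S1: "tr (SumLoop vx vN (Cell dout (Var vx))) s2 (1 + kfor n 1)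
        (\<lambda>s'. same {vN, vx} s2 s' \<and> s' vN 0 = (\<Sum>x<n. s2 dout x))"
    proof (rule tr_SumLoop[where s = s2 and f = "s2 dout", OF vn2])
      fix i s' assume sm: "same {vN, vx} s2 s'" and v: "s' vx 0 = i"
      show "val s' (Cell dout (Var vx)) = s2 dout i" using sameD[OF sm, of dout] v by simp
    qed (use so in simp_all)
    show "tr (Seq (SumLoop vx vN (Cell dout (Var vx))) (SumLoop vx vN' (Cell din (Var vx)))) s2
        ((1 + kfor n 1) + (1 + kfor n 1)) (prep_post s)"
    proof (rule tr_call[OF S1], elim conjE)
      fix s3 assume sm3: "same {vN, vx} s2 s3" and N3: "s3 vN 0 = (\<Sum>x<n. s2 dout x)"
      have vn3: "s3 vn 0 = n" using vn2 sameD[OF sm3, of vn] by simp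
      have e3: "s3 din = s2 din" "s3 dout = s2 dout" using sameD[OF sm3] by auto
      have "tr (SumLoop vx vN' (Cell din (Var vx))) s3 (1 + kfor n 1)
        (\<lambda>s'. same {vN', vx} s3 s' \<and> s' vN' 0 = (\<Sum>x<n. s2 din x))"
      proof (rule tr_SumLoop[where s = s3 and f = "s2 din", OF vn3])
        fix i s' assume sm: "same {vN', vx} s3 s'" and v: "s' vx 0 = i"
        show "val s' (Cell din (Var vx)) = s2 din i" using sameD[OF sm, of din] v e3 by simp
      qed (use si in simp_all)
      then show "tr (SumLoop vx vN' (Cell din (Var vx))) s3 (1 + kfor n 1) (prep_post s)"
      proof (rule tr_conseq, goal_cases)
        case (2 s4)
        then have sm4: "same {vN', vx} s3 s4" and N4: "s4 vN' 0 = (\<Sum>x<n. s2 din x)" by auto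
        have sm24: "same {vN, vN', vx} s2 s4" by (rule same_trans[OF sm3 sm4]) auto
        have "same prep_vars s1 s4" by (rule same_trans[OF sm2 sm24]) auto
        then have "same prep_vars s s4" by (rule same_trans[OF sm1]) auto
        moreover have "s4 dout = s2 dout" "s4 din = s2 din" "s4 vN 0 = s3 vN 0"
          using sameD[OF sm24] sameD[OF sm4, of vN] by auto
        moreover have "genv s4" using genv_same[OF g2 sm24] by simp
        ultimately show ?case using k2 N3 N4 e1 by (simp add: prep_post_def kernel_inv_def)
      qed simp
    qed
  qed
qed

definition k_setup :: "nat \<Rightarrow> nat" where
  "k_setup N = (1 + kfor n (kfor N 2)) + ((1 + kfor n (kfor N 2)) + (1 + (1 + 1)))"

abbreviation setup_vars :: "nat set" where
  "setup_vars \<equiv> {vra, vca, vt, vu, vv, vk, vD, vL}"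

lemma tr_Setup:
  assumes g: "genv s" and N: "s vN 0 = N" "N = (\<Sum>x<n. s dout x)" "N = (\<Sum>x<n. s din x)" "N \<le> n ^ 3"
    and k: "k = N + c" and D: "D = N * k + 1" and L: "L = (N + 1) * D" and rnd: "\<And>i. s rnd i = 0"
  shows "tr (Setup c) s (k_setup N) (\<lambda>s'. same setup_vars s s' \<and> det_machine.env n N k D L E s' \<and>
    slots_inv (s dout) N (s' vra) \<and> slots_inv (s din) N (s' vca))"
proof -
  interpret d: det_machine B I K n N k D L E by (rule det_machine[OF N(4) k D L])
  let ?Q = "\<lambda>s'. same setup_vars s s' \<and> d.env s' \<and> slots_inv (s dout) N (s' vra) \<and> slots_inv (s din) N (s' vca)"
  have vn: "s vn 0 = n" using g by (simp add: genv_def)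
  have S1: "tr (Slots dout vra) s (1 + kfor n (kfor N 2))
      (\<lambda>s'. same {vra, vt, vu, vv} s s' \<and> slots_inv (s dout) N (s' vra))"
    by (rule tr_Slots[where s = s, OF vn]) (use N d.NL in auto)
  show ?thesis
    unfolding Setup_def k_setup_def
  proof (rule tr_call[OF S1], elim conjE)
    fix s1 assume sm1: "same {vra, vt, vu, vv} s s1" and r1: "slots_inv (s dout) N (s1 vra)"
    have vn1: "s1 vn 0 = n" using vn sameD[OF sm1, of vn] by simp
    have e1: "s1 din = s din" using sameD[OF sm1] by auto
    have S2: "tr (Slots din vca) s1 (1 + kfor n (kfor N 2))
        (\<lambda>s'. same {vca, vt, vu, vv} s1 s' \<and> slots_inv (s1 din) N (s' vca))"
      by (rule tr_Slots[where s = s1, OF vn1]) (use N d.NL e1 in auto)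
    show "tr (Seq (Slots din vca) (Seq (Set vk (Add (Var vN) (Num c)))
     (Seq (Set vD (Add (Mul (Var vN) (Var vk)) (Num 1))) (Set vL (Mul (Add (Var vN) (Num 1)) (Var vD)))))) s1
      ((1 + kfor n (kfor N 2)) + (1 + (1 + 1))) ?Q"
    proof (rule tr_call[OF S2], elim conjE)
      fix s2 assume sm2: "same {vca, vt, vu, vv} s1 s2" and r2: "slots_inv (s1 din) N (s2 vca)"
      have sm: "same {vra, vca, vt, vu, vv} s s2" by (rule same_trans[OF sm1 sm2]) auto
      have g2: "genv s2" using genv_same[OF g sm] by simp
      have v2: "s2 vN 0 = N" "s2 vra = s1 vra" "s2 rnd = s rnd"
        using sameD[OF sm] sameD[OF sm2] N by auto
      define s3 where "s3 = upd (upd (upd s2 vk 0 k) vD 0 D) vL 0 L"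
      have sm3: "same setup_vars s s3"
        using same_mono[OF sm, of setup_vars] by (simp add: s3_def)
      have Dk: "k \<le> I" "D \<le> I" "L \<le> I"
      proof -
        show LI: "L \<le> I" by (rule d.NL)
        have "D \<le> L" using L by simp
        then show DI: "D \<le> I" using LI by simp
        show "k \<le> I" unfolding k by (rule k_le_I[OF N(4)])
      qed
      have env: "d.env s3"
        using g2 v2 r1 r2 rnd by (auto simp: d.env_def genv_def s3_def slots_inv_def)
      have post: "?Q s3" using sm3 env r1 r2 v2 e1 by (simp add: s3_def)
      have "tr (Set vL (Mul (Add (Var vN) (Num 1)) (Var vD))) (upd (upd s2 vk 0 k) vD 0 D) 1 ?Q"
        using post v2 L Dk I less_B[OF Dk(3)] by (intro tr_assign) (simp_all add: s3_def)
      then show "tr (Seq (Set vk (Add (Var vN) (Num c)))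
        (Seq (Set vD (Add (Mul (Var vN) (Var vk)) (Num 1))) (Set vL (Mul (Add (Var vN) (Num 1)) (Var vD))))) s2 (1 + (1 + 1)) ?Q"
        using v2 k D less_B[OF Dk(1)] less_B[OF Dk(2)] by (intro tr_set) simp_all
    qed
  qed
qed

text \<open>A bound independent of the run: the maximum over all values of \<open>N\<close> that
  pass the second test.\<close>

definition k_rest :: nat where
  "k_rest = Max ((\<lambda>N. let k = N + c; D = N * k + 1; L = (N + 1) * D in
     k_setup N + (det_machine.k_flips N k + det_machine.k_decide n N L)) ` {..n ^ 3})"

lemma perms_iff:
  assumes "slots_inv a N ra" "slots_inv b N ca"
  shows "conn_flow V E a b \<longleftrightarrow> conn_perms N ra ca V E \<noteq> {}"
  by (rule conn_flow_iff_perm) (use assms E in \<open>auto simp: slots_inv_def\<close>)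

text \<open>Solvable instances pass both tests of \<open>Prog\<close>.\<close>

lemma conn_flow_cases:
  assumes post: "prep_post s s'" and cf: "conn_flow V E (s dout) (s din)"
  shows "s' vN 0 = s' vN' 0" "s' vN 0 \<le> n ^ 3"
proof -
  have cf': "conn_flow V E (s' dout) (s' din)" using post cf by (simp add: prep_post_def)
  then show "s' vN 0 = s' vN' 0"
    using post flow_sum_eq[of V] by (auto simp: conn_flow_def prep_post_def)
  show "s' vN 0 \<le> n ^ 3"
    using irreducible_bound[OF _ E cf'] post by (auto simp: prep_post_def)
qed

lemma tr_core:
  assumes post: "prep_post s s1" and N: "N = s1 vN 0" "N = s1 vN' 0" "N \<le> n ^ 3"
    and zero: "\<And>i. s rnd i = 0" "\<And>i. s vW i = 0" "s ans 0 = 0"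
  shows "tr (Seq (Setup c) (Seq Flips Decide)) s1 k_rest (\<lambda>s'. s' ans 0 \<noteq> 0 \<longrightarrow> conn_flow V E (s dout) (s din))"
proof -
  define k where "k = N + c"
  define D where "D = N * k + 1"
  define L where "L = (N + 1) * D"
  interpret d: det_machine B I K n N k D L E by (rule det_machine[OF N(3) k_def D_def L_def])
  have sm: "same prep_vars s s1" and g: "genv s1" using post by (auto simp: prep_post_def)
  have z1: "s1 rnd = s rnd" "s1 vW = s vW" "s1 ans = s ans" using sameD[OF sm] by auto
  have NN: "N = (\<Sum>x<n. s1 dout x)" "N = (\<Sum>x<n. s1 din x)" using post N by (auto simp: prep_post_def)
  have S: "tr (Setup c) s1 (k_setup N) (\<lambda>s'. same setup_vars s1 s' \<and> d.env s' \<and>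
    slots_inv (s1 dout) N (s' vra) \<and> slots_inv (s1 din) N (s' vca))"
    by (rule tr_Setup[OF g N(1)[symmetric] NN N(3) k_def D_def L_def]) (simp add: z1 zero)
  have "tr (Seq (Setup c) (Seq Flips Decide)) s1 (k_setup N + (d.k_flips + d.k_decide))
      (\<lambda>s'. s' ans 0 \<noteq> 0 \<longrightarrow> conn_flow V E (s dout) (s din))"
  proof (rule tr_call[OF S], elim conjE)
    fix s2 assume sm2: "same setup_vars s1 s2" and env2: "d.env s2"
      and si: "slots_inv (s1 dout) N (s2 vra)" "slots_inv (s1 din) N (s2 vca)"
    show "tr (Seq Flips Decide) s2 (d.k_flips + d.k_decide) (\<lambda>s'. s' ans 0 \<noteq> 0 \<longrightarrow> conn_flow V E (s dout) (s din))"
    proof (rule tr_call[OF d.tr_Flips[OF env2]], elim conjE)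
      fix s3 assume env3: "d.env s3" and sm3: "same {rnd, vf} s2 s3"
      have e3: "s3 vW = s vW" "s3 ans = s ans" "s3 vra = s2 vra" "s3 vca = s2 vca"
        using sameD[OF sm3] sameD[OF sm2] z1 by auto
      have "tr Decide s3 d.k_decide (\<lambda>s'. s' ans 0 \<noteq> 0 \<longleftrightarrow> d.det_value (s3 vra) (s3 vca) (s3 rnd) \<noteq> 0)"
        by (rule d.tr_Decide[OF env3]) (use zero c k_def in \<open>simp_all add: e3\<close>)
      then show "tr Decide s3 d.k_decide (\<lambda>s'. s' ans 0 \<noteq> 0 \<longrightarrow> conn_flow V E (s dout) (s din))"
      proof (rule tr_conseq, goal_cases)
        case (2 s')
        \<comment> \<open>A sum over the empty set is 0, so a nonzero value exhibits a connected
          permutation; this is why acceptance is never wrong.\<close>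
        have "conn_perms N (s2 vra) (s2 vca) V E \<noteq> {}" if "d.det_value (s2 vra) (s2 vca) (s3 rnd) \<noteq> 0"
          using that by (auto simp: d.det_value_def)
        then show ?case using 2 perms_iff[OF si] post by (auto simp: e3 prep_post_def)
      qed simp
    qed
  qed
  then show ?thesis
  proof (rule tr_conseq)
    have "k_setup N + (d.k_flips + d.k_decide) \<in> (\<lambda>N. let k = N + c; D = N * k + 1; L = (N + 1) * D in
     k_setup N + (det_machine.k_flips N k + det_machine.k_decide n N L)) ` {..n ^ 3}"
      by (rule image_eqI[of _ _ N]) (use N in \<open>simp_all only: Let_def k_def D_def L_def atMost_iff\<close>)
    then show "k_setup N + (d.k_flips + d.k_decide) \<le> k_rest" unfolding k_rest_def by (intro Max_ge) auto
  qed
qed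

lemma val_test: "genv s \<Longrightarrow> val s (Sub (Add (Mul (Mul (Var vn) (Var vn)) (Var vn)) (Num 1)) (Var vN)) \<noteq> 0 \<longleftrightarrow> s vN 0 \<le> n ^ 3"
  by (auto simp: genv_def power3_eq_cube)

lemma tr_Prog:
  assumes vn: "s vn 0 = n" and adj: "\<And>u v. u < n \<Longrightarrow> v < n \<Longrightarrow> s adj (u * n + v) = of_bool ((u, v) \<in> E)"
    and M: "\<And>x. x < n \<Longrightarrow> s dout x \<le> M" "\<And>x. x < n \<Longrightarrow> s din x \<le> M"
    and zero: "\<And>i. s rnd i = 0" "\<And>i. s vW i = 0" "s ans 0 = 0"
  shows "tr (Prog c) s (k_prep + (k_rest + 1 + 1)) (\<lambda>s'. s' ans 0 \<noteq> 0 \<longrightarrow> conn_flow V E (s dout) (s din))"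
  unfolding Prog_def
proof (rule tr_call[OF tr_Prep[where s = s, OF vn adj M]])
  fix s1 assume post: "prep_post s s1"
  have g: "genv s1" and sm: "same prep_vars s s1" using post by (auto simp: prep_post_def)
  have a0: "s1 ans 0 = 0" using sameD[OF sm, of ans] zero by simp
  \<comment> \<open>The member for \<open>N = 0\<close>, with \<open>k = c\<close> and
    \<open>D = L = 1\<close>; it only serves to show that \<open>k_rest\<close> pays for a
    \<open>Skip\<close>.\<close>
  have setup0: "k_setup 0 + (det_machine.k_flips 0 c + det_machine.k_decide n 0 1) \<le> k_rest"
    unfolding k_rest_def by (intro Max_ge) (auto intro!: image_eqI[of _ _ 0])
  have "1 \<le> k_setup 0" by (simp add: k_setup_def)
  then have k1: "1 \<le> k_rest" using setup0 by linarith
  have skip: "tr Skip s1 k (\<lambda>s'. s' ans 0 \<noteq> 0 \<longrightarrow> conn_flow V E (s dout) (s din))" if "1 \<le> k" for k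
    by (rule tr_conseq[OF tr_skip[of "\<lambda>s'. s' = s1"]]) (use a0 that in auto)
  show "tr (Cond (EqE (Var vN) (Var vN')) (Cond (Sub (Add (Mul (Mul (Var vn) (Var vn)) (Var vn)) (Num 1)) (Var vN))
       (Seq (Setup c) (Seq Flips Decide)) Skip) Skip) s1 (k_rest + 1 + 1)
      (\<lambda>s'. s' ans 0 \<noteq> 0 \<longrightarrow> conn_flow V E (s dout) (s din))"
  proof (rule tr_cond)
    assume "val s1 (EqE (Var vN) (Var vN')) \<noteq> 0"
    then have eq: "s1 vN 0 = s1 vN' 0" by simp
    show "tr (Cond (Sub (Add (Mul (Mul (Var vn) (Var vn)) (Var vn)) (Num 1)) (Var vN))
       (Seq (Setup c) (Seq Flips Decide)) Skip) s1 (k_rest + 1) (\<lambda>s'. s' ans 0 \<noteq> 0 \<longrightarrow> conn_flow V E (s dout) (s din))"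
    proof (rule tr_cond)
      assume "val s1 (Sub (Add (Mul (Mul (Var vn) (Var vn)) (Var vn)) (Num 1)) (Var vN)) \<noteq> 0"
      then have "s1 vN 0 \<le> n ^ 3" using val_test[OF g] by blast
      then show "tr (Seq (Setup c) (Seq Flips Decide)) s1 k_rest (\<lambda>s'. s' ans 0 \<noteq> 0 \<longrightarrow> conn_flow V E (s dout) (s din))"
        using eq zero by (intro tr_core[OF post refl]) auto
    qed (rule skip[OF k1])
  qed (rule skip, simp)
qed

text \<open>Only \<open>Flips\<close> is random. Preparation and setup succeed surely, so the bound
  is shown for each of their outcomes; after \<open>Flips\<close>, every store with a nonzero
  \<open>det_value\<close> is accepted surely.\<close>

lemma prob_Prog:
  assumes vn: "s vn 0 = n" and adj: "\<And>u v. u < n \<Longrightarrow> v < n \<Longrightarrow> s adj (u * n + v) = of_bool ((u, v) \<in> E)"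
    and M: "\<And>x. x < n \<Longrightarrow> s dout x \<le> M" "\<And>x. x < n \<Longrightarrow> s din x \<le> M"
    and zero: "\<And>i. s rnd i = 0" "\<And>i. s vW i = 0" "s ans 0 = 0"
    and wf: "wf_store s" and K: "csize (Prog c) \<le> K" and c0: "store c0 = s"
    and cf: "conn_flow V E (s dout) (s din)"
  shows "1 - 1 / 2 ^ c \<le> measure (measure_spmf (sem (Prog c) c0)) {d. store d ans 0 \<noteq> 0}"
proof -
  have P: "tr Prep s k_prep (prep_post s)" by (rule tr_Prep[where s = s, OF vn adj M])
  have Ks: "csize Prep \<le> K" "csize (Setup c) \<le> K" "csize Flips \<le> K" "csize Decide \<le> K"
    using K by (simp_all add: Prog_def)
  let ?core = "Seq (Setup c) (Seq Flips Decide)"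
  let ?Q = "Cond (EqE (Var vN) (Var vN')) (Cond (Sub (Add (Mul (Mul (Var vn) (Var vn)) (Var vn)) (Num 1)) (Var vN)) ?core Skip) Skip"
  let ?A = "{d. store d ans 0 \<noteq> 0}"
  have "1 - 1 / 2 ^ c \<le> measure (measure_spmf (sem ?Q c1)) ?A" if c1: "c1 \<in> set_spmf (sem Prep c0)" for c1
  proof -
    define s1 where "s1 = store c1"
    have wf1: "wf_store s1" and post: "prep_post s s1"
      using tr_post[OF P Ks(1) wf c0 c1] by (auto simp: s1_def)
    have g: "genv s1" and sm: "same prep_vars s s1" using post by (auto simp: prep_post_def)
    define N where "N = s1 vN 0"
    have N: "N = s1 vN 0" "N = s1 vN' 0" "N \<le> n ^ 3" using conn_flow_cases[OF post cf] by (auto simp: N_def)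
    define k where "k = N + c"
    define D where "D = N * k + 1"
    define L where "L = (N + 1) * D"
    interpret d: det_machine B I K n N k D L E by (rule det_machine[OF N(3) k_def D_def L_def])
    have z1: "s1 rnd = s rnd" "s1 vW = s vW" "s1 ans = s ans" using sameD[OF sm] by auto
    have NN: "N = (\<Sum>x<n. s1 dout x)" "N = (\<Sum>x<n. s1 din x)" using post N by (auto simp: prep_post_def)
    have S: "tr (Setup c) s1 (k_setup N) (\<lambda>s'. same setup_vars s1 s' \<and> d.env s' \<and>
      slots_inv (s1 dout) N (s' vra) \<and> slots_inv (s1 din) N (s' vca))"
      by (rule tr_Setup[OF g N(1)[symmetric] NN N(3) k_def D_def L_def]) (simp add: z1 zero)
    obtain c1' where c1': "store c1' = s1" "sem ?Q c1 = sem ?core c1'"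
    proof
      let ?c = "charge (cost s1 (EqE (Var vN) (Var vN')) + 1) c1"
      let ?c' = "charge (cost s1 (Sub (Add (Mul (Mul (Var vn) (Var vn)) (Var vn)) (Num 1)) (Var vN)) + 1) ?c"
      show "store ?c' = s1" by (simp add: s1_def)
      have 1: "val s1 (EqE (Var vN) (Var vN')) \<noteq> 0" using N by simp
      have 2: "val s1 (Sub (Add (Mul (Mul (Var vn) (Var vn)) (Var vn)) (Num 1)) (Var vN)) \<noteq> 0"
        using val_test[OF g] N by simp
      have "sem ?Q c1 = sem (Cond (Sub (Add (Mul (Mul (Var vn) (Var vn)) (Var vn)) (Num 1)) (Var vN)) ?core Skip) ?c"
        unfolding sem.simps(5)[of "EqE (Var vN) (Var vN')"] Let_def s1_def[symmetric] by (rule if_P[OF 1])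
      also have "\<dots> = sem ?core ?c'"
        unfolding sem.simps(5)[of "Sub (Add (Mul (Mul (Var vn) (Var vn)) (Var vn)) (Num 1)) (Var vN)"] Let_def
          store_charge s1_def[symmetric] by (rule if_P[OF 2])
      finally show "sem ?Q c1 = sem ?core ?c'" .
    qed
    have "1 - 1 / 2 ^ c \<le> measure (measure_spmf (sem (Seq Flips Decide) c2)) ?A"
      if c2: "c2 \<in> set_spmf (sem (Setup c) c1')" for c2
    proof -
      define s2 where "s2 = store c2"
      have wf2: "wf_store s2" and sm2: "same setup_vars s1 s2" and env2: "d.env s2"
        and si: "slots_inv (s1 dout) N (s2 vra)" "slots_inv (s1 din) N (s2 vca)"
        using tr_post[OF S Ks(2) wf1 c1'(1) c2] by (auto simp: s2_def)
      have perms: "conn_perms N (s2 vra) (s2 vca) V E \<noteq> {}"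
        using perms_iff[OF si] post cf by (simp add: prep_post_def)
      let ?G = "{d. d.det_value (store d vra) (store d vca) (store d rnd) \<noteq> 0}"
      have "N / 2 ^ k \<le> 1 / (2::real) ^ c"
      proof -
        \<comment> \<open>Half of the exponent \<open>k = N + c\<close> compensates for the factor
          \<open>N\<close>; the other half is the error.\<close>
        have "real N \<le> 2 ^ N" using less_exp[of N] by (metis less_imp_le of_nat_le_iff of_nat_numeral of_nat_power)
        then show ?thesis by (simp add: k_def power_add field_simps)
      qed
      then have "1 - 1 / 2 ^ c \<le> 1 - N / 2 ^ k" by simp
      also have "\<dots> \<le> measure (measure_spmf (sem Flips c2)) ?G"
        by (rule d.prob_Flips[OF env2 _ perms]) (simp add: s2_def)
      also have "\<dots> \<le> measure (measure_spmf (bind_spmf (sem Flips c2) (sem Decide))) ?A"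
      proof (rule measure_bind_good)
        fix c3 assume c3: "c3 \<in> set_spmf (sem Flips c2)" and good: "c3 \<in> ?G"
        have wf3: "wf_store (store c3)" and env3: "d.env (store c3)" and sm3: "same {rnd, vf} s2 (store c3)"
          using tr_post[OF d.tr_Flips[OF env2] Ks(3) wf2 _ c3] by (auto simp: s2_def)
        have "store c3 vW = s vW" "store c3 ans = s ans" using sameD[OF sm3] sameD[OF sm2] z1 by auto
        then have T: "tr Decide (store c3) d.k_decide (\<lambda>s'. s' ans 0 \<noteq> 0 \<longleftrightarrow>
            d.det_value (store c3 vra) (store c3 vca) (store c3 rnd) \<noteq> 0)"
          using zero c k_def by (intro d.tr_Decide[OF env3]) simp_all
        show "lossless_spmf (sem Decide c3) \<and> set_spmf (sem Decide c3) \<subseteq> ?A"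
          using tr_lossless[OF T Ks(4) wf3 refl] tr_post[OF T Ks(4) wf3 refl] good by auto
      qed
      finally show ?thesis by simp
    qed
    moreover have "lossless_spmf (sem (Setup c) c1')" by (rule tr_lossless[OF S Ks(2) wf1 c1'(1)])
    ultimately show ?thesis unfolding c1'(2) sem.simps(4)[of "Setup c"] by (rule measure_bind_ge[rotated])
  qed
  then show ?thesis unfolding Prog_def sem.simps(4)[of Prep]
    by (rule measure_bind_ge[OF tr_lossless[OF P Ks(1) wf c0]])
qed

lemma lim_total: "lim (2 ^ n * (M + 1)) 25 (k_prep + (k_rest + 1 + 1))"
proof -
  let ?W = "2 ^ n * (M + 1)"
  have nI': "n \<le> I" using nI by simp
  have W1: "(1::nat) \<le> 2 ^ n" and W2: "2 ^ n \<le> ?W" by simp_all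
  have W: "1 \<le> ?W" using W1 W2 by (rule le_trans)
  have one: "lim 1 1 1" and two: "lim 1 1 2" and three: "lim 1 1 3" by (rule lim_const, simp)+
  note one' = lim_bump[OF one W order.refl]
  have loop: "lim 1 3 (1 + (n * (1 + 2) + 2))"
    by (rule lim_bump[OF lim_add[OF one lim_for[OF one nI']]]) simp_all
  have nb: "lim 1 4 k_nb" unfolding k_nb_def
    by (rule lim_bump[OF lim_for[OF lim_add[OF one lim_for[OF two nI']] nI']]) simp_all
  have set: "lim 1 6 k_set" unfolding k_set_def
    by (rule lim_bump[OF lim_add[OF loop lim_add[OF nb lim_add[OF loop three]]]]) simp_all
  have three': "lim (2 ^ n * 1) 1 3" by (rule lim_bump[OF three]) simp_all
  have check: "lim (2 ^ n) 8 k_check" unfolding k_check_def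
    by (rule lim_bump[OF lim_add[OF three' lim_mult[OF set order.refl]]]) simp_all
  \<comment> \<open>The loop of \<open>Reduce\<close> with its \<open>M + 1\<close> rounds, each
    enumerating \<open>2 ^ n\<close> sets.\<close>
  have "lim ((M + 1) * 2 ^ n) 10 ((M + 1) * (k_check + 3 + 2) + 2)"
    by (rule lim_bump[OF lim_mult[OF lim_add[OF check lim_bump[OF three W1 order.refl]] order.refl]]) simp_all
  then have "lim ?W 10 ((M + 1) * (k_check + 3 + 2) + 2)" by (simp only: mult.commute)
  moreover have "(M + 1) * ((k_check + 3) + 1) + 1 + 2 \<le> (M + 1) * (k_check + 3 + 2) + 2 + 2"
    by (intro add_mono mult_le_mono) simp_all
  ultimately have while: "lim ?W 10 ((M + 1) * ((k_check + 3) + 1) + 1)" unfolding lim_def by linarith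
  have red: "lim ?W 11 k_reduce" unfolding k_reduce_def
    by (rule lim_bump[OF lim_add[OF one' while]]) simp_all
  have kern: "lim ?W 14 k_kernel" unfolding k_kernel_def
    by (rule lim_bump[OF lim_for[OF lim_for[OF lim_add[OF red one'] nI'] nI']]) simp_all
  note loop' = lim_bump[OF loop W order.refl]
  have prep: "lim ?W 16 k_prep" unfolding k_prep_def
    by (rule lim_bump[OF lim_add[OF loop' lim_add[OF kern lim_add[OF loop' loop']]]]) simp_all
  have rest1: "lim (2 ^ n) 20 (let k = N + c; D = N * k + 1; L = (N + 1) * D in
     k_setup N + (det_machine.k_flips N k + det_machine.k_decide n N L))" if N: "N \<le> n ^ 3" for N
  proof -
    define k where "k = N + c"
    define D where "D = N * k + 1"
    define L where "L = (N + 1) * D"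
    interpret d: det_machine B I K n N k D L E by (rule det_machine[OF N k_def D_def L_def])
    have sl: "lim 1 4 (1 + (n * ((N * (2 + 2) + 2) + 2) + 2))"
      by (rule lim_bump[OF lim_add[OF one lim_for[OF lim_for[OF two d.NL(1)] nI']]]) simp_all
    have st: "lim (2 ^ n) 7 (k_setup N)" unfolding k_setup_def
      by (rule lim_bump[OF lim_add[OF sl lim_add[OF sl lim_add[OF one lim_add[OF one one]]]]]) simp_all
    have "lim (2 ^ n) 20 (k_setup N + (d.k_flips + d.k_decide))"
      by (rule lim_bump[OF lim_add[OF st lim_add[OF lim_bump[OF d.lim_flips W1 order.refl] d.lim_decide]]]) simp_all
    then show ?thesis unfolding Let_def k_def D_def L_def .
  qed
  have "k_rest \<in> (\<lambda>N. let k = N + c; D = N * k + 1; L = (N + 1) * D in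
     k_setup N + (det_machine.k_flips N k + det_machine.k_decide n N L)) ` {..n ^ 3}"
    unfolding k_rest_def by (rule Max_in) auto
  then obtain N where "N \<le> n ^ 3" and e: "k_rest = (let k = N + c; D = N * k + 1; L = (N + 1) * D in
     k_setup N + (det_machine.k_flips N k + det_machine.k_decide n N L))" by (elim imageE) simp
  then have "lim (2 ^ n) 20 k_rest" unfolding e by (intro rest1)
  note rest = lim_bump[OF this W2 order.refl]
  show ?thesis
    by (rule lim_bump[OF lim_add[OF prep lim_add[OF lim_add[OF rest one'] one']]]) simp_all
qed

end

lemma (in machine) tr_bounds: "tr p s k Q \<Longrightarrow> csize p \<le> K \<Longrightarrow> wf_store s \<Longrightarrow> store c = s \<Longrightarrow> peak c \<le> space \<Longrightarrow>
    c' \<in> set_spmf (sem p c) \<Longrightarrow> steps c' \<le> steps c + k * op_cost \<and> peak c' \<le> space"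
  by (auto simp: tr_def)

section \<open>Polynomial bounds in the size of the instance\<close>

lemma poly_nat_mono: "x \<le> y \<Longrightarrow> poly p x \<le> poly p (y :: nat)"
  by (induction p) (auto intro: add_mono mult_mono)

text \<open>The bound on \<open>I\<close> demanded by \<open>main_machine\<close>, written as a
  polynomial in \<open>n\<close>.\<close>

definition index_poly :: "nat \<Rightarrow> nat poly" where
  "index_poly c = (let X = [:0, 1:]; N = X ^ 3; k = N + [:c:]; D = N * k + 1; L = (N + 1) * D in
     (N * N + 6) * L + N * N * k + X * X + X + N + 2)"

lemma poly_index_poly: "poly (index_poly c) n = (let N = n ^ 3; k = N + c; D = N * k + 1; L = (N + 1) * D in
     (N * N + 6) * L + N * N * k + n * n + n + N + 2)"
  by (simp only: index_poly_def Let_def poly_add poly_mult poly_power poly_pCons poly_0 poly_1 poly_numeral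
      mult_zero_right mult_1_right add_0_right add_0_left)

lemma len_le_self: "len x \<le> x"
  by (rule len_le) (rule less_exp)

text \<open>A vertex attaining the maximum contributes the length of \<open>M\<close> to
  \<open>S\<close>, hence \<open>M < 2 ^ S\<close>. The upper bound on \<open>S\<close> later turns
  word lengths into a time bound in \<open>n\<close> and \<open>M\<close>.\<close>

lemma input_size_bounds:
  fixes G :: "nat pair_pre_digraph" and d_in d_out :: "nat \<Rightarrow> nat"
  assumes "finite (pverts G)" "pverts G \<noteq> {}"
  defines "n \<equiv> card (pverts G)" and "M \<equiv> max_degree G d_in d_out" and "S \<equiv> input_size G d_in d_out"
  shows "v \<in> pverts G \<Longrightarrow> d_in v \<le> M" "v \<in> pverts G \<Longrightarrow> d_out v \<le> M"
    "n ^ 2 \<le> S" "S \<le> n ^ 2 + n * (M + M)" "M < 2 ^ S"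
proof -
  show le: "d_in v \<le> M" "d_out v \<le> M" if "v \<in> pverts G" for v
  proof -
    have "max (d_in v) (d_out v) \<le> M" unfolding M_def max_degree_def using assms(1) that by (intro Max_ge) auto
    then show "d_in v \<le> M" "d_out v \<le> M" by simp_all
  qed
  show "n ^ 2 \<le> S" by (simp add: n_def S_def input_size_def)
  have "len (d_in v) + len (d_out v) \<le> M + M" if "v \<in> pverts G" for v
    using le[OF that] len_le_self[of "d_in v"] len_le_self[of "d_out v"] by linarith
  then have "(\<Sum>v\<in>pverts G. len (d_in v) + len (d_out v)) \<le> n * (M + M)"
    unfolding n_def by (rule sum_bounded_above[of "pverts G" _ "M + M", simplified])
  then show "S \<le> n ^ 2 + n * (M + M)" by (simp add: n_def S_def input_size_def)
  have "M \<in> (\<lambda>v. max (d_in v) (d_out v)) ` pverts G"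
    unfolding M_def max_degree_def using assms(1,2) by (intro Max_in) auto
  then obtain v where v: "v \<in> pverts G" "M = max (d_in v) (d_out v)" by auto
  have "len M \<le> len (d_in v) + len (d_out v)" unfolding v(2) by (cases "d_in v \<le> d_out v") simp_all
  also have "\<dots> \<le> (\<Sum>v\<in>pverts G. len (d_in v) + len (d_out v))"
    using assms(1) v(1) by (intro member_le_sum) auto
  also have "\<dots> \<le> S" by (simp add: S_def input_size_def)
  finally have "(2::nat) ^ len M \<le> 2 ^ S" by (intro power_increasing) auto
  then show "M < 2 ^ S" using less_2_pow_len[of M] by linarith
qed

theorem theorem6:
  fixes p :: real
  assumes "p < 1"
  shows "\<exists>(P :: com) (q_n :: nat poly) (q_M :: nat poly) (q_space :: nat poly).
    \<forall>(G :: nat pair_pre_digraph) (d_in :: nat \<Rightarrow> nat) (d_out :: nat \<Rightarrow> nat). encodable G \<longrightarrow>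
      (let n = card (pverts G); M = max_degree G d_in d_out; R = run P G d_in d_out in
        lossless_spmf R \<and>
        (\<forall>c \<in> set_spmf R.
           steps c \<le> 2 ^ n * poly q_n n * poly q_M M \<and>
           peak c \<le> poly q_space (input_size G d_in d_out)) \<and>
        (\<forall>c \<in> set_spmf R. accepts c \<longrightarrow> fdcs_solvable G d_in d_out) \<and>
        (fdcs_solvable G d_in d_out \<longrightarrow> measure (measure_spmf R) {c. accepts c} \<ge> p))"
proof -
  obtain c0 where c0: "(1 / 2 :: real) ^ c0 < 1 - p"
    \<comment> \<open>The successor taken next ensures at least one random bit per entry even when
      \<open>N = 0\<close>.\<close>
    using real_arch_pow_inv[of "1 - p" "1 / 2"] assms by auto
  define c where "c = Suc c0"
  have c: "1 \<le> c" and p_le: "p \<le> 1 - 1 / 2 ^ c"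
  proof -
    have "1 / 2 ^ c \<le> (1 / 2 :: real) ^ c0" by (simp add: c_def power_one_over field_simps)
    then show "p \<le> 1 - 1 / 2 ^ c" using c0 by simp
  qed (simp add: c_def)
  \<comment> \<open>The 4 accounts for the input arrays 0 to 3.\<close>
  define K where "K = csize (Prog c) + 4"
  define q_I where "q_I = index_poly c"
  \<comment> \<open>The word length is at most \<open>poly q_Y n * (M + 1)\<close>, used for the
    time; for the space it is bounded by \<open>q_B\<close> in the input size instead.\<close>
  define q_Y where "q_Y = q_I + [:1, 3:] + [:0, 1:] ^ 2"
  \<comment> \<open>The exponent 25 comes from \<open>lim_total\<close>, the square from the cost of
    an operation.\<close>
  define q_n where "q_n = (q_I + 4) ^ 25 * (3 * (q_Y * [:K:]) ^ 2)"
  \<comment> \<open>One factor \<open>M + 1\<close> from \<open>Reduce\<close>, two from the squared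
    word length.\<close>
  define q_M :: "nat poly" where "q_M = [:1, 1:] ^ 3"
  define q_B where "q_B = q_I + [:1, 2:]"
  define q_space where "q_space = [:K:] * q_I * (1 + q_I + q_B) + 3 * (q_B * [:K:]) ^ 2"
  show ?thesis
  proof (rule exI[of _ "Prog c"], rule exI[of _ q_n], rule exI[of _ q_M], rule exI[of _ q_space], intro allI impI)
    fix G :: "nat pair_pre_digraph" and d_in d_out :: "nat \<Rightarrow> nat"
    assume enc: "encodable G"
    then have G: "pair_fin_digraph G" by (simp add: encodable_def)
    interpret pair_fin_digraph G by (rule G)
    define n where "n = card (pverts G)"
    define M where "M = max_degree G d_in d_out"
    define S where "S = input_size G d_in d_out"
    define s where "s = input_store G d_in d_out"
    define I where "I = poly q_I n"
    \<comment> \<open>\<open>S\<close> bits hold any degree and \<open>n + S\<close> bits any sum of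
      degrees; \<open>I\<close> makes all indices fit as well.\<close>
    define B where "B = I + n + S + 1"
    obtain n' where n': "1 \<le> n'" "pverts G = {..<n'}" using enc by (auto simp: encodable_def)
    then have "n = n'" by (simp add: n_def)
    then have V: "pverts G = {..<n}" and n1: "1 \<le> n" using n' by simp_all
    have "0 < n" using n1 by simp
    then have ne: "pverts G \<noteq> {}" by (auto simp: V)
    have E: "parcs G \<subseteq> {..<n} \<times> {..<n}" unfolding V[symmetric] using wellformed' by auto
    have deg: "d_in v \<le> M" "d_out v \<le> M" if "v < n" for v
      using input_size_bounds(1)[of G v d_in d_out] input_size_bounds(2)[of G v d_out d_in] ne that
      by (simp_all add: V M_def)
    have S: "n ^ 2 \<le> S" "S \<le> n ^ 2 + n * (M + M)" "M < 2 ^ S"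
      using input_size_bounds(3-5)[OF pair_finite_verts ne, of d_in d_out] by (simp_all only: n_def M_def S_def)
    have I_eq: "I = (let N = n ^ 3; k = N + c; D = N * k + 1; L = (N + 1) * D in
        (N * N + 6) * L + N * N * k + n * n + n + N + 2)"
      unfolding I_def q_I_def by (rule poly_index_poly)
    have ge: "x \<le> a + b + x + n + y + 2" "n + 1 \<le> a + b + x + n + y + 2" for a b x y :: nat by linarith+
    have In: "n * n \<le> I" "n + 1 \<le> I" unfolding I_eq Let_def by (rule ge)+
    then have I1: "1 \<le> I" by simp
    have pow: "(2::nat) ^ x < 2 ^ B" if "x < B" for x using that by (rule power_strict_increasing) simp
    have less: "x < 2 ^ B" if "x < B" for x using less_exp[of x] pow[OF that] by (rule less_trans)
    have "Suc n \<le> 2 ^ n" "Suc M \<le> 2 ^ S" by (rule Suc_leI, fact less_exp S(3))+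
    then have "Suc n * Suc M \<le> 2 ^ n * 2 ^ S" by (rule mult_le_mono)
    then have MB: "(n + 1) * (M + 1) \<le> 2 ^ (n + S)" by (simp only: power_add Suc_eq_plus1)
    have M_less: "M < 2 ^ B" using S(3) by (rule less_trans) (rule pow, simp add: B_def)
    interpret m: main_machine B I K n M "parcs G" c
    proof
      have "n * M + n + 1 \<le> (n + 1) * (M + 1)" by simp
      also note MB
      also have "2 ^ (n + S) < (2::nat) ^ B" by (rule pow) (simp add: B_def)
      finally show "n * M + n + 1 < 2 ^ B" .
      show "I < 2 ^ B" by (rule less) (simp add: B_def)
      show "(2::nat) ^ n < 2 ^ B" by (rule pow) (simp add: B_def)
      show "1 \<le> B" by (simp add: B_def)
    qed (fact n1 E In I1 c eq_refl[OF I_eq[symmetric]])+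
    have s: "s 0 = (\<lambda>i. if i = 0 then n else 0)"
      "s 1 = (\<lambda>i. if i < n * n \<and> (i div n, i mod n) \<in> parcs G then 1 else 0)"
      "s 2 = (\<lambda>v. if v < n then d_in v else 0)" "s 3 = (\<lambda>v. if v < n then d_out v else 0)"
      "\<And>a. 4 \<le> a \<Longrightarrow> s a = (\<lambda>_. 0)"
      by (auto simp: s_def input_store_def Let_def n_def)
    have wf: "m.wf_store s"
      unfolding m.wf_store_def
    proof (intro allI)
      fix a i :: nat
      have "a = 0 \<or> a = 1 \<or> a = 2 \<or> a = 3 \<or> 4 \<le> a" by linarith
      moreover have "n < 2 ^ B" "(1::nat) < 2 ^ B" by (rule less, use In(2) in \<open>simp add: B_def\<close>)+
      moreover have "d_in i < 2 ^ B" "d_out i < 2 ^ B" if "i < n" using deg[OF that] M_less by auto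
      ultimately show "s a i < 2 ^ B \<and> (s a i \<noteq> 0 \<longrightarrow> a < K \<and> i < I)"
        using In unfolding K_def by (elim disjE) (auto simp: s s(2)[unfolded One_nat_def])
    qed
    have adj: "s 1 (u * n + v) = of_bool ((u, v) \<in> parcs G)" if "u < n" "v < n" for u v
    proof -
      have "(u + 1) * n \<le> n * n" using that by (intro mult_le_mono1) simp
      then show ?thesis using that unfolding s(2) by simp
    qed
    have cf: "conn_flow {..<n} (parcs G) (s 3) (s 2) \<longleftrightarrow> fdcs_solvable G d_in d_out"
      unfolding fdcs_solvable_iff[OF G ne] V conn_flow_def flow_def by (simp add: s)
    have vn: "s 0 0 = n" by (simp add: s)
    have ds: "s 3 x \<le> M" "s 2 x \<le> M" if "x < n" for x using deg[OF that] that by (simp_all add: s)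
    have zero: "s 24 i = 0" "s 26 i = 0" "s 4 0 = 0" for i by (simp_all add: s)
    let ?c0 = "\<lparr> store = s, steps = 0, peak = store_size s \<rparr>"
    let ?k = "m.k_prep + (m.k_rest + 1 + 1)"
    have run: "run (Prog c) G d_in d_out = sem (Prog c) ?c0" by (simp add: run_def s_def Let_def)
    have T: "m.tr (Prog c) s ?k (\<lambda>s'. s' 4 0 \<noteq> 0 \<longrightarrow> conn_flow {..<n} (parcs G) (s 3) (s 2))"
      by (rule m.tr_Prog[where s = s, OF vn adj ds zero])
    have K: "csize (Prog c) \<le> K" by (simp add: K_def)
    have peak0: "store_size s \<le> m.space" using m.store_size_bound[OF wf] by (rule add_leD1)
    have st: "store ?c0 = s" and pk: "peak ?c0 \<le> m.space" using peak0 by simp_all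
    note lossless = m.tr_lossless[OF T K wf st]
    have sound: "store c' 4 0 \<noteq> 0 \<Longrightarrow> fdcs_solvable G d_in d_out" if "c' \<in> set_spmf (sem (Prog c) ?c0)" for c'
      using m.tr_post[OF T K wf st that] cf by blast
    have bounds: "steps c' \<le> ?k * m.op_cost" "peak c' \<le> m.space" if "c' \<in> set_spmf (sem (Prog c) ?c0)" for c'
      using m.tr_bounds[OF T K wf st pk that] by simp_all
    have time: "?k * m.op_cost \<le> 2 ^ n * poly q_n n * poly q_M M"
    proof -
      have "B \<le> I + n + 1 + n ^ 2 + n * (M + M)" using S(2) by (simp add: B_def)
      also have "\<dots> \<le> (I + n + 1 + n ^ 2) * (M + 1) + 2 * n * (M + 1)" by (simp add: algebra_simps)
      also have "\<dots> = poly q_Y n * (M + 1)" by (simp add: q_Y_def I_def algebra_simps power2_eq_square)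
      finally have "B * K \<le> poly q_Y n * (M + 1) * K" by (rule mult_le_mono1)
      then have "(B * K)\<^sup>2 \<le> (poly q_Y n * (M + 1) * K)\<^sup>2" by (rule power_mono) simp
      moreover have "?k \<le> 2 ^ n * (M + 1) * (I + 4) ^ 25" using m.lim_total unfolding m.lim_def by linarith
      ultimately have "?k * m.op_cost \<le> 2 ^ n * (M + 1) * (I + 4) ^ 25 * (3 * (poly q_Y n * (M + 1) * K)\<^sup>2)"
        unfolding m.op_cost_def by (intro mult_le_mono order.refl)
      also have "\<dots> = 2 ^ n * ((I + 4) ^ 25 * (3 * (poly q_Y n * K)\<^sup>2)) * (M + 1) ^ 3"
        by (simp only: power_mult_distrib power2_eq_square power3_eq_cube mult_ac)
      also have "\<dots> = 2 ^ n * poly q_n n * poly q_M M" by (simp add: q_n_def q_M_def I_def mult_ac)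
      finally show ?thesis .
    qed
    have space: "m.space \<le> poly q_space S"
    proof -
      have nS: "n \<le> S" using S(1) self_le_power[OF n1, of 2] by simp
      have I': "I \<le> poly q_I S" unfolding I_def by (rule poly_nat_mono[OF nS])
      have B': "B \<le> poly q_B S" using I' nS by (simp add: B_def q_B_def)
      have "m.space \<le> K * poly q_I S * (1 + poly q_I S + poly q_B S) + 3 * (poly q_B S * K)\<^sup>2"
        unfolding m.space_def m.op_cost_def using I' B' len_le_self[of I]
        by (intro add_mono mult_le_mono power_mono order.refl) simp_all
      also have "\<dots> = poly q_space S" by (simp add: q_space_def algebra_simps)
      finally show ?thesis .
    qed
    have prob: "p \<le> measure (measure_spmf (sem (Prog c) ?c0)) {c. accepts c}" if "fdcs_solvable G d_in d_out"
      unfolding accepts_def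
      by (rule order_trans[OF p_le m.prob_Prog[where s = s, OF vn adj ds zero wf K]]) (use that cf in simp_all)
    show "let n = card (pverts G); M = max_degree G d_in d_out; R = run (Prog c) G d_in d_out in
        lossless_spmf R \<and>
        (\<forall>c \<in> set_spmf R.
           steps c \<le> 2 ^ n * poly q_n n * poly q_M M \<and>
           peak c \<le> poly q_space (input_size G d_in d_out)) \<and>
        (\<forall>c \<in> set_spmf R. accepts c \<longrightarrow> fdcs_solvable G d_in d_out) \<and>
        (fdcs_solvable G d_in d_out \<longrightarrow> measure (measure_spmf R) {c. accepts c} \<ge> p)"
      unfolding Let_def run n_def[symmetric] M_def[symmetric] S_def[symmetric]
      using lossless sound bounds[THEN le_trans] time space prob unfolding accepts_def by blast
  qed
qed

end
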